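(* Let $p_n=(F,X,\Gamma,\theta)$ be a Weyl preseed in $\mathcal{D}_n$, with $X=\{x_1,\dots,x_n\}$. Then: (1) For each $k\in[1,n]$, the right mutation $\mu_k^R$ induces an isomorphism between the generalized Weyl algebras $H^R(p_n)$ and $H^R(\mu_k^R(p_n))$, and the left mutation $\mu_k^L$ induces an isomorphism between the generalized Weyl algebras $H^L(p_n)$ and $H^L(\mu_k^L(p_n))$. (2) The Weyl cluster algebra $\mathcal{H}(p_n)$ is a subring of the (non-commutative) ring of Laurent polynomials in the initial exchange cluster variables $x_1,\dots,x_n$ with coefficients from the ring of polynomials $R_n[\theta_1^{\pm1}(\xi_1^{-1}),\dots,\theta_n^{\pm1}(\xi_n^{-1})]$. (3) Let $p_1(x_k)$ be the rank one preseed $(\{F_k\},\{x_k\},\{\Gamma_k\},\{\theta_k\})$. Then $$\mathcal{H}(p_n)\cong\mathcal{H}(p_1(x_1))\otimes\cdots\otimes\mathcal{H}(p_1(x_n)),$$ where the tensor product is over $K$.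
   Context: Throughout, $K$ is a field of characteristic zero and $[1,k]=\{1,\dots,k\}$. Ambient rings. For $i\in[1,n]$ let $F_i=\{f_{i1},\dots,f_{im_i}\}$ be a finite set of "frozen variables"; $\mathbb{P}_i$ is the free abelian group (written multiplicatively) with generating set $F_1\cup\dots\cup F_i$, and $R_i=K[\mathbb{P}_i]$ is its group ring. $D_1\subset D_2\subset\dots\subset D_n$ are Ore domains with $R_i\subset D_i$, together with elements $t_i\in D_i$ (with $t_i^{-1}\in D_i$) such that $t_it_j=t_jt_i$ and $t_if_{jr}=f_{jr}t_i$ for all $i\ne j$ and $r\in[1,m_j]$, and the monomials $t_1^{\alpha_1}\cdots t_i^{\alpha_i}$, $\alpha_1,\dots,\alpha_i\in\mathbb{Z}$, form a basis of $D_i$ as a left $R_i$-module. $\mathcal{D}_i$ is the division ring of right fractions $ab^{-1}$, $a,b\in D_i$, $b\neq0$; so $\mathcal{D}_1\subset\dots\subset\mathcal{D}_n$. Star quivers. A valued quiver has vertices, arrows (no loops, no 2-cycles), and each arrow $i\to j$ carries a valuation $(v_{ij},v_{ji})$ of positive integers, for which there are positive integers $d_i$ with $d_iv_{ij}=v_{ji}d_j$. It is a star quiver with center $k$ if every arrow starts or ends at $k$. Preseeds. A preseed of rank $n$ in $\mathcal{D}_n$ is a triple $(F,X,\Gamma)$ with $F=\{F_1,\dots,F_n\}$, $X=\{x_1,\dots,x_n\}$, $\Gamma=\{\Gamma_1,\dots,\Gamma_n\}$ such that for each $k$: $x_k\in\mathcal{D}_k$ is the image of $t_k$ under some $R_k$-linear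 automorphism of $\mathcal{D}_k$ fixing the frozen variables, and $\Gamma_k$ is a star quiver with $m_k+1$ vertices, whose center corresponds to $x_k$ and whose other vertices correspond to $f_{k1},\dots,f_{km_k}$. The $x_k$ are the (initial) exchange cluster variables. Mutations. Put $\xi_k=\prod_{j\to k}f_{kj}^{v_{jk}}+\prod_{k\to j}f_{kj}^{v_{kj}}$ (products over the arrows of $\Gamma_k$ into, respectively out of, its center $k$). The right mutation $\mu_k^R$ (left mutation $\mu^L_k$) replaces $x_k$ by $\mu_k^R(x_k)=\xi_kx_k^{-1}$ (by $\mu_k^L(x_k)=x_k^{-1}\xi_k$), keeps $x_i$ for $i\neq k$, keeps $F$, and replaces $\Gamma_k$ by the quiver with all arrows reversed (components of the valuations switched), keeping the other $\Gamma_i$. A cluster variable of $p_n$ is an element of some cluster obtained from $p_n$ by a finite (possibly empty) sequence of right or left mutations; $\mathcal{X}(p_n)$ is the set of all of them. Weyl preseeds. $(F,X,\Gamma,\theta)$ is a Weyl preseed if $(F,X,\Gamma)$ is a preseed of rank $n$ and $\theta=\{\theta_1,\dots,\theta_n\}$ is a set of ring automorphisms of $R_n$ (extended so as to fix all exchange cluster variables) such that $x_i^{\pm1}f=\theta_i^{\pm1}(f)x_i^{\pm1}$ for all $f\in F_i$ and $i\in[1,n]$. The Weyl cluster algebra $\mathcal{H}(p_n)$ is the $R_n$-subalgebra of $\mathcal{D}_n$ generated by $\mathcal{X}(p_n)$; for the rank one preseed $p_1(x_k)$ the coefficient ring is the group ring over $K$ of the free abelian group generated by $F_k$. Algebras $H^R$,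 $H^L$. Let $R=K[\xi_1,\dots,\xi_n]$. $H^R(p_n)$ is the ring extension of $R$ (inside $\mathcal{D}_n$) generated by $\mu_1^R(x_1),\dots,\mu_n^R(x_n),x_1,\dots,x_n$, and $H^L(p_n)$ is the ring extension of $R$ generated by $x_1,\dots,x_n,\mu_1^L(x_1),\dots,\mu_n^L(x_n)$. The isomorphism induced by $\mu_k^R$ (resp. $\mu_k^L$) is one sending $x_k$ to $\mu_k^R(x_k)$ (resp. $\mu_k^L(x_k)$). A generalized Weyl algebra $R(\theta,\xi,n)$ over a commutative ring $R$ with elements $\xi_1,\dots,\xi_n\in R$ and automorphisms $\theta_i$ of $R$ with $\theta_i(\xi_j)=\xi_j$ for $i\ne j$ is the ring extension of $R$ generated by $x_1,\dots,x_n,y_1,\dots,y_n$ with relations $x_ir=\theta_i(r)x_i$, $y_ir=\theta_i^{-1}(r)y_i$ ($r\in R$), $x_iy_i=\xi_i$, $y_ix_i=\theta_i^{-1}(\xi_i)$, and $x_iy_j=y_jx_i$, $x_ix_j=x_jx_i$, $y_iy_j=y_jy_i$ for $i\neq j$.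
   Formalization: Assumes the x_i commute and are Laurent-independent over R_n. GWA claims assume each θ_i restricts to K[ξ_1,…,ξ_n], fixing K and ξ_j (j≠i); (3) assumes θ_k preserves K[F_k^±]. The induced isomorphism fixes μ_k(x_k) and sends x_k to μ_k(μ_k(x_k)), since x_k↦μ_k(x_k) can fail. *)

theory Defs
  imports "HOL-Algebra.Algebra" "HOL-Algebra.Algebraic_Closure_Type"
begin

section \<open>Rings living inside a division ring type\<close>

text \<open>
  The division ring of right fractions of the largest Ore domain is the type \<open>'d\<close>; all other rings
  inside it are subsets, turned into HOL-Algebra records by restricting the carrier.
\<close>

abbreviation DD :: "'d::division_ring ring"
  where "DD \<equiv> ring_of_type_algebra"

abbreviation sub_ring :: "'d::division_ring set \<Rightarrow> 'd ring"
  where "sub_ring A \<equiv> DD \<lparr> carrier := A \<rparr>"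

definition right_fractions :: "'d::division_ring set \<Rightarrow> 'd set"
  where "right_fractions A = {a * inverse b | a b. a \<in> A \<and> b \<in> A \<and> b \<noteq> 0}"

definition ore_domain :: "'d::division_ring set \<Rightarrow> bool"
  where "ore_domain A \<longleftrightarrow> subring A DD \<and>
     (\<forall>a\<in>A - {0}. \<forall>b\<in>A - {0}.
        (\<exists>c\<in>A. \<exists>d\<in>A. a * c = b * d \<and> a * c \<noteq> 0) \<and>
        (\<exists>c\<in>A. \<exists>d\<in>A. c * a = d * b \<and> c * a \<noteq> 0))"

text \<open>
  A Laurent monomial is written in increasing order of the indices, and an exponent vector is a
  finitely supported function.
\<close>

definition laurent_monomial :: "(nat \<Rightarrow> 'd::division_ring) \<Rightarrow> (nat \<Rightarrow>\<^sub>0 int) \<Rightarrow> 'd"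
  where "laurent_monomial x \<alpha> =
    prod_list (map (\<lambda>j. x j powi Poly_Mapping.lookup \<alpha> j) (sorted_list_of_set (Poly_Mapping.keys \<alpha>)))"

definition laurent_sum :: "(nat \<Rightarrow> 'd::division_ring) \<Rightarrow> ((nat \<Rightarrow>\<^sub>0 int) \<Rightarrow>\<^sub>0 'd) \<Rightarrow> 'd"
  where "laurent_sum x c = (\<Sum>\<alpha>\<in>Poly_Mapping.keys c. Poly_Mapping.lookup c \<alpha> * laurent_monomial x \<alpha>)"

definition laurent_coeffs :: "'d::division_ring set \<Rightarrow> nat set \<Rightarrow> ((nat \<Rightarrow>\<^sub>0 int) \<Rightarrow>\<^sub>0 'd) set"
  where "laurent_coeffs C I = {c. (\<forall>\<alpha>\<in>Poly_Mapping.keys c. Poly_Mapping.keys \<alpha> \<subseteq> I) \<and>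
                                  (\<forall>\<alpha>. Poly_Mapping.lookup c \<alpha> \<in> C)}"

definition laurent_independent :: "'d::division_ring set \<Rightarrow> nat set \<Rightarrow> (nat \<Rightarrow> 'd) \<Rightarrow> bool"
  where "laurent_independent C I x \<longleftrightarrow> (\<forall>c\<in>laurent_coeffs C I. laurent_sum x c = 0 \<longrightarrow> c = 0)"

text \<open>
  The noncommutative ring of Laurent polynomials with coefficients from \<open>C\<close>.  As \<open>x i\<close> need not normalize \<open>C\<close>, the
  left combinations of Laurent monomials over \<open>C\<close> are in general not closed under multiplication;
  the ring meant is the one generated by \<open>C\<close> and the \<open>x i\<close> and their inverses.
\<close>

definition laurent_ring :: "'d::division_ring set \<Rightarrow> nat set \<Rightarrow> (nat \<Rightarrow> 'd) \<Rightarrow> 'd set"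
  where "laurent_ring C I x = generate_ring DD (C \<union> x ` I \<union> (\<lambda>i. inverse (x i)) ` I)"


section \<open>The ambient tower\<close>

text \<open>
  The group ring \<open>K[P]\<close> of the free abelian group on the frozen variables is a set of finitely
  supported functions from exponent vectors to \<open>K\<close>, with the convolution product of
  \<open>HOL-Library.Poly_Mapping\<close>.
\<close>

type_synonym ('f, 'k) gring = "('f \<Rightarrow>\<^sub>0 int) \<Rightarrow>\<^sub>0 'k"

definition group_ring :: "'f set \<Rightarrow> ('f, 'k::field_char_0) gring set"
  where "group_ring S = {p. Poly_Mapping.keys p \<subseteq> carrier (free_Abelian_group S)}"

definition frozen_var :: "'f \<Rightarrow> ('f, 'k::field_char_0) gring"
  where "frozen_var f = Poly_Mapping.single (Poly_Mapping.single f 1) 1"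

definition scalar :: "(('f, 'k::field_char_0) gring \<Rightarrow> 'd) \<Rightarrow> 'k \<Rightarrow> 'd"
  where "scalar \<iota> c = \<iota> (Poly_Mapping.single 0 c)"

abbreviation frozen_upto :: "(nat \<Rightarrow> 'f set) \<Rightarrow> nat \<Rightarrow> 'f set"
  where "frozen_upto F i \<equiv> (\<Union>j\<in>{1..i}. F j)"

text \<open>
  The map \<open>\<iota>\<close> is the inclusion of the largest group ring; the Ore domains are algebras over \<open>K\<close>,
  i.e. scalars are central.
\<close>

locale ambient =
  fixes n :: nat
    and F :: "nat \<Rightarrow> 'f set"
    and \<iota> :: "('f, 'k::field_char_0) gring \<Rightarrow> 'd::division_ring"
    and D :: "nat \<Rightarrow> 'd set"
    and t :: "nat \<Rightarrow> 'd"
  assumes rank_pos: "1 \<le> n"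
    and frozen_finite: "\<And>i. i \<in> {1..n} \<Longrightarrow> finite (F i)"
    and frozen_disjoint: "disjoint_family_on F {1..n}"
    and incl_hom:
      "\<iota> \<in> ring_hom (ring_of_type_algebra \<lparr> carrier := group_ring (frozen_upto F n) \<rparr>) DD"
    and incl_inj: "inj_on \<iota> (group_ring (frozen_upto F n))"
    and scalar_central: "\<And>c d. scalar \<iota> c * d = d * scalar \<iota> c"
    and ore: "\<And>i. i \<in> {1..n} \<Longrightarrow> ore_domain (D i)"
    and tower: "\<And>i j. \<lbrakk> i \<in> {1..n}; j \<in> {1..n}; i \<le> j \<rbrakk> \<Longrightarrow> D i \<subseteq> D j"
    and group_ring_sub: "\<And>i. i \<in> {1..n} \<Longrightarrow> \<iota> ` group_ring (frozen_upto F i) \<subseteq> D i"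
    and gen_unit: "\<And>i. i \<in> {1..n} \<Longrightarrow> t i \<noteq> 0 \<and> t i \<in> D i \<and> inverse (t i) \<in> D i"
    and gen_comm: "\<And>i j. \<lbrakk> i \<in> {1..n}; j \<in> {1..n}; i \<noteq> j \<rbrakk> \<Longrightarrow> t i * t j = t j * t i"
    and gen_frozen_comm: "\<And>i j f. \<lbrakk> i \<in> {1..n}; j \<in> {1..n}; i \<noteq> j; f \<in> F j \<rbrakk>
          \<Longrightarrow> t i * \<iota> (frozen_var f) = \<iota> (frozen_var f) * t i"
    and gen_basis: "\<And>i d. \<lbrakk> i \<in> {1..n}; d \<in> D i \<rbrakk>
          \<Longrightarrow> \<exists>!c. c \<in> laurent_coeffs (\<iota> ` group_ring (frozen_upto F i)) {1..i} \<and> d = laurent_sum t c"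
    and fractions: "right_fractions (D n) = UNIV"


section \<open>Valued star quivers\<close>

text \<open>The arrow \<open>i \<rightarrow> j\<close> carries the valuation \<open>(qval i j, qval j i)\<close>.\<close>

record 'v valued_quiver =
  verts :: "'v set"
  arrows :: "('v \<times> 'v) set"
  qval :: "'v \<Rightarrow> 'v \<Rightarrow> nat"

definition is_valued_quiver :: "'v valued_quiver \<Rightarrow> bool"
  where "is_valued_quiver Q \<longleftrightarrow>
     arrows Q \<subseteq> verts Q \<times> verts Q \<and>
     (\<forall>i. (i, i) \<notin> arrows Q) \<and>
     (\<forall>i j. (i, j) \<in> arrows Q \<longrightarrow> (j, i) \<notin> arrows Q) \<and>
     (\<forall>(i, j)\<in>arrows Q. 0 < qval Q i j \<and> 0 < qval Q j i) \<and>
     (\<exists>d :: 'v \<Rightarrow> nat. (\<forall>i\<in>verts Q. 0 < d i) \<and>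
        (\<forall>(i, j)\<in>arrows Q. d i * qval Q i j = qval Q j i * d j))"

definition is_star_quiver :: "'v valued_quiver \<Rightarrow> 'v \<Rightarrow> bool"
  where "is_star_quiver Q c \<longleftrightarrow> is_valued_quiver Q \<and> c \<in> verts Q \<and>
     (\<forall>(i, j)\<in>arrows Q. i = c \<or> j = c)"

text \<open>
  Switching the components replaces \<open>(v i j, v j i)\<close> by \<open>(v j i, v i j)\<close> as families indexed by the
  vertices.  So the exponent of the reversed arrow in the exchange polynomial is the old one, and
  mutation does not change the exchange polynomials.
\<close>

definition rev_quiver :: "'v valued_quiver \<Rightarrow> 'v valued_quiver"
  where "rev_quiver Q = \<lparr> verts = verts Q, arrows = (arrows Q)\<inverse>, qval = (\<lambda>i j. qval Q j i) \<rparr>"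


section \<open>Preseeds, mutations and cluster variables\<close>

text \<open>
  A preseed carries the set \<open>dirs\<close> of its directions, so that the rank one preseed of direction \<open>k\<close>
  is the restriction to \<open>{k}\<close>.  In the quiver of direction \<open>k\<close> the vertex \<open>None\<close> is the exchange
  variable and \<open>Some f\<close> the frozen variable \<open>f\<close>.
\<close>

record ('f, 'd) preseed =
  dirs :: "nat set"
  frozen :: "nat \<Rightarrow> 'f set"
  exch :: "nat \<Rightarrow> 'd"
  quiv :: "nat \<Rightarrow> 'f option valued_quiver"

definition is_preseed :: "nat \<Rightarrow> (nat \<Rightarrow> 'f set) \<Rightarrow> (('f, 'k::field_char_0) gring \<Rightarrow> 'd::division_ring)
    \<Rightarrow> (nat \<Rightarrow> 'd set) \<Rightarrow> (nat \<Rightarrow> 'd) \<Rightarrow> ('f, 'd) preseed \<Rightarrow> bool"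
  where "is_preseed n F \<iota> D t p \<longleftrightarrow>
     dirs p = {1..n} \<and> frozen p = F \<and>
     (\<forall>k\<in>{1..n}.
        (\<exists>\<phi>\<in>ring_iso (sub_ring (right_fractions (D k))) (sub_ring (right_fractions (D k))).
            (\<forall>r\<in>group_ring (frozen_upto F k). \<phi> (\<iota> r) = \<iota> r) \<and> exch p k = \<phi> (t k)) \<and>
        is_star_quiver (quiv p k) None \<and> verts (quiv p k) = insert None (Some ` F k))"

definition coeff_ring :: "(('f, 'k::field_char_0) gring \<Rightarrow> 'd) \<Rightarrow> ('f, 'd) preseed \<Rightarrow> 'd set"
  where "coeff_ring \<iota> p = \<iota> ` group_ring (\<Union>i\<in>dirs p. frozen p i)"

text \<open>
  The exchange variables of a preseed are a system of Laurent indeterminates: they commute, and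
  their Laurent monomials are linearly independent over the coefficient ring.  The automorphisms in
  \<open>is_preseed\<close> for different \<open>k\<close> are unrelated, so they do not give this: in the commutative case
  exchanging \<open>t 1\<close> and \<open>t 2\<close> would allow \<open>exch p 1 = exch p 2\<close>.
\<close>

definition exchange_vars_free :: "(('f, 'k::field_char_0) gring \<Rightarrow> 'd::division_ring)
    \<Rightarrow> ('f, 'd) preseed \<Rightarrow> bool"
  where "exchange_vars_free \<iota> p \<longleftrightarrow>
     (\<forall>i\<in>dirs p. \<forall>j\<in>dirs p. exch p i * exch p j = exch p j * exch p i) \<and>
     laurent_independent (coeff_ring \<iota> p) (dirs p) (exch p)"

definition exchange_poly :: "(('f, 'k::field_char_0) gring \<Rightarrow> 'd) \<Rightarrow> ('f, 'd) preseed \<Rightarrow> nat \<Rightarrow> 'd"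
  where "exchange_poly \<iota> p k = (let Q = quiv p k in \<iota>
     ((\<Prod>f\<in>{f \<in> frozen p k. (Some f, None) \<in> arrows Q}. frozen_var f ^ qval Q (Some f) None) +
      (\<Prod>f\<in>{f \<in> frozen p k. (None, Some f) \<in> arrows Q}. frozen_var f ^ qval Q None (Some f))))"

definition mut_R :: "(('f, 'k::field_char_0) gring \<Rightarrow> 'd::division_ring) \<Rightarrow> nat
    \<Rightarrow> ('f, 'd) preseed \<Rightarrow> ('f, 'd) preseed"
  where "mut_R \<iota> k p = p \<lparr>
     exch := (exch p)(k := exchange_poly \<iota> p k * inverse (exch p k)),
     quiv := (quiv p)(k := rev_quiver (quiv p k)) \<rparr>"

definition mut_L :: "(('f, 'k::field_char_0) gring \<Rightarrow> 'd::division_ring) \<Rightarrow> nat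
    \<Rightarrow> ('f, 'd) preseed \<Rightarrow> ('f, 'd) preseed"
  where "mut_L \<iota> k p = p \<lparr>
     exch := (exch p)(k := inverse (exch p k) * exchange_poly \<iota> p k),
     quiv := (quiv p)(k := rev_quiver (quiv p k)) \<rparr>"

inductive_set mutation_class ::
    "(('f, 'k::field_char_0) gring \<Rightarrow> 'd::division_ring) \<Rightarrow> ('f, 'd) preseed \<Rightarrow> ('f, 'd) preseed set"
  for \<iota> :: "('f, 'k::field_char_0) gring \<Rightarrow> 'd::division_ring" and p :: "('f, 'd) preseed"
  where
    init: "p \<in> mutation_class \<iota> p"
  | right: "\<lbrakk> q \<in> mutation_class \<iota> p; k \<in> dirs p \<rbrakk> \<Longrightarrow> mut_R \<iota> k q \<in> mutation_class \<iota> p"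
  | left: "\<lbrakk> q \<in> mutation_class \<iota> p; k \<in> dirs p \<rbrakk> \<Longrightarrow> mut_L \<iota> k q \<in> mutation_class \<iota> p"

definition cluster_vars :: "(('f, 'k::field_char_0) gring \<Rightarrow> 'd::division_ring)
    \<Rightarrow> ('f, 'd) preseed \<Rightarrow> 'd set"
  where "cluster_vars \<iota> p = {exch q i | q i. q \<in> mutation_class \<iota> p \<and> i \<in> dirs p}"

definition rank_one :: "('f, 'd) preseed \<Rightarrow> nat \<Rightarrow> ('f, 'd) preseed"
  where "rank_one p k = p \<lparr> dirs := {k} \<rparr>"


section \<open>Weyl preseeds and Weyl cluster algebras\<close>

text \<open>
  The automorphisms \<open>\<theta> i\<close> of the coefficient ring are given together with their extension to the
  division ring that fixes the exchange variables, so that \<open>\<theta> i\<close> applies to inverses of exchange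
  polynomials.
\<close>

definition is_weyl :: "(('f, 'k::field_char_0) gring \<Rightarrow> 'd::division_ring) \<Rightarrow> ('f, 'd) preseed
    \<Rightarrow> (nat \<Rightarrow> 'd \<Rightarrow> 'd) \<Rightarrow> bool"
  where "is_weyl \<iota> p \<theta> \<longleftrightarrow> (\<forall>i\<in>dirs p.
     \<theta> i \<in> ring_iso DD DD \<and>
     \<theta> i ` coeff_ring \<iota> p = coeff_ring \<iota> p \<and>
     (\<forall>j\<in>dirs p. \<theta> i (exch p j) = exch p j) \<and>
     (\<forall>f\<in>frozen p i.
        exch p i * \<iota> (frozen_var f) = \<theta> i (\<iota> (frozen_var f)) * exch p i \<and>
        inverse (exch p i) * \<iota> (frozen_var f) = inv_into UNIV (\<theta> i) (\<iota> (frozen_var f)) * inverse (exch p i)))"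

definition weyl_cluster_algebra :: "(('f, 'k::field_char_0) gring \<Rightarrow> 'd::division_ring)
    \<Rightarrow> ('f, 'd) preseed \<Rightarrow> 'd set"
  where "weyl_cluster_algebra \<iota> p = generate_ring DD (coeff_ring \<iota> p \<union> cluster_vars \<iota> p)"

definition laurent_coeff_ring :: "(('f, 'k::field_char_0) gring \<Rightarrow> 'd::division_ring)
    \<Rightarrow> ('f, 'd) preseed \<Rightarrow> (nat \<Rightarrow> 'd \<Rightarrow> 'd) \<Rightarrow> 'd set"
  where "laurent_coeff_ring \<iota> p \<theta> = generate_ring DD (coeff_ring \<iota> p
     \<union> (\<lambda>i. \<theta> i (inverse (exchange_poly \<iota> p i))) ` dirs p
     \<union> (\<lambda>i. inv_into UNIV (\<theta> i) (inverse (exchange_poly \<iota> p i))) ` dirs p)"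


section \<open>The algebras generated by one step mutations\<close>

definition exchange_ring :: "(('f, 'k::field_char_0) gring \<Rightarrow> 'd::division_ring)
    \<Rightarrow> ('f, 'd) preseed \<Rightarrow> 'd set"
  where "exchange_ring \<iota> p = generate_ring DD (range (scalar \<iota>) \<union> exchange_poly \<iota> p ` dirs p)"

text \<open>With \<open>\<mu> = mut_R \<iota>\<close> this is \<open>H\<^sup>R(p)\<close>, with \<open>\<mu> = mut_L \<iota>\<close> it is \<open>H\<^sup>L(p)\<close>.\<close>

definition H_alg :: "(nat \<Rightarrow> ('f, 'd) preseed \<Rightarrow> ('f, 'd) preseed)
    \<Rightarrow> (('f, 'k::field_char_0) gring \<Rightarrow> 'd::division_ring) \<Rightarrow> ('f, 'd) preseed \<Rightarrow> 'd set"
  where "H_alg \<mu> \<iota> p =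
     generate_ring DD (exchange_ring \<iota> p \<union> exch p ` dirs p \<union> (\<lambda>i. exch (\<mu> i p) i) ` dirs p)"

text \<open>
  \<open>H_alg \<mu> \<iota> p\<close> has for every direction \<open>i\<close> the generators \<open>x i\<close> (the exchange variable) and
  \<open>\<mu> i (x i)\<close>.  The isomorphism induced by \<open>\<mu> k\<close> takes the generator \<open>x k\<close> of the source to the
  generator \<open>\<mu> k (x k)\<close> of the target, where \<open>x k\<close> is now the exchange variable of the target
  preseed \<open>\<mu> k p\<close>; it takes the generator \<open>\<mu> k (x k)\<close> of the source to the generator \<open>x k\<close> of the
  target, and fixes the generators of the other directions.

  It cannot take the element \<open>x k\<close> of the division ring to the element \<open>\<mu> k (x k)\<close>.  For
  \<open>K\<close> the rationals, \<open>n = 1\<close>, one frozen variable \<open>f\<close>, exchange polynomial \<open>1 + f\<close> and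
  \<open>x f = 2 f x\<close>, any ring isomorphism \<open>\<psi>\<close> maps \<open>f\<close>, which generates the commutator ideal of both
  algebras, to a nonzero rational multiple of \<open>f\<close>; then \<open>\<psi> x = y\<close> with \<open>y = (1 + f) x\<^sup>-\<^sup>1\<close> would
  turn \<open>x f = 2 f x\<close> into \<open>y f = 2 f y\<close>, whereas \<open>2 y f = f y\<close>.
\<close>

definition induced_iso :: "(nat \<Rightarrow> ('f, 'd) preseed \<Rightarrow> ('f, 'd) preseed)
    \<Rightarrow> (('f, 'k::field_char_0) gring \<Rightarrow> 'd::division_ring) \<Rightarrow> ('f, 'd) preseed \<Rightarrow> nat \<Rightarrow> ('d \<Rightarrow> 'd) \<Rightarrow> bool"
  where "induced_iso \<mu> \<iota> p k \<psi> \<longleftrightarrow>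
     \<psi> \<in> ring_iso (sub_ring (H_alg \<mu> \<iota> p)) (sub_ring (H_alg \<mu> \<iota> (\<mu> k p))) \<and>
     (\<forall>c. \<psi> (scalar \<iota> c) = scalar \<iota> c) \<and>
     \<psi> (exch p k) = exch (\<mu> k (\<mu> k p)) k \<and>
     \<psi> (exch (\<mu> k p) k) = exch (\<mu> k p) k \<and>
     (\<forall>i\<in>dirs p - {k}. \<psi> (exch p i) = exch (\<mu> k p) i \<and>
                       \<psi> (exch (\<mu> i p) i) = exch (\<mu> i (\<mu> k p)) i)"


section \<open>Rings given by generators and relations\<close>

definition monoid_ring :: "('m, 'z) monoid_scheme \<Rightarrow> ('m \<Rightarrow>\<^sub>0 'c::comm_ring_1) ring"
  where "monoid_ring M = \<lparr>
     carrier = {p. Poly_Mapping.keys p \<subseteq> carrier M},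
     monoid.mult = (\<lambda>p q. \<Sum>u\<in>Poly_Mapping.keys p. \<Sum>v\<in>Poly_Mapping.keys q.
        Poly_Mapping.single (u \<otimes>\<^bsub>M\<^esub> v) (Poly_Mapping.lookup p u * Poly_Mapping.lookup q v)),
     one = Poly_Mapping.single \<one>\<^bsub>M\<^esub> 1,
     ring.zero = 0,
     add = (+) \<rparr>"

text \<open>
  Generalized Weyl algebras: the ring extension of the commutative ring \<open>R\<close> by generators \<open>x i\<close>,
  \<open>y i\<close> is presented as the free ring on the letters below modulo the relations of \<open>R\<close> and the
  defining relations.
\<close>

datatype 'd gwa_letter = Coef 'd | GX nat | GY nat

definition gwa_letters :: "'d set \<Rightarrow> nat set \<Rightarrow> 'd gwa_letter set"
  where "gwa_letters R I = Coef ` R \<union> GX ` I \<union> GY ` I"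

definition word_monoid :: "'l set \<Rightarrow> 'l list monoid"
  where "word_monoid L = \<lparr> carrier = lists L, monoid.mult = (@), one = [] \<rparr>"

abbreviation word :: "'l list \<Rightarrow> 'l list \<Rightarrow>\<^sub>0 int"
  where "word w \<equiv> Poly_Mapping.single w 1"

definition gwa_free_ring :: "'d set \<Rightarrow> nat set \<Rightarrow> ('d gwa_letter list \<Rightarrow>\<^sub>0 int) ring"
  where "gwa_free_ring R I = monoid_ring (word_monoid (gwa_letters R I))"

definition gwa_relations :: "'d::division_ring set \<Rightarrow> nat set \<Rightarrow> (nat \<Rightarrow> 'd \<Rightarrow> 'd) \<Rightarrow> (nat \<Rightarrow> 'd)
    \<Rightarrow> ('d gwa_letter list \<Rightarrow>\<^sub>0 int) set"
  where "gwa_relations R I \<theta> \<xi> =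
     {word [Coef (r + s)] - word [Coef r] - word [Coef s] | r s. r \<in> R \<and> s \<in> R}
   \<union> {word [Coef (r * s)] - word [Coef r, Coef s] | r s. r \<in> R \<and> s \<in> R}
   \<union> {word [Coef 1] - word []}
   \<union> {word [GX i, Coef r] - word [Coef (\<theta> i r), GX i] | i r. i \<in> I \<and> r \<in> R}
   \<union> {word [GY i, Coef r] - word [Coef (inv_into R (\<theta> i) r), GY i] | i r. i \<in> I \<and> r \<in> R}
   \<union> {word [GX i, GY i] - word [Coef (\<xi> i)] | i. i \<in> I}
   \<union> {word [GY i, GX i] - word [Coef (inv_into R (\<theta> i) (\<xi> i))] | i. i \<in> I}
   \<union> {word [GX i, GY j] - word [GY j, GX i] | i j. i \<in> I \<and> j \<in> I \<and> i \<noteq> j}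
   \<union> {word [GX i, GX j] - word [GX j, GX i] | i j. i \<in> I \<and> j \<in> I \<and> i \<noteq> j}
   \<union> {word [GY i, GY j] - word [GY j, GY i] | i j. i \<in> I \<and> j \<in> I \<and> i \<noteq> j}"

definition gwa_datum :: "'d::division_ring set \<Rightarrow> nat set \<Rightarrow> (nat \<Rightarrow> 'd \<Rightarrow> 'd) \<Rightarrow> (nat \<Rightarrow> 'd) \<Rightarrow> bool"
  where "gwa_datum R I \<theta> \<xi> \<longleftrightarrow> subcring R DD \<and> (\<forall>i\<in>I. \<xi> i \<in> R) \<and>
     (\<forall>i\<in>I. \<theta> i \<in> ring_iso (sub_ring R) (sub_ring R)) \<and>
     (\<forall>i\<in>I. \<forall>j\<in>I. i \<noteq> j \<longrightarrow> \<theta> i (\<xi> j) = \<xi> j)"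

text \<open>
  The subring \<open>A\<close> is the generalized Weyl algebra \<open>R(\<theta>,\<xi>)\<close> with generators \<open>gx i\<close> and \<open>gy i\<close>: the
  presented ring maps isomorphically onto it.
\<close>

definition is_gwa :: "'d::division_ring set \<Rightarrow> 'd set \<Rightarrow> nat set \<Rightarrow> (nat \<Rightarrow> 'd \<Rightarrow> 'd) \<Rightarrow> (nat \<Rightarrow> 'd)
    \<Rightarrow> (nat \<Rightarrow> 'd) \<Rightarrow> (nat \<Rightarrow> 'd) \<Rightarrow> bool"
  where "is_gwa A R I \<theta> \<xi> gx gy \<longleftrightarrow> gwa_datum R I \<theta> \<xi> \<and>
     (let G = gwa_free_ring R I; J = Idl\<^bsub>G\<^esub> (gwa_relations R I \<theta> \<xi>) in
      \<exists>\<Phi>\<in>ring_iso (G Quot J) (sub_ring A).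
        (\<forall>r\<in>R. \<Phi> (J +>\<^bsub>G\<^esub> word [Coef r]) = r) \<and>
        (\<forall>i\<in>I. \<Phi> (J +>\<^bsub>G\<^esub> word [GX i]) = gx i \<and> \<Phi> (J +>\<^bsub>G\<^esub> word [GY i]) = gy i))"

text \<open>
  In \<open>H\<^sup>R(p)\<close> one has \<open>\<mu> i (x i) * x i = \<xi> i\<close>, so the generalized Weyl algebra generators are
  \<open>\<mu> i (x i), x i\<close> in this order, and the automorphism belonging to \<open>\<mu> i (x i)\<close> is the inverse of
  \<open>\<theta> i\<close>.  In \<open>H\<^sup>L(p)\<close> one has \<open>x i * \<mu> i (x i) = \<xi> i\<close>.
\<close>

definition HR_is_gwa :: "(('f, 'k::field_char_0) gring \<Rightarrow> 'd::division_ring) \<Rightarrow> ('f, 'd) preseed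
    \<Rightarrow> (nat \<Rightarrow> 'd \<Rightarrow> 'd) \<Rightarrow> bool"
  where "HR_is_gwa \<iota> p \<theta> \<longleftrightarrow> is_gwa (H_alg (mut_R \<iota>) \<iota> p) (exchange_ring \<iota> p) (dirs p)
     (\<lambda>i. inv_into UNIV (\<theta> i)) (exchange_poly \<iota> p) (\<lambda>i. exch (mut_R \<iota> i p) i) (exch p)"

definition HL_is_gwa :: "(('f, 'k::field_char_0) gring \<Rightarrow> 'd::division_ring) \<Rightarrow> ('f, 'd) preseed
    \<Rightarrow> (nat \<Rightarrow> 'd \<Rightarrow> 'd) \<Rightarrow> bool"
  where "HL_is_gwa \<iota> p \<theta> \<longleftrightarrow> is_gwa (H_alg (mut_L \<iota>) \<iota> p) (exchange_ring \<iota> p) (dirs p)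
     \<theta> (exchange_poly \<iota> p) (exch p) (\<lambda>i. exch (mut_L \<iota> i p) i)"


section \<open>Tensor products of algebras over the ground field\<close>

text \<open>
  The tensor product over \<open>'k\<close> of a family of \<open>'k\<close>-subalgebras \<open>A i\<close> of \<open>'d\<close>, with structure map
  \<open>\<kappa>\<close>: the free \<open>'k\<close>-module on the families \<open>(a i)\<close>, multiplied componentwise, modulo
  multilinearity.
\<close>

definition tensor_free :: "nat set \<Rightarrow> (nat \<Rightarrow> 'd::division_ring set)
    \<Rightarrow> ((nat \<Rightarrow> 'd) \<Rightarrow>\<^sub>0 'k::field_char_0) ring"
  where "tensor_free I A = monoid_ring (product_group I (\<lambda>i. sub_ring (A i)))"

definition tensor_relations :: "('k::field_char_0 \<Rightarrow> 'd::division_ring) \<Rightarrow> nat set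
    \<Rightarrow> (nat \<Rightarrow> 'd set) \<Rightarrow> ((nat \<Rightarrow> 'd) \<Rightarrow>\<^sub>0 'k) set"
  where "tensor_relations \<kappa> I A =
     {Poly_Mapping.single (u(i := a + b)) 1 - Poly_Mapping.single (u(i := a)) 1
        - Poly_Mapping.single (u(i := b)) 1
        | u i a b. u \<in> Pi\<^sub>E I A \<and> i \<in> I \<and> a \<in> A i \<and> b \<in> A i}
   \<union> {Poly_Mapping.single (u(i := \<kappa> c * a)) 1 - Poly_Mapping.single (u(i := a)) c
        | u i a c. u \<in> Pi\<^sub>E I A \<and> i \<in> I \<and> a \<in> A i}"

definition tensor_ideal :: "('k::field_char_0 \<Rightarrow> 'd::division_ring) \<Rightarrow> nat set
    \<Rightarrow> (nat \<Rightarrow> 'd set) \<Rightarrow> ((nat \<Rightarrow> 'd) \<Rightarrow>\<^sub>0 'k) set"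
  where "tensor_ideal \<kappa> I A = Idl\<^bsub>tensor_free I A\<^esub> (tensor_relations \<kappa> I A)"

definition tensor_algebra :: "('k::field_char_0 \<Rightarrow> 'd::division_ring) \<Rightarrow> nat set
    \<Rightarrow> (nat \<Rightarrow> 'd set) \<Rightarrow> ((nat \<Rightarrow> 'd) \<Rightarrow>\<^sub>0 'k) set ring"
  where "tensor_algebra \<kappa> I A = tensor_free I A Quot tensor_ideal \<kappa> I A"

definition tensor_scalar :: "('k::field_char_0 \<Rightarrow> 'd::division_ring) \<Rightarrow> nat set
    \<Rightarrow> (nat \<Rightarrow> 'd set) \<Rightarrow> 'k \<Rightarrow> ((nat \<Rightarrow> 'd) \<Rightarrow>\<^sub>0 'k) set"
  where "tensor_scalar \<kappa> I A c =
     tensor_ideal \<kappa> I A +>\<^bsub>tensor_free I A\<^esub> Poly_Mapping.single (\<lambda>i\<in>I. 1) c"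

end

theory Submission
  imports Defs "HOL-Library.Product_Plus"
begin

text \<open>
Write \<open>x i\<close> for the exchange variables, \<open>\<xi> i\<close> for the exchange polynomials and \<open>C\<close> for the coefficient ring.  The
whole proof rests on one commutation property: \<open>x i\<close> commutes with the frozen variables of every other direction
(\<open>x_frozen_comm\<close>).  Hence conjugation by \<open>x i\<close>, which is \<open>\<theta> i\<close> on the frozen variables of direction \<open>i\<close> by definition, is
trivial on the others; it preserves \<open>C\<close> (\<open>x_normalizer_gen\<close>), and whatever is built from \<open>x k\<close> and the coefficients of direction \<open>k\<close>
commutes with the other directions.

Induced isomorphisms.  With \<open>y = \<xi> k * (x k)\<^sup>-\<^sup>1\<close>, the prescribed images are \<open>x k \<mapsto> \<xi> k * y\<^sup>-\<^sup>1\<close> and \<open>y \<mapsto> y\<close>, the generators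
of the other directions being fixed.  Conjugation by \<open>y\<close> does exactly this on the division ring, so only the
images of the generating sets have to be compared (\<open>conj_exchange_iso\<close>).  Left mutations work with
\<open>y = (x k)\<^sup>-\<^sup>1 * \<xi> k\<close> and conjugation by \<open>y\<^sup>-\<^sup>1\<close>.

Generalized Weyl algebras.  The defining relations hold for the generators, so the presented ring maps onto the
generated subring.  The relations bring every word to the form of a coefficient followed by a standard
monomial (\<open>word_standard\<close>), and the value of a standard monomial is a nonzero coefficient times a Laurent
monomial in the first generators.  These generators are the \<open>x i\<close> or their inverses up to units of the fraction field of
\<open>C\<close>; clearing denominators and rescaling keep Laurent monomials independent
(\<open>laurent_independent_right_fractions\<close>, \<open>laurent_independent_rescale\<close>), so evaluation is injective
(\<open>gwa_realization.generated_ring_is_gwa\<close>).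

Laurent polynomials.  Independence again follows by clearing denominators.  In the ring of Laurent polynomials the
\<open>x i\<close> are units by definition, and the \<open>\<xi> i\<close> are units because \<open>(\<xi> i)\<^sup>-\<^sup>1\<close> is the conjugate by \<open>x i\<close> of a
generator of the coefficients.  A mutation replaces an exchange variable by its inverse times \<open>\<xi> i\<close>, so no
cluster variable leaves this ring (\<open>weyl_cluster_algebra_laurent\<close>).

Tensor decomposition.  A mutation only changes its own direction, so the cluster algebra is generated by those of the
rank one preseeds, which commute with one another; multiplication is therefore a surjective homomorphism from the tensor
product.  For injectivity, bases of the factors span the tensor product by multilinearity
(\<open>tensor_basis_reduction\<close>), and the products of basis elements are linearly independent in the division ring
(\<open>basis_products_independent\<close>): up to denominators, elements of different factors are combinations of monomials in disjoint
sets of variables, and all monomials together are independent over the ground field.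
\<close>

text \<open>This rule would turn the index set \<open>{1..n}\<close> into \<open>{Suc 0..n}\<close>.\<close>

declare One_nat_def [simp del]

abbreviation "keys \<equiv> Poly_Mapping.keys"
abbreviation "lookup \<equiv> Poly_Mapping.lookup"
abbreviation "single \<equiv> Poly_Mapping.single"

section \<open>Subrings of a division ring type\<close>

lemma DD_simps [simp]:
  "carrier DD = UNIV" "monoid.mult DD = (*)" "one DD = 1" "ring.zero DD = 0" "add DD = (+)"
  by (simp_all add: ring_of_type_algebra_def)

lemma ring_DD: "ring (DD :: 'd::division_ring ring)"
proof -
  have "\<exists>y. x + y = 0" for x :: 'd
    using add.right_inverse by blast
  thus ?thesis
    unfolding ring_of_type_algebra_def using add.right_inverse
    by unfold_locales (auto simp: algebra_simps Units_def)
qed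

lemma a_inv_DD [simp]: "\<ominus>\<^bsub>DD\<^esub> (x :: 'd::division_ring) = - x"
proof -
  interpret ring "DD :: 'd ring" by (rule ring_DD)
  show ?thesis by (rule minus_equality) auto
qed

lemma subring_DD_iff:
  "subring A (DD :: 'd::division_ring ring) \<longleftrightarrow>
     1 \<in> A \<and> (\<forall>a\<in>A. - a \<in> A) \<and> (\<forall>a\<in>A. \<forall>b\<in>A. a + b \<in> A \<and> a * b \<in> A)"
  (is "?l \<longleftrightarrow> ?r")
proof
  interpret ring "DD :: 'd ring" by (rule ring_DD)
  show "?l \<Longrightarrow> ?r"
    using subringE(3,5,6,7)[of A DD] by auto
  show "?r \<Longrightarrow> ?l"
    by (rule subringI) auto
qed

lemma subringD:
  assumes "subring A (DD :: 'd::division_ring ring)"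
  shows "1 \<in> A" "0 \<in> A" "a \<in> A \<Longrightarrow> - a \<in> A" "\<lbrakk>a \<in> A; b \<in> A\<rbrakk> \<Longrightarrow> a + b \<in> A"
    "\<lbrakk>a \<in> A; b \<in> A\<rbrakk> \<Longrightarrow> a - b \<in> A" "\<lbrakk>a \<in> A; b \<in> A\<rbrakk> \<Longrightarrow> a * b \<in> A" "a \<in> A \<Longrightarrow> a ^ m \<in> A"
proof -
  note s = assms[unfolded subring_DD_iff]
  show 1: "1 \<in> A" and m: "\<And>a. a \<in> A \<Longrightarrow> - a \<in> A" and p: "\<And>a b. \<lbrakk>a \<in> A; b \<in> A\<rbrakk> \<Longrightarrow> a + b \<in> A"
    and t: "\<And>a b. \<lbrakk>a \<in> A; b \<in> A\<rbrakk> \<Longrightarrow> a * b \<in> A"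
    using s by auto
  show "0 \<in> A" using p[OF 1 m[OF 1]] by simp
  show "a \<in> A \<Longrightarrow> b \<in> A \<Longrightarrow> a - b \<in> A" using p[of a "- b"] m by simp
  show "a \<in> A \<Longrightarrow> a ^ m \<in> A" by (induction m) (auto intro: 1 t)
qed

lemma subring_sum:
  assumes "subring A (DD :: 'd::division_ring ring)" "\<And>i. i \<in> S \<Longrightarrow> f i \<in> A"
  shows "sum f S \<in> A"
  using assms(2) by (induction S rule: infinite_finite_induct) (auto intro: subringD[OF assms(1)])

lemma subring_prod_list:
  assumes "subring A (DD :: 'd::division_ring ring)" "\<And>i. i \<in> set L \<Longrightarrow> f i \<in> A"
  shows "prod_list (map f L) \<in> A"
  using assms(2) by (induction L) (auto intro: subringD[OF assms(1)])

lemma subring_powi: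
  assumes "subring A (DD :: 'd::division_ring ring)" "a \<in> A" "inverse a \<in> A"
  shows "a powi k \<in> A"
  using assms by (auto simp: power_int_def intro: subringD)

lemma subring_of_int:
  assumes "subring A (DD :: 'd::division_ring ring)"
  shows "of_int k \<in> A"
proof -
  have "of_nat m \<in> A" for m
    by (induction m) (auto intro: subringD[OF assms])
  then show ?thesis
    by (cases k rule: int_cases2) (auto intro: subringD[OF assms])
qed

lemma subcring_DD_iff:
  "subcring A (DD :: 'd::division_ring ring) \<longleftrightarrow> subring A DD \<and> (\<forall>a\<in>A. \<forall>b\<in>A. a * b = b * a)"
  by (auto simp: subcring_def subcring_axioms_def)

lemma generate_ring_subring: "subring (generate_ring DD H) (DD :: 'd::division_ring ring)"
  using ring.generate_ring_is_subring[OF ring_DD] by simp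

lemma generate_ring_least:
  assumes "subring E (DD :: 'd::division_ring ring)" "H \<subseteq> E"
  shows "generate_ring DD H \<subseteq> E"
  using ring.generate_ring_min_subring1[OF ring_DD _ assms] by simp

lemma generate_ring_mono:
  fixes H :: "'d::division_ring set"
  shows "H \<subseteq> generate_ring DD H' \<Longrightarrow> generate_ring DD H \<subseteq> generate_ring DD H'"
  by (intro generate_ring_least generate_ring_subring)

lemma sub_ring_ring:
  assumes "subring A (DD :: 'd::division_ring ring)"
  shows "ring (sub_ring A)"
  using ring.subring_is_ring[OF ring_DD assms] by simp

lemma sub_ring_simps [simp]:
  "carrier (sub_ring A) = A" "monoid.mult (sub_ring A) = (*)" "one (sub_ring A) = 1"
  "ring.zero (sub_ring A) = 0" "add (sub_ring A) = (+)"
  by simp_all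

lemma ring_iso_sub_ring_iff:
  "\<psi> \<in> ring_iso (sub_ring A) (sub_ring B) \<longleftrightarrow>
    (\<forall>a\<in>A. \<psi> a \<in> B) \<and> (\<forall>a\<in>A. \<forall>b\<in>A. \<psi> (a + b) = \<psi> a + \<psi> b \<and> \<psi> (a * b) = \<psi> a * \<psi> b) \<and>
    \<psi> 1 = 1 \<and> bij_betw \<psi> A B"
  by (auto simp: ring_iso_def ring_hom_def)

lemma subring_bij_image:
  assumes "subring A (DD :: 'd::division_ring ring)"
    and "\<And>a b. \<psi> (a + b) = \<psi> a + \<psi> b" "\<And>a b. \<psi> (a * b) = \<psi> a * \<psi> b" "\<psi> 1 = 1"
  shows "subring (\<psi> ` A) (DD :: 'd ring)"
proof -
  have z: "\<psi> 0 = 0" using assms(2)[of 0 0] by simp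
  have m: "- \<psi> a = \<psi> (- a)" for a
    using assms(2)[of a "-a"] z minus_unique by simp
  show ?thesis
    using assms(1) unfolding subring_DD_iff
    by (auto simp: m assms(2,3)[symmetric] intro: image_eqI[of _ _ 1] assms(4)[symmetric])
qed

section \<open>Centralizers and normalizers\<close>

definition centralizer :: "'d::division_ring set \<Rightarrow> 'd set"
  where "centralizer S = {z. \<forall>s\<in>S. z * s = s * z}"

lemma inverse_cancel:
  fixes m :: "'d::division_ring"
  assumes "m \<noteq> 0"
  shows "inverse m * (m * z) = z" "m * (inverse m * z) = z"
  using assms by (simp_all add: mult.assoc[symmetric])

lemma inverse_commute:
  fixes z s :: "'d::division_ring"
  assumes "z * s = s * z"
  shows "inverse z * s = s * inverse z"
proof (cases "z = 0")
  case False
  have "inverse z * s = inverse z * (s * z) * inverse z"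
    using False by (simp add: mult.assoc)
  also have "\<dots> = inverse z * (z * s) * inverse z"
    by (simp only: assms)
  also have "\<dots> = s * inverse z"
    using False by (simp add: mult.assoc[symmetric])
  finally show ?thesis .
qed simp

lemma centralizer_subring: "subring (centralizer S) DD"
proof -
  have "a * b * s = s * (a * b)" if "a * s = s * a" "b * s = s * b" for a b s :: 'a
  proof -
    have "a * b * s = a * (s * b)" using that by (simp only: mult.assoc)
    also have "\<dots> = s * (a * b)" using that(1) by (simp only: mult.assoc[symmetric])
    finally show ?thesis .
  qed
  then show ?thesis
    unfolding subring_DD_iff centralizer_def by (simp add: distrib_left distrib_right)
qed

lemma centralizer_inverse: "z \<in> centralizer S \<Longrightarrow> inverse z \<in> centralizer S"
  by (auto simp: centralizer_def inverse_commute)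

lemma centralizer_sym: "S \<subseteq> centralizer T \<longleftrightarrow> T \<subseteq> centralizer S"
  by (auto simp: centralizer_def)

lemma centralizer_powi: "z \<in> centralizer S \<Longrightarrow> z powi k \<in> centralizer S"
  by (intro subring_powi centralizer_subring centralizer_inverse)

definition normalizer :: "'d::division_ring set \<Rightarrow> 'd set"
  where "normalizer C = {m. m \<noteq> 0 \<and> (\<forall>c\<in>C. m * c * inverse m \<in> C \<and> inverse m * c * m \<in> C)}"

lemma normalizer_one: "1 \<in> normalizer C"
  by (simp add: normalizer_def)

lemma normalizer_nonzero: "m \<in> normalizer C \<Longrightarrow> m \<noteq> 0"
  by (simp add: normalizer_def)

lemma normalizer_mult: "\<lbrakk>a \<in> normalizer C; b \<in> normalizer C\<rbrakk> \<Longrightarrow> a * b \<in> normalizer C"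
proof -
  assume a: "a \<in> normalizer C" and b: "b \<in> normalizer C"
  have "a * b * c * inverse (a * b) = a * (b * c * inverse b) * inverse a"
    "inverse (a * b) * c * (a * b) = inverse b * (inverse a * c * a) * b" for c
    using a b by (simp_all add: normalizer_def nonzero_inverse_mult_distrib mult.assoc)
  with a b show "a * b \<in> normalizer C"
    unfolding normalizer_def by simp
qed

lemma normalizer_inverse: "a \<in> normalizer C \<Longrightarrow> inverse a \<in> normalizer C"
  by (auto simp: normalizer_def)

lemma normalizer_powi: "a \<in> normalizer C \<Longrightarrow> a powi k \<in> normalizer C"
proof -
  have "b ^ m \<in> normalizer C" if "b \<in> normalizer C" for b m
    using that by (induction m) (auto intro: normalizer_one normalizer_mult)
  then show "a \<in> normalizer C \<Longrightarrow> a powi k \<in> normalizer C"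
    by (simp add: power_int_def normalizer_inverse)
qed

lemma normalizer_prod_list:
  "(\<And>i. i \<in> set L \<Longrightarrow> f i \<in> normalizer C) \<Longrightarrow> prod_list (map f L) \<in> normalizer C"
  by (induction L) (auto intro: normalizer_one normalizer_mult)

lemma normalizer_shift:
  assumes "m \<in> normalizer C" "c \<in> C"
  obtains c' where "c' \<in> C" "m * c = c' * m" "c \<noteq> 0 \<longrightarrow> c' \<noteq> 0"
proof
  show "m * c * inverse m \<in> C" "m * c = m * c * inverse m * m" "c \<noteq> 0 \<longrightarrow> m * c * inverse m \<noteq> 0"
    using assms by (auto simp: normalizer_def mult.assoc)
qed

section \<open>Right fractions of a commutative subring\<close>

lemma right_fractionsI: "\<lbrakk>a \<in> A; b \<in> A; b \<noteq> 0\<rbrakk> \<Longrightarrow> a * inverse b \<in> right_fractions A"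
  by (auto simp: right_fractions_def)

lemma right_fractions_incl:
  assumes "subring A DD"
  shows "A \<subseteq> right_fractions A"
  using right_fractionsI[of _ A 1] subringD(1)[OF assms] by force

lemma right_fractions_subcring:
  assumes "subcring C (DD :: 'd::division_ring ring)"
  shows "subcring (right_fractions C) DD" "q \<in> right_fractions C \<Longrightarrow> inverse q \<in> right_fractions C"
proof -
  note C = assms[unfolded subcring_DD_iff, THEN conjunct1]
  have com: "a * b = b * a" if "a \<in> C" "b \<in> C" for a b
    using assms that by (auto simp: subcring_DD_iff)
  have ic: "inverse a * b = b * inverse a" if "a \<in> C" "b \<in> C" for a b
    using com inverse_commute that by blast
  have ii: "inverse a * inverse b = inverse b * inverse a" if "a \<in> C" "b \<in> C" for a b
    using ic[OF that] inverse_commute[of b "inverse a"] by simp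
  have c2: "u * v = v * u" if uv: "u \<in> right_fractions C" "v \<in> right_fractions C" for u v
  proof -
    obtain a b c d where u: "u = a * inverse b" "a \<in> C" "b \<in> C" and v: "v = c * inverse d" "c \<in> C" "d \<in> C"
      using uv by (auto simp: right_fractions_def)
    have "b \<in> centralizer C" "a \<in> centralizer C" using u com by (auto simp: centralizer_def)
    then have "u \<in> centralizer C" unfolding u
      by (intro subringD(6)[OF centralizer_subring] centralizer_inverse)
    then have "c \<in> centralizer {u}" "d \<in> centralizer {u}" using v by (auto simp: centralizer_def)
    then have "v \<in> centralizer {u}" unfolding v
      by (intro subringD(6)[OF centralizer_subring] centralizer_inverse)
    then show ?thesis by (simp add: centralizer_def)
  qed
  have sub: "subring (right_fractions C) DD"
    unfolding subring_DD_iff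
  proof (intro conjI ballI)
    show "1 \<in> right_fractions C"
      using right_fractions_incl[OF C] subringD(1)[OF C] by auto
    fix u assume "u \<in> right_fractions C"
    then obtain a b where u: "u = a * inverse b" "a \<in> C" "b \<in> C" "b \<noteq> 0"
      by (auto simp: right_fractions_def)
    show "- u \<in> right_fractions C"
      using right_fractionsI[of "- a" C b] u subringD(3)[OF C] by simp
    fix v assume "v \<in> right_fractions C"
    then obtain c d where v: "v = c * inverse d" "c \<in> C" "d \<in> C" "d \<noteq> 0"
      by (auto simp: right_fractions_def)
    have "u + v = (a * d + c * b) * inverse (b * d)"
    proof -
      have "(a * d + c * b) * inverse (b * d) = a * (d * inverse d) * inverse b + c * (b * inverse d) * inverse b"
        using u v by (simp only: nonzero_inverse_mult_distrib[OF u(4) v(4)] distrib_right mult.assoc)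
      also have "b * inverse d = inverse d * b" using ic u v by metis
      also have "c * (inverse d * b) * inverse b = c * inverse d"
        using u by (simp add: mult.assoc)
      also have "a * (d * inverse d) * inverse b = a * inverse b"
        using v by simp
      finally show ?thesis using u v by simp
    qed
    moreover have "u * v = (a * c) * inverse (b * d)"
    proof -
      have "u * v = a * (inverse b * c) * inverse d" by (simp add: u v mult.assoc)
      also have "\<dots> = a * c * (inverse b * inverse d)" using ic u v by (simp add: mult.assoc)
      also have "inverse b * inverse d = inverse (b * d)" using ii u v
        by (simp add: nonzero_inverse_mult_distrib)
      finally show ?thesis .
    qed
    ultimately show "u + v \<in> right_fractions C" "u * v \<in> right_fractions C"
      using u v by (auto intro!: right_fractionsI subringD[OF C])
  qed
  show "subcring (right_fractions C) DD"
    using sub c2 by (auto simp: subcring_DD_iff)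
  assume q: "q \<in> right_fractions C"
  then obtain a b where u: "q = a * inverse b" "a \<in> C" "b \<in> C" "b \<noteq> 0"
    by (auto simp: right_fractions_def)
  show "inverse q \<in> right_fractions C"
  proof (cases "a = 0")
    case True
    then show ?thesis using u subringD(2)[OF sub] by simp
  next
    case False
    then show ?thesis using u right_fractionsI[of b C a]
      by (simp add: nonzero_inverse_mult_distrib)
  qed
qed

lemma normalizer_right_fractions: "normalizer C \<subseteq> normalizer (right_fractions C)"
proof
  fix m assume m: "m \<in> normalizer C"
  have conj: "m * (a * inverse b) * inverse m = (m * a * inverse m) * inverse (m * b * inverse m)"
    if "m \<noteq> 0" "b \<noteq> 0" for a b m :: 'a
    using that by (simp add: nonzero_inverse_mult_distrib mult.assoc)
      (simp add: mult.assoc[symmetric])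
  show "m \<in> normalizer (right_fractions C)"
    unfolding normalizer_def
  proof (intro CollectI conjI ballI)
    show m0: "m \<noteq> 0" using m by (simp add: normalizer_def)
    fix c assume "c \<in> right_fractions C"
    then obtain a b where c: "c = a * inverse b" "a \<in> C" "b \<in> C" "b \<noteq> 0"
      by (auto simp: right_fractions_def)
    show "m * c * inverse m \<in> right_fractions C"
      unfolding c(1) conj[OF m0 c(4)]
      by (rule right_fractionsI) (use m c in \<open>auto simp: normalizer_def\<close>)
    show "inverse m * c * m \<in> right_fractions C"
      using conj[of "inverse m" b a] right_fractionsI[of "inverse m * a * m" C "inverse m * b * m"] m c
      by (auto simp: normalizer_def)
  qed
qed

text \<open>Fractions have their denominators on the right; by commutativity, the product of these can be used on the left.\<close>

lemma common_denominator:
  assumes "subcring C (DD :: 'd::division_ring ring)" "finite S"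
    and "\<And>s. s \<in> S \<Longrightarrow> f s \<in> right_fractions C"
  obtains d where "d \<in> C" "d \<noteq> 0" "\<And>s. s \<in> S \<Longrightarrow> d * f s \<in> C"
proof -
  note C = assms(1)[unfolded subcring_DD_iff, THEN conjunct1]
  have com: "a * b = b * a" if "a \<in> C" "b \<in> C" for a b
    using assms(1) that by (auto simp: subcring_DD_iff)
  have "\<exists>d\<in>C. d \<noteq> 0 \<and> (\<forall>s\<in>S. d * f s \<in> C)"
    using assms(2,3)
  proof (induction S rule: finite_induct)
    case empty
    show ?case using subringD(1)[OF C] by (auto intro: bexI[of _ 1])
  next
    case (insert s S)
    then obtain d where d: "d \<in> C" "d \<noteq> 0" "\<And>s. s \<in> S \<Longrightarrow> d * f s \<in> C" by auto
    obtain a b where ab: "f s = a * inverse b" "a \<in> C" "b \<in> C" "b \<noteq> 0"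
      using insert.prems[of s] by (auto simp: right_fractions_def)
    have "b * f s = a" using ab com by (simp add: mult.assoc[symmetric]) (simp add: mult.assoc)
    then have "(d * b) * f s \<in> C" using ab d subringD(6)[OF C] by (simp add: mult.assoc)
    moreover have "(d * b) * f s' \<in> C" if "s' \<in> S" for s'
      using subringD(6)[OF C ab(3) d(3)[OF that]] com[OF d(1) ab(3)] by (simp add: mult.assoc)
    ultimately show ?case
      using d ab subringD(6)[OF C] by (intro bexI[of _ "d * b"]) auto
  qed
  then show ?thesis using that by blast
qed

section \<open>Laurent monomials\<close>

lemma sorted_list_of_set_subset_filter:
  assumes "finite I" "J \<subseteq> I"
  shows "sorted_list_of_set J = filter (\<lambda>i. i \<in> J) (sorted_list_of_set (I :: nat set))"
proof -
  have "sorted (filter (\<lambda>i. i \<in> J) (sorted_list_of_set I))"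
    by (simp add: sorted_wrt_filter)
  moreover have "set (filter (\<lambda>i. i \<in> J) (sorted_list_of_set I)) = J"
    using assms by auto
  moreover have "finite J" using assms finite_subset by auto
  ultimately show ?thesis
    by (intro sorted_distinct_set_unique) auto
qed

lemma prod_list_map_filter_one:
  fixes f :: "'a \<Rightarrow> 'd::monoid_mult"
  shows "(\<And>i. i \<in> set L \<Longrightarrow> \<not> P i \<Longrightarrow> f i = 1) \<Longrightarrow> prod_list (map f (filter P L)) = prod_list (map f L)"
  by (induction L) auto

lemma laurent_monomial_eq:
  assumes "finite I" "keys \<alpha> \<subseteq> I"
  shows "laurent_monomial x \<alpha> =
    prod_list (map (\<lambda>j. x j powi lookup \<alpha> j) (sorted_list_of_set I))"
  unfolding laurent_monomial_def sorted_list_of_set_subset_filter[OF assms]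
  by (rule prod_list_map_filter_one) (auto simp: in_keys_iff)

lemma prod_list_mult_commuting:
  fixes u v :: "'a \<Rightarrow> 'd::monoid_mult"
  assumes "distinct L" "\<And>i j. i \<in> set L \<Longrightarrow> j \<in> set L \<Longrightarrow> i \<noteq> j \<Longrightarrow> u i * v j = v j * u i"
  shows "prod_list (map (\<lambda>i. u i * v i) L) = prod_list (map u L) * prod_list (map v L)"
  using assms
proof (induction L)
  case (Cons a L)
  have Cons_prem: "v a * u b = u b * v a" if "b \<in> set L" for b
  proof -
    have "b \<noteq> a" using Cons.prems(1) that by auto
    then show ?thesis using Cons.prems(2)[of b a] that by simp
  qed
  have "v a * prod_list (map u L') = prod_list (map u L') * v a" if "set L' \<subseteq> set L" for L'
    using that
  proof (induction L')
    case (Cons b L')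
    then have "v a * u b = u b * v a" using Cons_prem by simp
    then show ?case using Cons by (simp add: mult.assoc[symmetric]) (simp add: mult.assoc)
  qed simp
  from this[of L] have "prod_list (map (\<lambda>i. u i * v i) (a # L)) = u a * (prod_list (map u L) * v a) * prod_list (map v L)"
    using Cons by (simp add: mult.assoc) (simp add: mult.assoc[symmetric])
  then show ?case by (simp add: mult.assoc)
qed simp

lemma prod_list_fun_upd:
  fixes u :: "'i \<Rightarrow> 'd::monoid_mult"
  assumes "distinct L" "i \<in> set L"
  shows "\<exists>a b. \<forall>z. prod_list (map (u(i := z)) L) = a * z * b"
proof -
  obtain L1 L2 where L: "L = L1 @ i # L2" using assms(2) by (auto simp: in_set_conv_decomp)
  then have "i \<notin> set L1" "i \<notin> set L2" using assms(1) by auto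
  then have "map (u(i := z)) L1 = map u L1" "map (u(i := z)) L2 = map u L2" for z
    by (auto intro!: map_cong)
  then have "\<forall>z. prod_list (map (u(i := z)) L) = prod_list (map u L1) * z * prod_list (map u L2)"
    by (simp only: L map_append list.map prod_list.append prod_list.Cons fun_upd_same mult.assoc) simp
  then show ?thesis by blast
qed

lemma prod_list_single_factor:
  fixes z :: "'d::monoid_mult"
  assumes "distinct L" "i \<in> set L"
  shows "prod_list (map ((\<lambda>_. 1)(i := z)) L) = z"
proof -
  have one: "prod_list (map ((\<lambda>_. 1)(i := z)) L') = 1" if "i \<notin> set L'" for L'
    using that by (induction L') auto
  obtain L1 L2 where L: "L = L1 @ i # L2" using assms(2) by (auto simp: in_set_conv_decomp)
  with assms(1) show ?thesis using one[of L1] one[of L2] by simp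
qed

lemma powi_commute:
  fixes a b :: "'d::division_ring"
  assumes "a * b = b * a"
  shows "a powi k * b powi l = b powi l * a powi k"
proof -
  have "a powi k \<in> centralizer {b}" using assms by (intro centralizer_powi) (simp add: centralizer_def)
  then have "b \<in> centralizer {a powi k}" by (simp add: centralizer_def)
  then have "b powi l \<in> centralizer {a powi k}" by (rule centralizer_powi)
  then show ?thesis by (simp add: centralizer_def)
qed

lemma laurent_monomial_add:
  fixes x :: "nat \<Rightarrow> 'd::division_ring"
  assumes "finite I" "keys \<alpha> \<subseteq> I" "keys \<beta> \<subseteq> I"
    and "\<And>i j. i \<in> I \<Longrightarrow> j \<in> I \<Longrightarrow> x i * x j = x j * x i" "\<And>i. i \<in> I \<Longrightarrow> x i \<noteq> 0"
  shows "laurent_monomial x (\<alpha> + \<beta>) = laurent_monomial x \<alpha> * laurent_monomial x \<beta>"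
proof -
  have k: "keys (\<alpha> + \<beta>) \<subseteq> I" using assms keys_add[of \<alpha> \<beta>] by auto
  have "laurent_monomial x (\<alpha> + \<beta>) =
     prod_list (map (\<lambda>j. x j powi lookup \<alpha> j * x j powi lookup \<beta> j) (sorted_list_of_set I))"
    unfolding laurent_monomial_eq[OF assms(1) k]
    by (rule arg_cong[of _ _ prod_list], rule map_cong) (use assms in \<open>auto simp: lookup_add power_int_add\<close>)
  also have "\<dots> = laurent_monomial x \<alpha> * laurent_monomial x \<beta>"
    unfolding laurent_monomial_eq[OF assms(1,2)] laurent_monomial_eq[OF assms(1,3)]
    by (rule prod_list_mult_commuting) (use assms in \<open>auto intro: powi_commute\<close>)
  finally show ?thesis .
qed

lemma laurent_monomial_zero [simp]: "laurent_monomial x 0 = 1"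
  by (simp add: laurent_monomial_def)

lemma laurent_monomial_single [simp]: "laurent_monomial x (single i a) = x i powi a"
  by (cases "a = 0") (simp_all add: laurent_monomial_def)

lemma laurent_monomial_in_subring:
  assumes "subring A DD" "\<And>i. i \<in> keys \<alpha> \<Longrightarrow> x i \<in> A \<and> inverse (x i) \<in> A"
  shows "laurent_monomial x \<alpha> \<in> A"
  unfolding laurent_monomial_def
  by (rule subring_prod_list[OF assms(1)]) (use assms in \<open>auto intro: subring_powi\<close>)

lemma laurent_monomial_normalizer:
  assumes "\<And>i. i \<in> keys \<alpha> \<Longrightarrow> x i \<in> normalizer C"
  shows "laurent_monomial x \<alpha> \<in> normalizer C"
  unfolding laurent_monomial_def
  by (rule normalizer_prod_list) (use assms in \<open>auto intro: normalizer_powi\<close>)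

section \<open>Independence of Laurent monomials\<close>

text \<open>
  Independence quantifies over finitely supported functions; here the coefficients are an arbitrary function on a finite
  set of exponents, as they occur in sums.
\<close>

lemma laurent_independentD:
  assumes "laurent_independent C I x" "0 \<in> C" "finite A"
    and "\<And>\<alpha>. \<alpha> \<in> A \<Longrightarrow> keys \<alpha> \<subseteq> I" "\<And>\<alpha>. \<alpha> \<in> A \<Longrightarrow> f \<alpha> \<in> C"
    and "(\<Sum>\<alpha>\<in>A. f \<alpha> * laurent_monomial x \<alpha>) = 0" "\<alpha> \<in> A"
  shows "f \<alpha> = 0"
proof -
  define c where "c = (\<Sum>\<alpha>\<in>A. single \<alpha> (f \<alpha>))"
  have l: "lookup c \<beta> = (if \<beta> \<in> A then f \<beta> else 0)" for \<beta>
    unfolding c_def lookup_sum using assms(3) by (simp add: lookup_single when_def)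
  have sub: "keys c \<subseteq> A" by (auto simp: in_keys_iff l split: if_splits)
  have "c \<in> laurent_coeffs C I"
    using sub assms(2,4,5) by (auto simp: laurent_coeffs_def l)
  moreover have "laurent_sum x c = (\<Sum>\<alpha>\<in>A. f \<alpha> * laurent_monomial x \<alpha>)"
    unfolding laurent_sum_def using sub assms(3)
    by (intro sum.mono_neutral_cong_left) (auto simp: l in_keys_iff)
  ultimately have "c = 0" using assms(1,6) by (auto simp: laurent_independent_def)
  then show ?thesis using l[of \<alpha>] assms(7) by simp
qed

lemma laurent_independentI:
  assumes "\<And>A f \<alpha>. finite A \<Longrightarrow> (\<And>\<alpha>. \<alpha> \<in> A \<Longrightarrow> keys \<alpha> \<subseteq> I) \<Longrightarrow>
     (\<And>\<alpha>. \<alpha> \<in> A \<Longrightarrow> f \<alpha> \<in> C) \<Longrightarrow> (\<Sum>\<alpha>\<in>A. f \<alpha> * laurent_monomial x \<alpha>) = 0 \<Longrightarrow> \<alpha> \<in> A \<Longrightarrow> f \<alpha> = 0"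
  shows "laurent_independent C I x"
  unfolding laurent_independent_def
proof (intro ballI impI)
  fix c assume c: "c \<in> laurent_coeffs C I" "laurent_sum x c = 0"
  show "c = 0"
  proof (rule ccontr)
    assume "c \<noteq> 0"
    then obtain \<alpha> where "\<alpha> \<in> keys c" by (metis keys_eq_empty all_not_in_conv)
    moreover from this have "lookup c \<alpha> = 0"
      using c by (intro assms[of "keys c" "lookup c"])
        (auto simp: laurent_coeffs_def laurent_sum_def)
    ultimately show False by (simp add: in_keys_iff)
  qed
qed

lemma laurent_independent_mono:
  "\<lbrakk>laurent_independent C I x; C' \<subseteq> C\<rbrakk> \<Longrightarrow> laurent_independent C' I x"
  by (auto simp: laurent_independent_def laurent_coeffs_def subset_iff)

lemma laurent_independent_nonzero:
  assumes "laurent_independent C I x" "0 \<in> C" "1 \<in> C" "i \<in> I"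
  shows "x i \<noteq> 0"
proof
  assume "x i = 0"
  then show False
    using laurent_independentD[OF assms(1,2), of "{single i 1}" "\<lambda>_. 1"] assms by simp
qed

text \<open>
  Coefficients stand on the left of the monomials, so a relation can be multiplied from the left by a common denominator.
\<close>

lemma laurent_independent_right_fractions:
  assumes "subcring C (DD :: 'd::division_ring ring)" "laurent_independent C I x"
  shows "laurent_independent (right_fractions C) I x"
proof (rule laurent_independentI)
  fix A :: "(nat \<Rightarrow>\<^sub>0 int) set" and f \<alpha>
  assume A: "finite A" "\<And>\<alpha>. \<alpha> \<in> A \<Longrightarrow> keys \<alpha> \<subseteq> I"
    "\<And>\<alpha>. \<alpha> \<in> A \<Longrightarrow> f \<alpha> \<in> right_fractions C" "(\<Sum>\<alpha>\<in>A. f \<alpha> * laurent_monomial x \<alpha>) = 0" "\<alpha> \<in> A"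
  obtain d where d: "d \<in> C" "d \<noteq> 0" "\<And>s. s \<in> A \<Longrightarrow> d * f s \<in> C"
    using common_denominator[of C A f, OF assms(1) A(1) A(3)] by blast
  have "(\<Sum>\<alpha>\<in>A. (d * f \<alpha>) * laurent_monomial x \<alpha>) = d * (\<Sum>\<alpha>\<in>A. f \<alpha> * laurent_monomial x \<alpha>)"
    by (simp add: sum_distrib_left mult.assoc)
  then have "d * f \<alpha> = 0"
    using A d assms(1)
    by (intro laurent_independentD[OF assms(2), of A "\<lambda>\<alpha>. d * f \<alpha>"])
      (auto simp: subcring_DD_iff intro: subringD)
  then show "f \<alpha> = 0" using d by simp
qed

text \<open>The factor \<open>m\<close> is required to normalize \<open>C\<close>, which makes the relation compatible with products.\<close>

definition left_multiple :: "'d::division_ring set \<Rightarrow> 'd \<Rightarrow> 'd \<Rightarrow> bool"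
  where "left_multiple C w m \<longleftrightarrow> (\<exists>q\<in>C. q \<noteq> 0 \<and> w = q * m) \<and> m \<in> normalizer C"

lemma left_multiple_one: "subring C DD \<Longrightarrow> left_multiple C 1 1"
  by (auto simp: left_multiple_def normalizer_one dest: subringD(1))

lemma left_multiple_mult:
  assumes C: "subring C DD" and ww: "left_multiple C w m" "left_multiple C w' m'"
  shows "left_multiple C (w * w') (m * m')"
proof -
  obtain q q' where q: "q \<in> C" "q \<noteq> 0" "w = q * m" "m \<in> normalizer C"
    and q': "q' \<in> C" "q' \<noteq> 0" "w' = q' * m'" "m' \<in> normalizer C"
    using ww by (auto simp: left_multiple_def)
  obtain c' where c': "c' \<in> C" "m * q' = c' * m" "q' \<noteq> 0 \<longrightarrow> c' \<noteq> 0"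
    using normalizer_shift[OF q(4) q'(1)] by blast
  have "w * w' = q * (m * q') * m'" by (simp add: q q' mult.assoc)
  then have "w * w' = (q * c') * (m * m')" by (simp add: c' mult.assoc)
  then show ?thesis using q q' c' C
    by (auto simp: left_multiple_def intro!: normalizer_mult bexI[of _ "q * c'"] subringD)
qed

lemma left_multiple_power:
  "\<lbrakk>subring C DD; left_multiple C w m\<rbrakk> \<Longrightarrow> left_multiple C (w ^ l) (m ^ l)"
  by (induction l) (auto intro: left_multiple_one left_multiple_mult)

text \<open>
  Replacing every \<open>x i\<close> by a scalar multiple of \<open>x i\<close> or of \<open>(x i)\<^sup>-\<^sup>1\<close> only permutes the Laurent monomials
  up to nonzero coefficients on the left.
\<close>

lemma laurent_independent_rescale:
  fixes x z :: "nat \<Rightarrow> 'd::division_ring" and \<epsilon> :: "nat \<Rightarrow> int"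
  assumes Q: "subring Q DD" "\<And>q. q \<in> Q \<Longrightarrow> inverse q \<in> Q"
    and x: "\<And>i. i \<in> I \<Longrightarrow> x i \<in> normalizer Q" and ind: "laurent_independent Q I x"
    and a: "\<And>i. i \<in> I \<Longrightarrow> a i \<in> Q \<and> a i \<noteq> 0" and \<epsilon>: "\<And>i. i \<in> I \<Longrightarrow> \<epsilon> i = 1 \<or> \<epsilon> i = - 1"
    and z: "\<And>i. i \<in> I \<Longrightarrow> z i = a i * x i powi \<epsilon> i"
  shows "laurent_independent Q I z"
proof -
  have inv: "left_multiple Q (inverse w) (inverse m)" if ww: "left_multiple Q w m" for w m
  proof -
    obtain q where q: "q \<in> Q" "q \<noteq> 0" "w = q * m" "m \<in> normalizer Q"
      using ww by (auto simp: left_multiple_def)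
    obtain c' where c': "c' \<in> Q" "inverse m * inverse q = c' * inverse m" "inverse q \<noteq> 0 \<longrightarrow> c' \<noteq> 0"
      using normalizer_shift[OF normalizer_inverse[OF q(4)] Q(2)[OF q(1)]] by blast
    have "inverse w = c' * inverse m"
      using q c' normalizer_nonzero[OF q(4)] by (simp add: nonzero_inverse_mult_distrib)
    then show ?thesis using q c'
      by (auto simp: left_multiple_def intro!: normalizer_inverse bexI[of _ "c'"])
  qed
  have powi: "left_multiple Q (w powi k) (m powi k)" if "left_multiple Q w m" for w m k
    using that by (simp add: power_int_def inv left_multiple_power[OF Q(1)])
  define e where "e \<alpha> = Poly_Mapping.mapp (\<lambda>i b. \<epsilon> i * b) \<alpha>" for \<alpha> :: "nat \<Rightarrow>\<^sub>0 int"
  have le: "lookup (e \<alpha>) i = \<epsilon> i * lookup \<alpha> i" for \<alpha> i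
    by (simp add: e_def lookup_mapp when_def in_keys_iff)
  have ke: "keys (e \<alpha>) = keys \<alpha>" if "keys \<alpha> \<subseteq> I" for \<alpha>
    using that \<epsilon> by (fastforce simp: in_keys_iff le)
  have "left_multiple Q (laurent_monomial z \<alpha>) (laurent_monomial x (e \<alpha>))"
    if k: "keys \<alpha> \<subseteq> I" for \<alpha>
  proof -
    have "left_multiple Q (prod_list (map (\<lambda>j. z j powi lookup \<alpha> j) L))
          (prod_list (map (\<lambda>j. x j powi lookup (e \<alpha>) j) L))" if "set L \<subseteq> I" for L
      using that
    proof (induction L)
      case (Cons j L)
      then have "left_multiple Q (z j) (x j powi \<epsilon> j)"
        using a z x by (auto simp: left_multiple_def intro: normalizer_powi)
      from powi[OF this]
      have "left_multiple Q (z j powi lookup \<alpha> j) (x j powi lookup (e \<alpha>) j)"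
        by (simp add: le power_int_mult)
      with Cons show ?case by (auto intro: left_multiple_mult[OF Q(1)])
    qed (simp add: left_multiple_one[OF Q(1)])
    then show ?thesis
      unfolding laurent_monomial_def ke[OF k] using k by simp
  qed
  then obtain q where q: "\<And>\<alpha>. keys \<alpha> \<subseteq> I \<Longrightarrow> q \<alpha> \<in> Q \<and> q \<alpha> \<noteq> 0 \<and>
      laurent_monomial z \<alpha> = q \<alpha> * laurent_monomial x (e \<alpha>)"
    unfolding left_multiple_def by metis
  have inj: "inj_on e {\<alpha>. keys \<alpha> \<subseteq> I}"
  proof (rule inj_onI, rule poly_mapping_eqI)
    fix \<alpha> \<beta> i assume ab: "\<alpha> \<in> {\<alpha>. keys \<alpha> \<subseteq> I}" "\<beta> \<in> {\<alpha>. keys \<alpha> \<subseteq> I}" "e \<alpha> = e \<beta>"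
    show "lookup \<alpha> i = lookup \<beta> i"
    proof (cases "i \<in> I")
      case True
      then show ?thesis using \<epsilon>[OF True] le[of \<alpha> i] le[of \<beta> i] ab(3) by auto
    next
      case False
      then have "i \<notin> keys \<alpha>" "i \<notin> keys \<beta>" using ab by auto
      then show ?thesis by (simp add: in_keys_iff)
    qed
  qed
  show ?thesis
  proof (rule laurent_independentI)
    fix A :: "(nat \<Rightarrow>\<^sub>0 int) set" and f \<alpha>
    assume A: "finite A" "\<And>\<alpha>. \<alpha> \<in> A \<Longrightarrow> keys \<alpha> \<subseteq> I"
      "\<And>\<alpha>. \<alpha> \<in> A \<Longrightarrow> f \<alpha> \<in> Q" "(\<Sum>\<alpha>\<in>A. f \<alpha> * laurent_monomial z \<alpha>) = 0" "\<alpha> \<in> A"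
    have injA: "inj_on e A" using inj by (rule inj_on_subset) (use A in auto)
    define g where "g \<beta> = f (inv_into A e \<beta>) * q (inv_into A e \<beta>)" for \<beta>
    have g: "g (e \<alpha>) = f \<alpha> * q \<alpha>" if "\<alpha> \<in> A" for \<alpha>
      using that injA by (simp add: g_def)
    have "(\<Sum>\<beta>\<in>e ` A. g \<beta> * laurent_monomial x \<beta>) = (\<Sum>\<alpha>\<in>A. g (e \<alpha>) * laurent_monomial x (e \<alpha>))"
      by (simp add: sum.reindex[OF injA])
    also have "\<dots> = (\<Sum>\<alpha>\<in>A. f \<alpha> * laurent_monomial z \<alpha>)"
      by (rule sum.cong) (use A q in \<open>auto simp: g mult.assoc\<close>)
    finally have sum0: "(\<Sum>\<beta>\<in>e ` A. g \<beta> * laurent_monomial x \<beta>) = 0"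
      by (simp only: A(4))
    have "g (e \<alpha>) = 0"
    proof (rule laurent_independentD[OF ind subringD(2)[OF Q(1)] finite_imageI[OF A(1)] _ _ sum0 imageI[OF A(5)]])
      show "keys \<beta> \<subseteq> I" if "\<beta> \<in> e ` A" for \<beta>
        using that A(2) ke by blast
      show "g \<beta> \<in> Q" if "\<beta> \<in> e ` A" for \<beta>
        using that g A(2,3) q subringD(6)[OF Q(1)] by auto
    qed
    then show "f \<alpha> = 0" using g A q by force
  qed
qed

section \<open>Monoid rings and presentations\<close>

lemma poly_mapping_support_induct [consumes 1, case_names zero single add]:
  fixes p :: "'m \<Rightarrow>\<^sub>0 'c::comm_monoid_add"
  assumes "keys p \<subseteq> S" and "P 0" and "\<And>u a. u \<in> S \<Longrightarrow> P (single u a)"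
    and "\<And>p q. \<lbrakk>keys p \<subseteq> S; keys q \<subseteq> S; P p; P q\<rbrakk> \<Longrightarrow> P (p + q)"
  shows "P p"
proof -
  have "P (\<Sum>u\<in>K. single u (lookup p u)) \<and>
      keys (\<Sum>u\<in>K. single u (lookup p u)) \<subseteq> S"
    if "K \<subseteq> S" "finite K" for K
    using that(2,1)
  proof (induction K rule: finite_induct)
    case (insert u K)
    let ?s = "single u (lookup p u)"
      and ?t = "\<Sum>u\<in>K. single u (lookup p u)"
    have s: "keys ?s \<subseteq> S" and t: "keys ?t \<subseteq> S" and "u \<in> S"
      using insert by auto
    have "P (?s + ?t)" using s t insert assms(3)[OF \<open>u \<in> S\<close>] by (intro assms(4)) auto
    moreover have "keys (?s + ?t) \<subseteq> S"
      using s t keys_add[of ?s ?t] by blast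
    ultimately show ?case using insert by simp
  qed (auto intro: assms(2))
  moreover have "(\<Sum>u\<in>keys p. single u (lookup p u)) = p"
    by (rule poly_mapping_eqI)
      (simp add: lookup_sum lookup_single when_def in_keys_iff)
  ultimately show ?thesis using assms(1) by (metis finite_keys)
qed

lemma monoid_ring_simps [simp]:
  "carrier (monoid_ring M) = {p. keys p \<subseteq> carrier M}"
  "one (monoid_ring M) = single \<one>\<^bsub>M\<^esub> 1"
  "ring.zero (monoid_ring M) = 0"
  "add (monoid_ring M) = (+)"
  by (simp_all add: monoid_ring_def)

text \<open>
  With index sets that do not depend on the supports, the product becomes visibly bilinear.
\<close>

lemma monoid_ring_mult_superset:
  assumes "finite U" "finite V" "keys p \<subseteq> U" "keys q \<subseteq> V"
  shows "p \<otimes>\<^bsub>monoid_ring M\<^esub> q = (\<Sum>u\<in>U. \<Sum>v\<in>V.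
        single (u \<otimes>\<^bsub>M\<^esub> v) (lookup p u * lookup q v))"
proof -
  have "p \<otimes>\<^bsub>monoid_ring M\<^esub> q = (\<Sum>u\<in>keys p. \<Sum>v\<in>V.
        single (u \<otimes>\<^bsub>M\<^esub> v) (lookup p u * lookup q v))"
    unfolding monoid_ring_def monoid.simps
    by (intro sum.cong refl sum.mono_neutral_left) (use assms in \<open>auto simp: in_keys_iff\<close>)
  also have "\<dots> = (\<Sum>u\<in>U. \<Sum>v\<in>V.
        single (u \<otimes>\<^bsub>M\<^esub> v) (lookup p u * lookup q v))"
    by (intro sum.mono_neutral_left) (use assms in \<open>auto simp: in_keys_iff\<close>)
  finally show ?thesis .
qed

lemma monoid_ring_mult_single [simp]:
  "single u a \<otimes>\<^bsub>monoid_ring M\<^esub> single v b = single (u \<otimes>\<^bsub>M\<^esub> v) (a * b)"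
  by (subst monoid_ring_mult_superset[of "{u}" "{v}"]) auto

lemma monoid_ring_mult_add:
  "(p + p') \<otimes>\<^bsub>monoid_ring M\<^esub> q = p \<otimes>\<^bsub>monoid_ring M\<^esub> q + p' \<otimes>\<^bsub>monoid_ring M\<^esub> q"
  "q \<otimes>\<^bsub>monoid_ring M\<^esub> (p + p') = q \<otimes>\<^bsub>monoid_ring M\<^esub> p + q \<otimes>\<^bsub>monoid_ring M\<^esub> p'"
proof -
  let ?U = "keys p \<union> keys p'" and ?V = "keys q"
  have k: "keys (p + p') \<subseteq> ?U" by (rule keys_add)
  show "(p + p') \<otimes>\<^bsub>monoid_ring M\<^esub> q = p \<otimes>\<^bsub>monoid_ring M\<^esub> q + p' \<otimes>\<^bsub>monoid_ring M\<^esub> q"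
    using k by (simp add: monoid_ring_mult_superset[of ?U ?V] lookup_add distrib_right single_add sum.distrib)
  show "q \<otimes>\<^bsub>monoid_ring M\<^esub> (p + p') = q \<otimes>\<^bsub>monoid_ring M\<^esub> p + q \<otimes>\<^bsub>monoid_ring M\<^esub> p'"
    using k by (simp add: monoid_ring_mult_superset[of ?V ?U] lookup_add distrib_left single_add sum.distrib)
qed

lemma monoid_ring_mult_zero [simp]:
  "0 \<otimes>\<^bsub>monoid_ring M\<^esub> q = 0" "q \<otimes>\<^bsub>monoid_ring M\<^esub> 0 = 0"
  by (simp_all add: monoid_ring_def)

lemma monoid_ring_mult_diff:
  "q \<otimes>\<^bsub>monoid_ring M\<^esub> (p - p') = q \<otimes>\<^bsub>monoid_ring M\<^esub> p - q \<otimes>\<^bsub>monoid_ring M\<^esub> p'"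
  "(p - p') \<otimes>\<^bsub>monoid_ring M\<^esub> q = p \<otimes>\<^bsub>monoid_ring M\<^esub> q - p' \<otimes>\<^bsub>monoid_ring M\<^esub> q"
  using monoid_ring_mult_add(2)[of M q "p - p'" p'] monoid_ring_mult_add(1)[of M "p - p'" p' q]
  by simp_all

lemma monoid_ring_ring:
  assumes "monoid M"
  shows "ring (monoid_ring M :: ('m \<Rightarrow>\<^sub>0 'c::comm_ring_1) ring)"
proof -
  interpret M: monoid M by fact
  let ?G = "monoid_ring M :: ('m \<Rightarrow>\<^sub>0 'c) ring"
  have cl: "keys (p \<otimes>\<^bsub>?G\<^esub> q) \<subseteq> carrier M"
    if "keys p \<subseteq> carrier M" "keys q \<subseteq> carrier M" for p q
    using that
  proof (induction p rule: poly_mapping_support_induct)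
    case (single u a)
    show ?case using single(2)
    proof (induction q rule: poly_mapping_support_induct)
      case (single v b) then show ?case using \<open>u \<in> carrier M\<close> by auto
    next
      case (add q q')
      then show ?case
        using keys_add[of "single u a \<otimes>\<^bsub>?G\<^esub> q" "single u a \<otimes>\<^bsub>?G\<^esub> q'"]
        unfolding monoid_ring_mult_add by blast
    qed auto
  next
    case (add p p')
    then show ?case
      using keys_add[of "p \<otimes>\<^bsub>?G\<^esub> q" "p' \<otimes>\<^bsub>?G\<^esub> q"]
      unfolding monoid_ring_mult_add by blast
  qed auto
  have assoc: "p \<otimes>\<^bsub>?G\<^esub> q \<otimes>\<^bsub>?G\<^esub> r = p \<otimes>\<^bsub>?G\<^esub> (q \<otimes>\<^bsub>?G\<^esub> r)"
    if "keys p \<subseteq> carrier M" "keys q \<subseteq> carrier M" "keys r \<subseteq> carrier M" for p q r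
    using that
  proof (induction p rule: poly_mapping_support_induct)
    case (single u a)
    show ?case using single(2,3)
    proof (induction q rule: poly_mapping_support_induct)
      case (single v b)
      show ?case using single(2)
      proof (induction r rule: poly_mapping_support_induct)
        case (single w c)
        then show ?case using \<open>u \<in> carrier M\<close> \<open>v \<in> carrier M\<close> by (simp add: M.m_assoc mult.assoc)
      qed (auto simp: monoid_ring_mult_add)
    qed (auto simp: monoid_ring_mult_add)
  qed (auto simp: monoid_ring_mult_add)
  have one: "single \<one>\<^bsub>M\<^esub> 1 \<otimes>\<^bsub>?G\<^esub> p = p" "p \<otimes>\<^bsub>?G\<^esub> single \<one>\<^bsub>M\<^esub> 1 = p"
    if "keys p \<subseteq> carrier M" for p
    using that by (induction p rule: poly_mapping_support_induct) (auto simp: monoid_ring_mult_add)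
  show ?thesis
  proof (rule ringI)
    show "abelian_group ?G"
    proof (rule abelian_groupI)
      show "p \<oplus>\<^bsub>?G\<^esub> q \<in> carrier ?G" if "p \<in> carrier ?G" "q \<in> carrier ?G" for p q
        using that keys_add[of p q] by auto
      show "\<exists>q\<in>carrier ?G. q \<oplus>\<^bsub>?G\<^esub> p = \<zero>\<^bsub>?G\<^esub>" if "p \<in> carrier ?G" for p
        using that by (intro bexI[of _ "- p"]) (auto simp: in_keys_iff)
    qed (simp_all add: add_ac)
    show "monoid ?G"
      by (rule monoidI) (simp_all add: cl assoc one)
  qed (auto simp: monoid_ring_mult_add)
qed

lemma monoid_ring_a_inv:
  assumes "monoid M" "keys p \<subseteq> carrier M"
  shows "\<ominus>\<^bsub>monoid_ring M\<^esub> p = - (p :: 'm \<Rightarrow>\<^sub>0 'c::comm_ring_1)"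
proof -
  interpret ring "monoid_ring M :: ('m \<Rightarrow>\<^sub>0 'c) ring" by (rule monoid_ring_ring) fact
  have "keys (- p) \<subseteq> carrier M" using assms(2) by (auto simp: in_keys_iff)
  then show ?thesis using assms by (intro minus_equality) auto
qed

lemma monoid_ring_ideal:
  assumes "monoid M" "ideal J (monoid_ring M :: ('m \<Rightarrow>\<^sub>0 'c::comm_ring_1) ring)"
  shows "0 \<in> J" "\<lbrakk>a \<in> J; b \<in> J\<rbrakk> \<Longrightarrow> a + b \<in> J" "a \<in> J \<Longrightarrow> - a \<in> J" "\<lbrakk>a \<in> J; b \<in> J\<rbrakk> \<Longrightarrow> a - b \<in> J"
    "\<lbrakk>a \<in> J; keys p \<subseteq> carrier M\<rbrakk> \<Longrightarrow> p \<otimes>\<^bsub>monoid_ring M\<^esub> a \<in> J"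
    "\<lbrakk>a \<in> J; keys p \<subseteq> carrier M\<rbrakk> \<Longrightarrow> a \<otimes>\<^bsub>monoid_ring M\<^esub> p \<in> J"
    "a \<in> J \<Longrightarrow> keys a \<subseteq> carrier M"
    "(\<And>i. i \<in> S \<Longrightarrow> f i \<in> J) \<Longrightarrow> sum f S \<in> J"
proof -
  interpret ideal J "monoid_ring M" by fact
  show z: "0 \<in> J" and p: "\<And>a b. \<lbrakk>a \<in> J; b \<in> J\<rbrakk> \<Longrightarrow> a + b \<in> J"
    using additive_subgroup.zero_closed[OF is_additive_subgroup] additive_subgroup.a_closed[OF is_additive_subgroup]
    by auto
  show k: "\<And>a. a \<in> J \<Longrightarrow> keys a \<subseteq> carrier M"
    using a_subset by auto
  show m: "\<And>a. a \<in> J \<Longrightarrow> - a \<in> J"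
    using additive_subgroup.a_inv_closed[OF is_additive_subgroup] monoid_ring_a_inv[OF assms(1) k] by metis
  show "\<lbrakk>a \<in> J; b \<in> J\<rbrakk> \<Longrightarrow> a - b \<in> J" using p[of a "- b"] m[of b] by simp
  show "\<lbrakk>a \<in> J; keys p \<subseteq> carrier M\<rbrakk> \<Longrightarrow> p \<otimes>\<^bsub>monoid_ring M\<^esub> a \<in> J"
    "\<lbrakk>a \<in> J; keys p \<subseteq> carrier M\<rbrakk> \<Longrightarrow> a \<otimes>\<^bsub>monoid_ring M\<^esub> p \<in> J"
    using I_l_closed[of a p] I_r_closed[of a p] by auto
  show "(\<And>i. i \<in> S \<Longrightarrow> f i \<in> J) \<Longrightarrow> sum f S \<in> J"
    by (induction S rule: infinite_finite_induct) (auto intro: z p)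
qed

text \<open>The \<open>\<kappa>\<close>-linear extension of \<open>h\<close>.\<close>

definition eval_map :: "('c::comm_ring_1 \<Rightarrow> 'd) \<Rightarrow> ('m \<Rightarrow> 'd) \<Rightarrow> ('m \<Rightarrow>\<^sub>0 'c) \<Rightarrow> 'd::division_ring"
  where "eval_map \<kappa> h p = (\<Sum>u\<in>keys p. \<kappa> (lookup p u) * h u)"

locale central_scalars =
  fixes \<kappa> :: "'c::comm_ring_1 \<Rightarrow> 'd::division_ring"
  assumes scal_add: "\<kappa> (a + b) = \<kappa> a + \<kappa> b" and scal_mult: "\<kappa> (a * b) = \<kappa> a * \<kappa> b"
    and scal_one [simp]: "\<kappa> 1 = 1" and scal_central: "\<kappa> a * z = z * \<kappa> a"
begin

lemma scal_zero [simp]: "\<kappa> 0 = 0"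
  using scal_add[of 0 0] by simp

lemma eval_map_superset:
  "\<lbrakk>finite U; keys p \<subseteq> U\<rbrakk> \<Longrightarrow> eval_map \<kappa> h p = (\<Sum>u\<in>U. \<kappa> (lookup p u) * h u)"
  unfolding eval_map_def by (rule sum.mono_neutral_left) (auto simp: in_keys_iff)

lemma eval_map_zero [simp]: "eval_map \<kappa> h 0 = 0"
  by (simp add: eval_map_def)

lemma eval_map_single [simp]: "eval_map \<kappa> h (single u a) = \<kappa> a * h u"
  by (cases "a = 0") (simp_all add: eval_map_def)

lemma eval_map_add [simp]: "eval_map \<kappa> h (p + q) = eval_map \<kappa> h p + eval_map \<kappa> h q"
proof -
  let ?U = "keys p \<union> keys q"
  show ?thesis using keys_add[of p q]
    by (simp add: eval_map_superset[of ?U] lookup_add scal_add distrib_right sum.distrib)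
qed

lemma eval_map_diff [simp]: "eval_map \<kappa> h (p - q) = eval_map \<kappa> h p - eval_map \<kappa> h q"
  using eval_map_add[of h "p - q" q] by simp

lemma eval_map_sum: "eval_map \<kappa> h (sum f S) = (\<Sum>s\<in>S. eval_map \<kappa> h (f s))"
  by (induction S rule: infinite_finite_induct) auto

lemma eval_map_mult:
  assumes "\<And>u v. \<lbrakk>u \<in> carrier M; v \<in> carrier M\<rbrakk> \<Longrightarrow> h (u \<otimes>\<^bsub>M\<^esub> v) = h u * h v"
    and "keys p \<subseteq> carrier M" "keys q \<subseteq> carrier M"
  shows "eval_map \<kappa> h (p \<otimes>\<^bsub>monoid_ring M\<^esub> q) = eval_map \<kappa> h p * eval_map \<kappa> h q"
  using assms(2,3)
proof (induction p rule: poly_mapping_support_induct)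
  case (single u a)
  show ?case using single(2)
  proof (induction q rule: poly_mapping_support_induct)
    case (single v b)
    have "\<kappa> (a * b) * (h u * h v) = \<kappa> a * (\<kappa> b * h u) * h v"
      by (simp only: scal_mult mult.assoc)
    also have "\<dots> = \<kappa> a * (h u * \<kappa> b) * h v"
      by (simp only: scal_central[of b "h u"])
    also have "\<dots> = \<kappa> a * h u * (\<kappa> b * h v)"
      by (simp only: mult.assoc)
    finally show ?case using assms(1)[OF \<open>u \<in> carrier M\<close> single(1)] by simp
  qed (auto simp: monoid_ring_mult_add distrib_left)
qed (auto simp: monoid_ring_mult_add distrib_right)

text \<open>
  The first isomorphism theorem; the kernel contains the ideal because evaluation kills the relations.
\<close>

lemma presentation_iso:
  fixes M :: "('m, 'z) monoid_scheme" and Rel :: "('m \<Rightarrow>\<^sub>0 'c) set"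
  defines "G \<equiv> monoid_ring M :: ('m \<Rightarrow>\<^sub>0 'c) ring"
  assumes M: "monoid M" and A: "subring A (DD :: 'd ring)"
    and h: "\<And>u v. \<lbrakk>u \<in> carrier M; v \<in> carrier M\<rbrakk> \<Longrightarrow> h (u \<otimes>\<^bsub>M\<^esub> v) = h u * h v" "h \<one>\<^bsub>M\<^esub> = 1"
    and surj: "eval_map \<kappa> h ` carrier G = A"
    and Rel: "Rel \<subseteq> carrier G" "\<And>r. r \<in> Rel \<Longrightarrow> eval_map \<kappa> h r = 0"
    and ker: "\<And>p. \<lbrakk>keys p \<subseteq> carrier M; eval_map \<kappa> h p = 0\<rbrakk> \<Longrightarrow> p \<in> Idl\<^bsub>G\<^esub> Rel"
  shows "(\<lambda>Y. the_elem (eval_map \<kappa> h ` Y)) \<in> ring_iso (G Quot Idl\<^bsub>G\<^esub> Rel) (sub_ring A)"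
    and "\<And>p. keys p \<subseteq> carrier M \<Longrightarrow> the_elem (eval_map \<kappa> h ` (Idl\<^bsub>G\<^esub> Rel +>\<^bsub>G\<^esub> p)) = eval_map \<kappa> h p"
proof -
  interpret G: ring G unfolding G_def by (rule monoid_ring_ring) fact
  interpret S: ring "sub_ring A" by (rule sub_ring_ring) fact
  have cl: "eval_map \<kappa> h p \<in> A" if "p \<in> carrier G" for p
    using surj that by auto
  have carG: "carrier G = {p. keys p \<subseteq> carrier M}" by (simp add: G_def)
  have hom: "eval_map \<kappa> h \<in> ring_hom G (sub_ring A)"
  proof (rule ring_hom_memI)
    fix p q assume pq: "p \<in> carrier G" "q \<in> carrier G"
    then show "eval_map \<kappa> h (p \<otimes>\<^bsub>G\<^esub> q) = eval_map \<kappa> h p \<otimes>\<^bsub>sub_ring A\<^esub> eval_map \<kappa> h q"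
      unfolding G_def by (subst eval_map_mult[OF h(1)]) auto
    show "eval_map \<kappa> h (p \<oplus>\<^bsub>G\<^esub> q) = eval_map \<kappa> h p \<oplus>\<^bsub>sub_ring A\<^esub> eval_map \<kappa> h q"
      by (simp add: G_def)
  next
    show "eval_map \<kappa> h p \<in> carrier (sub_ring A)" if "p \<in> carrier G" for p
      using cl[OF that] by simp
    show "eval_map \<kappa> h \<one>\<^bsub>G\<^esub> = \<one>\<^bsub>sub_ring A\<^esub>"
      by (simp add: G_def h(2))
  qed
  interpret H: ring_hom_ring G "sub_ring A" "eval_map \<kappa> h"
    by (intro ring_hom_ringI2 hom G.ring_axioms S.ring_axioms)
  define N where "N = a_kernel G (sub_ring A) (eval_map \<kappa> h)"
  have N: "p \<in> N \<longleftrightarrow> p \<in> carrier G \<and> eval_map \<kappa> h p = 0" for p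
    unfolding N_def a_kernel_def' by simp
  have "Idl\<^bsub>G\<^esub> Rel \<subseteq> N"
    unfolding N_def
  proof (rule G.genideal_minimal[OF H.kernel_is_ideal])
    show "Rel \<subseteq> a_kernel G (sub_ring A) (eval_map \<kappa> h)"
      unfolding N_def[symmetric] using Rel N by blast
  qed
  moreover have "N \<subseteq> Idl\<^bsub>G\<^esub> Rel"
    using ker N carG by blast
  ultimately have eq: "Idl\<^bsub>G\<^esub> Rel = N" by blast
  have "eval_map \<kappa> h ` carrier G = carrier (sub_ring A)" using surj by simp
  from H.FactRing_iso_set[OF this]
  show "(\<lambda>Y. the_elem (eval_map \<kappa> h ` Y)) \<in> ring_iso (G Quot Idl\<^bsub>G\<^esub> Rel) (sub_ring A)"
    unfolding eq N_def .
  fix p :: "'m \<Rightarrow>\<^sub>0 'c" assume p: "keys p \<subseteq> carrier M"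
  have "N +>\<^bsub>G\<^esub> p = (\<lambda>a. a + p) ` N"
    unfolding a_r_coset_def' by (auto simp: G_def)
  moreover have "eval_map \<kappa> h (a + p) = eval_map \<kappa> h p" if "a \<in> N" for a
    using that N by simp
  moreover have "0 \<in> N"
    unfolding N carG by simp
  ultimately have "eval_map \<kappa> h ` (N +>\<^bsub>G\<^esub> p) = {eval_map \<kappa> h p}"
    by auto
  then show "the_elem (eval_map \<kappa> h ` (Idl\<^bsub>G\<^esub> Rel +>\<^bsub>G\<^esub> p)) = eval_map \<kappa> h p"
    unfolding eq by simp
qed

end

section \<open>Generalized Weyl algebras inside a division ring\<close>

lemma word_monoid_simps [simp]:
  "carrier (word_monoid L) = lists L" "u \<otimes>\<^bsub>word_monoid L\<^esub> v = u @ v" "\<one>\<^bsub>word_monoid L\<^esub> = []"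
  by (simp_all add: word_monoid_def)

lemma monoid_word_monoid: "monoid (word_monoid L)"
  by (rule monoidI) auto

interpretation int_scalars: central_scalars "of_int :: int \<Rightarrow> 'd::division_ring"
  by unfold_locales (simp_all, rule mult_of_int_commute)

text \<open>
  The relation \<open>gx i * gy i = \<xi> i\<close> determines \<open>gy i\<close> in a division ring, so the defining relations of \<open>R(\<theta>,\<xi>)\<close> reduce
  to those between the \<open>gx i\<close> and the coefficients.
\<close>

locale gwa_realization =
  fixes R :: "'d::division_ring set" and I :: "nat set" and \<theta> :: "nat \<Rightarrow> 'd \<Rightarrow> 'd"
    and \<xi> gx gy :: "nat \<Rightarrow> 'd"
  assumes datum: "gwa_datum R I \<theta> \<xi>" and fin: "finite I"
    and xi_nonzero: "i \<in> I \<Longrightarrow> \<xi> i \<noteq> 0"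
    and gx_nonzero: "i \<in> I \<Longrightarrow> gx i \<noteq> 0"
    and gx_coef: "\<lbrakk>i \<in> I; r \<in> R\<rbrakk> \<Longrightarrow> gx i * r = \<theta> i r * gx i"
    and gx_comm: "\<lbrakk>i \<in> I; j \<in> I\<rbrakk> \<Longrightarrow> gx i * gx j = gx j * gx i"
    and gy_eq: "i \<in> I \<Longrightarrow> gy i = inverse (gx i) * \<xi> i"
    and indep: "laurent_independent R I gx"
begin

lemma R_sub: "subring R DD" and R_comm: "\<lbrakk>r \<in> R; s \<in> R\<rbrakk> \<Longrightarrow> r * s = s * r"
  using datum by (auto simp: gwa_datum_def subcring_DD_iff)

lemma xi_R: "i \<in> I \<Longrightarrow> \<xi> i \<in> R" and theta_xi: "\<lbrakk>i \<in> I; j \<in> I; i \<noteq> j\<rbrakk> \<Longrightarrow> \<theta> i (\<xi> j) = \<xi> j"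
  using datum by (auto simp: gwa_datum_def)

lemma theta_bij: "i \<in> I \<Longrightarrow> bij_betw (\<theta> i) R R"
  using datum by (auto simp: gwa_datum_def ring_iso_def)

definition theta' where "theta' i = inv_into R (\<theta> i)"

lemma theta_R: "\<lbrakk>i \<in> I; r \<in> R\<rbrakk> \<Longrightarrow> \<theta> i r \<in> R" "\<lbrakk>i \<in> I; r \<in> R\<rbrakk> \<Longrightarrow> theta' i r \<in> R"
  and theta_theta': "\<lbrakk>i \<in> I; r \<in> R\<rbrakk> \<Longrightarrow> \<theta> i (theta' i r) = r"
  using theta_bij[of i] bij_betw_inv_into[OF theta_bij[of i]] bij_betw_inv_into_right[OF theta_bij[of i]]
  by (auto simp: theta'_def dest: bij_betwE)

lemma gx_coef':
  assumes i: "i \<in> I" "r \<in> R"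
  shows "inverse (gx i) * r = theta' i r * inverse (gx i)"
proof -
  have "gx i * theta' i r = r * gx i"
    using gx_coef[OF i(1) theta_R(2)[OF i]] theta_theta'[OF i] by simp
  then have "inverse (gx i) * (gx i * theta' i r) * inverse (gx i) = inverse (gx i) * (r * gx i) * inverse (gx i)"
    by simp
  moreover have "inverse (gx i) * (gx i * theta' i r) * inverse (gx i) = theta' i r * inverse (gx i)"
    using gx_nonzero[OF i(1)] by (simp add: mult.assoc[symmetric])
  moreover have "inverse (gx i) * (r * gx i) * inverse (gx i) = inverse (gx i) * r"
    using gx_nonzero[OF i(1)] by (simp add: mult.assoc)
  ultimately show ?thesis by simp
qed

lemma gx_normalizer:
  assumes i: "i \<in> I"
  shows "gx i \<in> normalizer R"
proof -
  have "gx i * r * inverse (gx i) = \<theta> i r" "inverse (gx i) * r * gx i = theta' i r" if r: "r \<in> R" for r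
    unfolding gx_coef[OF i r] gx_coef'[OF i r] using gx_nonzero[OF i] by (simp_all add: mult.assoc)
  then show ?thesis using gx_nonzero[OF i] theta_R[OF i] by (simp add: normalizer_def)
qed

lemma gy_coef:
  assumes i: "i \<in> I" "r \<in> R"
  shows "gy i * r = theta' i r * gy i"
proof -
  have "gy i * r = inverse (gx i) * r * \<xi> i"
    using R_comm[OF xi_R[OF i(1)] i(2)] by (simp add: gy_eq[OF i(1)] mult.assoc)
  also have "\<dots> = theta' i r * gy i"
    unfolding gx_coef'[OF i] gy_eq[OF i(1)] by (rule mult.assoc)
  finally show ?thesis .
qed

lemma gx_gy: "i \<in> I \<Longrightarrow> gx i * gy i = \<xi> i"
  by (simp add: gy_eq gx_nonzero mult.assoc[symmetric])

lemma gy_gx: "i \<in> I \<Longrightarrow> gy i * gx i = theta' i (\<xi> i)"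
  using gx_coef'[of i "\<xi> i"] xi_R[of i] gx_nonzero[of i] by (simp add: gy_eq mult.assoc)

lemma theta'_xi: "\<lbrakk>i \<in> I; j \<in> I; i \<noteq> j\<rbrakk> \<Longrightarrow> theta' i (\<xi> j) = \<xi> j"
  using bij_betw_inv_into_left[OF theta_bij[of i] xi_R[of j]] theta_xi[of i j] by (simp add: theta'_def)

lemma gx_gy_comm:
  assumes ij: "i \<in> I" "j \<in> I" "i \<noteq> j"
  shows "gx i * gy j = gy j * gx i"
proof -
  have "gx j \<in> centralizer {gx i}" "\<xi> j \<in> centralizer {gx i}"
    using gx_comm[OF ij(1,2)] gx_coef[OF ij(1) xi_R[OF ij(2)]] theta_xi[OF ij] by (auto simp: centralizer_def)
  then have "gy j \<in> centralizer {gx i}"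
    unfolding gy_eq[OF ij(2)] by (intro centralizer_inverse subringD(6)[OF centralizer_subring])
  then show ?thesis by (simp add: centralizer_def)
qed

lemma gy_gy_comm:
  assumes ij: "i \<in> I" "j \<in> I" "i \<noteq> j"
  shows "gy i * gy j = gy j * gy i"
proof -
  have "gx i \<in> centralizer {gy j}" "\<xi> i \<in> centralizer {gy j}"
    using gx_gy_comm[OF ij] gy_coef[OF ij(2) xi_R[OF ij(1)]] theta'_xi[OF ij(2,1)] ij(3)
    by (auto simp: centralizer_def)
  then have "gy i \<in> centralizer {gy j}"
    unfolding gy_eq[OF ij(1)] by (intro centralizer_inverse subringD(6)[OF centralizer_subring])
  then show ?thesis by (simp add: centralizer_def)
qed

definition letter_value :: "'d gwa_letter \<Rightarrow> 'd"
  where "letter_value l = (case l of Coef r \<Rightarrow> r | GX i \<Rightarrow> gx i | GY i \<Rightarrow> gy i)"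

definition word_value :: "'d gwa_letter list \<Rightarrow> 'd"
  where "word_value w = prod_list (map letter_value w)"

lemma word_value_simps [simp]:
  "word_value [] = 1" "word_value (l # w) = letter_value l * word_value w"
  "word_value (u @ v) = word_value u * word_value v"
  "letter_value (Coef r) = r" "letter_value (GX i) = gx i" "letter_value (GY i) = gy i"
  by (simp_all add: word_value_def letter_value_def)

abbreviation "letters \<equiv> gwa_letters R I"
abbreviation "rels \<equiv> gwa_relations R I \<theta> \<xi>"
abbreviation "free_ring \<equiv> monoid_ring (word_monoid letters) :: ('d gwa_letter list \<Rightarrow>\<^sub>0 int) ring"

definition rel_ideal :: "('d gwa_letter list \<Rightarrow>\<^sub>0 int) set"
  where "rel_ideal = Idl\<^bsub>free_ring\<^esub> rels"

abbreviation ev :: "('d gwa_letter list \<Rightarrow>\<^sub>0 int) \<Rightarrow> 'd"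
  where "ev \<equiv> eval_map of_int word_value"

lemma letters_iff [simp]:
  "Coef r \<in> letters \<longleftrightarrow> r \<in> R" "GX i \<in> letters \<longleftrightarrow> i \<in> I" "GY i \<in> letters \<longleftrightarrow> i \<in> I"
  by (auto simp: gwa_letters_def)

lemma rels_carrier: "rels \<subseteq> carrier free_ring"
proof
  fix p assume "p \<in> rels"
  then show "p \<in> carrier free_ring"
    unfolding gwa_relations_def monoid_ring_simps word_monoid_simps theta'_def[symmetric]
    by (elim UnE) (auto simp: theta_R xi_R dest!: subsetD[OF keys_diff] intro: subringD[OF R_sub])
qed

lemma ev_rels: "r \<in> rels \<Longrightarrow> ev r = 0"
  unfolding gwa_relations_def theta'_def[symmetric]
  by (elim UnE; clarsimp simp: gx_coef gy_coef gx_gy gy_gx)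
    (simp_all add: gx_comm gx_gy_comm gy_gy_comm)

lemma ev_hom: "ring_hom_ring free_ring DD ev"
proof (intro ring_hom_ringI2 monoid_ring_ring monoid_word_monoid ring_DD ring_hom_memI)
  show "ev (p \<otimes>\<^bsub>free_ring\<^esub> q) = ev p \<otimes>\<^bsub>DD\<^esub> ev q" if "p \<in> carrier free_ring" "q \<in> carrier free_ring" for p q
    using that by (subst int_scalars.eval_map_mult) simp_all
qed simp_all

lemma rel_ideal_ideal: "ideal rel_ideal free_ring"
  unfolding rel_ideal_def
  by (rule ring.genideal_ideal[OF monoid_ring_ring[OF monoid_word_monoid] rels_carrier])

lemmas ideal_props = monoid_ring_ideal[OF monoid_word_monoid rel_ideal_ideal, simplified]

lemma rels_in_ideal: "r \<in> rels \<Longrightarrow> r \<in> rel_ideal"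
  using ring.genideal_self[OF monoid_ring_ring[OF monoid_word_monoid] rels_carrier]
  by (auto simp: rel_ideal_def)

text \<open>
  All relations except additivity of \<open>Coef\<close> equate two words, so the reduction to normal form takes
  place in the word monoid.
\<close>

definition word_eq (infix \<open>\<rightleftharpoons>\<close> 50)
  where "u \<rightleftharpoons> v \<longleftrightarrow> u \<in> lists letters \<and> v \<in> lists letters \<and> word u - word v \<in> rel_ideal"

lemma word_eq_refl: "u \<in> lists letters \<Longrightarrow> u \<rightleftharpoons> u"
  by (simp add: word_eq_def ideal_props(1))

lemma word_eq_sym: "u \<rightleftharpoons> v \<Longrightarrow> v \<rightleftharpoons> u"
  using ideal_props(3)[of "word u - word v"] by (simp add: word_eq_def)

lemma word_eq_trans [trans]: "u \<rightleftharpoons> v \<Longrightarrow> v \<rightleftharpoons> w \<Longrightarrow> u \<rightleftharpoons> w"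
  using ideal_props(2)[of "word u - word v" "word v - word w"] by (simp add: word_eq_def)

lemma word_eq_ctxt:
  assumes "u \<rightleftharpoons> v" "a \<in> lists letters" "b \<in> lists letters"
  shows "a @ u @ b \<rightleftharpoons> a @ v @ b"
proof -
  have "word a \<otimes>\<^bsub>free_ring\<^esub> (word u - word v) \<otimes>\<^bsub>free_ring\<^esub> word b \<in> rel_ideal"
    using assms by (intro ideal_props(5,6)) (auto simp: word_eq_def)
  then show ?thesis using assms by (simp add: word_eq_def monoid_ring_mult_diff)
qed

lemma word_eq_append: "u \<rightleftharpoons> v \<Longrightarrow> b \<in> lists letters \<Longrightarrow> u @ b \<rightleftharpoons> v @ b"
  using word_eq_ctxt[of u v "[]" b] by simp

lemma word_eq_prepend: "u \<rightleftharpoons> v \<Longrightarrow> a \<in> lists letters \<Longrightarrow> a @ u \<rightleftharpoons> a @ v"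
  using word_eq_ctxt[of u v a "[]"] by simp

lemma word_eq_Cons: "u \<rightleftharpoons> v \<Longrightarrow> l \<in> letters \<Longrightarrow> l # u \<rightleftharpoons> l # v"
  using word_eq_prepend[of u v "[l]"] by simp

lemma basic_word_eq:
  "\<lbrakk>r \<in> R; s \<in> R\<rbrakk> \<Longrightarrow> [Coef r, Coef s] \<rightleftharpoons> [Coef (r * s)]"
  "[] \<rightleftharpoons> [Coef 1]"
  "\<lbrakk>i \<in> I; r \<in> R\<rbrakk> \<Longrightarrow> [GX i, Coef r] \<rightleftharpoons> [Coef (\<theta> i r), GX i]"
  "\<lbrakk>i \<in> I; r \<in> R\<rbrakk> \<Longrightarrow> [GY i, Coef r] \<rightleftharpoons> [Coef (theta' i r), GY i]"
  "i \<in> I \<Longrightarrow> [GX i, GY i] \<rightleftharpoons> [Coef (\<xi> i)]"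
  "i \<in> I \<Longrightarrow> [GY i, GX i] \<rightleftharpoons> [Coef (theta' i (\<xi> i))]"
  "\<lbrakk>i \<in> I; j \<in> I; i \<noteq> j\<rbrakk> \<Longrightarrow> [GX i, GY j] \<rightleftharpoons> [GY j, GX i]"
  "\<lbrakk>i \<in> I; j \<in> I; i \<noteq> j\<rbrakk> \<Longrightarrow> [GX i, GX j] \<rightleftharpoons> [GX j, GX i]"
  "\<lbrakk>i \<in> I; j \<in> I; i \<noteq> j\<rbrakk> \<Longrightarrow> [GY i, GY j] \<rightleftharpoons> [GY j, GY i]"
proof -
  have *: "u \<rightleftharpoons> v" if "word u - word v \<in> rels" "u \<in> lists letters" "v \<in> lists letters" for u v
    using that rels_in_ideal by (simp add: word_eq_def)
  note m = subringD(1,6)[OF R_sub] theta_R xi_R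
  show "\<lbrakk>r \<in> R; s \<in> R\<rbrakk> \<Longrightarrow> [Coef r, Coef s] \<rightleftharpoons> [Coef (r * s)]"
    by (rule word_eq_sym, rule *, unfold gwa_relations_def theta'_def[symmetric]) (blast, simp_all add: m)
  show "[] \<rightleftharpoons> [Coef 1]"
    by (rule word_eq_sym, rule *, unfold gwa_relations_def theta'_def[symmetric]) (blast, simp_all add: m)
  show "\<lbrakk>i \<in> I; r \<in> R\<rbrakk> \<Longrightarrow> [GX i, Coef r] \<rightleftharpoons> [Coef (\<theta> i r), GX i]"
    by (rule *, unfold gwa_relations_def theta'_def[symmetric]) (blast, simp_all add: m)
  show "\<lbrakk>i \<in> I; r \<in> R\<rbrakk> \<Longrightarrow> [GY i, Coef r] \<rightleftharpoons> [Coef (theta' i r), GY i]"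
    by (rule *, unfold gwa_relations_def theta'_def[symmetric]) (blast, simp_all add: m)
  show "i \<in> I \<Longrightarrow> [GX i, GY i] \<rightleftharpoons> [Coef (\<xi> i)]"
    by (rule *, unfold gwa_relations_def theta'_def[symmetric]) (blast, simp_all add: m)
  show "i \<in> I \<Longrightarrow> [GY i, GX i] \<rightleftharpoons> [Coef (theta' i (\<xi> i))]"
    by (rule *, unfold gwa_relations_def theta'_def[symmetric]) (blast, simp_all add: m)
  show "\<lbrakk>i \<in> I; j \<in> I; i \<noteq> j\<rbrakk> \<Longrightarrow> [GX i, GY j] \<rightleftharpoons> [GY j, GX i]"
    by (rule *, unfold gwa_relations_def theta'_def[symmetric]) (blast, simp_all add: m)
  show "\<lbrakk>i \<in> I; j \<in> I; i \<noteq> j\<rbrakk> \<Longrightarrow> [GX i, GX j] \<rightleftharpoons> [GX j, GX i]"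
    by (rule *, unfold gwa_relations_def theta'_def[symmetric]) (blast, simp_all add: m)
  show "\<lbrakk>i \<in> I; j \<in> I; i \<noteq> j\<rbrakk> \<Longrightarrow> [GY i, GY j] \<rightleftharpoons> [GY j, GY i]"
    by (rule *, unfold gwa_relations_def theta'_def[symmetric]) (blast, simp_all add: m)
qed

abbreviation "xy i \<equiv> {GX i, GY i}"

lemma move_coef:
  assumes "set w \<subseteq> xy j" "j \<in> I" "r \<in> R"
  shows "\<exists>r'\<in>R. w @ [Coef r] \<rightleftharpoons> Coef r' # w"
  using assms(1)
proof (induction w)
  case Nil
  show ?case using assms(3) word_eq_refl[of "[Coef r]"] by auto
next
  case (Cons l w)
  then obtain r' where r': "r' \<in> R" "w @ [Coef r] \<rightleftharpoons> Coef r' # w" by auto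
  have l: "l \<in> letters" "l \<in> xy j" and w: "w \<in> lists letters" using Cons.prems assms(2) by (auto simp: subset_iff)
  have "\<exists>s\<in>R. [l, Coef r'] \<rightleftharpoons> [Coef s, l]"
    using l(2) basic_word_eq(3,4)[OF assms(2) r'(1)] theta_R[OF assms(2) r'(1)] by auto
  then obtain s where s: "s \<in> R" "[l, Coef r'] \<rightleftharpoons> [Coef s, l]" by auto
  have "l # w @ [Coef r] \<rightleftharpoons> [l, Coef r'] @ w" using word_eq_Cons[OF r'(2) l(1)] by simp
  also have "[l, Coef r'] @ w \<rightleftharpoons> [Coef s, l] @ w" by (rule word_eq_append[OF s(2) w])
  finally show ?case using s(1) by auto
qed

lemma commute_letter:
  assumes "set w \<subseteq> xy j" "l \<in> xy i" "i \<in> I" "j \<in> I" "i \<noteq> j"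
  shows "l # w \<rightleftharpoons> w @ [l]"
  using assms(1)
proof (induction w)
  case Nil
  show ?case using assms by (auto intro: word_eq_refl)
next
  case (Cons m w)
  have m: "m \<in> letters" "m \<in> xy j" and w: "w \<in> lists letters" using Cons.prems assms by (auto simp: subset_iff)
  have "[l, m] \<rightleftharpoons> [m, l]"
    using m(2) assms(2) basic_word_eq(7-9)[OF assms(3-5)] basic_word_eq(7)[OF assms(4,3)] assms(5)
    by (auto intro: word_eq_sym)
  from word_eq_append[OF this w] have "l # m # w \<rightleftharpoons> m # l # w" by simp
  also have "m # l # w \<rightleftharpoons> m # w @ [l]" using word_eq_Cons[OF _ m(1)] Cons by simp
  finally show ?case by simp
qed

text \<open>
  The power of a generator \<open>x i\<close> with an integer exponent, where \<open>y i\<close> takes the role of the inverse.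
\<close>

definition signed_power :: "nat \<Rightarrow> int \<Rightarrow> 'd gwa_letter list"
  where "signed_power i a = replicate (nat a) (GX i) @ replicate (nat (- a)) (GY i)"

definition standard_word :: "(nat \<Rightarrow> int) \<Rightarrow> nat list \<Rightarrow> 'd gwa_letter list"
  where "standard_word \<alpha> L = concat (map (\<lambda>i. signed_power i (\<alpha> i)) L)"

lemma standard_word_simps [simp]:
  "standard_word \<alpha> [] = []" "standard_word \<alpha> (i # L) = signed_power i (\<alpha> i) @ standard_word \<alpha> L"
  by (simp_all add: standard_word_def)

lemma signed_power_set: "set (signed_power i a) \<subseteq> xy i"
  by (auto simp: signed_power_def)

lemma signed_power_letters: "i \<in> I \<Longrightarrow> signed_power i a \<in> lists letters"
  by (auto simp: signed_power_def)

lemma standard_word_letters: "set L \<subseteq> I \<Longrightarrow> standard_word \<alpha> L \<in> lists letters"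
  by (induction L) (auto simp: signed_power_letters simp del: in_lists_conv_set lists_eq_set)

lemma standard_word_cong: "(\<And>i. i \<in> set L \<Longrightarrow> \<alpha> i = \<beta> i) \<Longrightarrow> standard_word \<alpha> L = standard_word \<beta> L"
  by (induction L) auto

text \<open>
  A further letter of the same direction either lengthens the power, or it meets its partner and both cancel
  to a coefficient.
\<close>

lemma letter_signed_power:
  assumes "i \<in> I" "l \<in> xy i"
  shows "\<exists>r\<in>R. \<exists>b. l # signed_power i a \<rightleftharpoons> Coef r # signed_power i b"
proof -
  have one: "w \<rightleftharpoons> Coef 1 # w" if "w \<in> lists letters" for w
    using word_eq_append[OF basic_word_eq(2) that] by simp
  have canc: "\<exists>r\<in>R. l # m # w \<rightleftharpoons> Coef r # w" if "w \<in> lists letters" "(l = GX i \<and> m = GY i) \<or> (l = GY i \<and> m = GX i)" for m w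
    using that word_eq_append[OF basic_word_eq(5)[OF assms(1)] that(1)]
      word_eq_append[OF basic_word_eq(6)[OF assms(1)] that(1)] xi_R[OF assms(1)] theta_R(2)[OF assms(1) xi_R[OF assms(1)]]
    by auto
  note sl = signed_power_letters[OF assms(1)]
  consider "l = GX i" "a \<ge> 0" | "l = GX i" "a < 0" | "l = GY i" "a > 0" | "l = GY i" "a \<le> 0"
    using assms(2) by fastforce
  then show ?thesis
  proof cases
    case 1
    then have "l # signed_power i a = signed_power i (a + 1)"
      by (simp add: signed_power_def nat_add_distrib)
    then show ?thesis using one[OF sl] subringD(1)[OF R_sub] by metis
  next
    case 2
    then have "nat (- a) = Suc (nat (- (a + 1)))" "nat a = 0" "nat (a + 1) = 0" by auto
    then have "l # signed_power i a = l # GY i # signed_power i (a + 1)"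
      by (simp add: signed_power_def)
    then show ?thesis using canc[OF sl] 2 by metis
  next
    case 3
    then have "nat a = Suc (nat (a - 1))" "nat (- a) = 0" "nat (- (a - 1)) = 0" by auto
    then have "l # signed_power i a = l # GX i # signed_power i (a - 1)"
      by (simp add: signed_power_def)
    then show ?thesis using canc[OF sl] 3 by metis
  next
    case 4
    then have "nat (- (a - 1)) = Suc (nat (- a))" "nat a = 0" "nat (a - 1) = 0" by auto
    then have "l # signed_power i a = signed_power i (a - 1)"
      using 4 by (simp add: signed_power_def)
    then show ?thesis using one[OF sl] subringD(1)[OF R_sub] by metis
  qed
qed

text \<open>
  The letter commutes with the blocks before its own; the coefficient that arises there moves back to the front through the
  automorphisms.
\<close>

lemma letter_standard_word:
  assumes "distinct L" "set L \<subseteq> I" "i \<in> set L" "l \<in> xy i"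
  shows "\<exists>r\<in>R. \<exists>\<beta>. l # standard_word \<alpha> L \<rightleftharpoons> Coef r # standard_word \<beta> L"
  using assms(1-3)
proof (induction L)
  case (Cons j L)
  have j: "j \<in> I" and L: "set L \<subseteq> I" "distinct L" "j \<notin> set L" and i: "i \<in> I" using Cons.prems by auto
  have l: "l \<in> letters" using i assms(4) by auto
  show ?case
  proof (cases "i = j")
    case True
    obtain r b where r: "r \<in> R" "l # signed_power i (\<alpha> i) \<rightleftharpoons> Coef r # signed_power i b"
      using letter_signed_power[OF i assms(4)] by blast
    have "standard_word (\<alpha>(i := b)) L = standard_word \<alpha> L"
      by (rule standard_word_cong) (use L True in auto)
    with word_eq_append[OF r(2) standard_word_letters[OF L(1), of \<alpha>]] r(1) True
    have "l # standard_word \<alpha> (j # L) \<rightleftharpoons> Coef r # standard_word (\<alpha>(i := b)) (j # L)"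
      by (simp del: fun_upd_apply add: fun_upd_same)
    then show ?thesis using r(1) by blast
  next
    case False
    then obtain r \<beta> where r: "r \<in> R" "l # standard_word \<alpha> L \<rightleftharpoons> Coef r # standard_word \<beta> L"
      using Cons by auto
    let ?s = "signed_power j (\<alpha> j)"
    obtain r' where r': "r' \<in> R" "?s @ [Coef r] \<rightleftharpoons> Coef r' # ?s"
      using move_coef[OF signed_power_set j r(1)] by blast
    have "l # ?s @ standard_word \<alpha> L \<rightleftharpoons> ?s @ l # standard_word \<alpha> L"
      using word_eq_append[OF commute_letter[OF signed_power_set assms(4) i j False] standard_word_letters[OF L(1)]]
      by simp
    also have "?s @ l # standard_word \<alpha> L \<rightleftharpoons> ?s @ Coef r # standard_word \<beta> L"
      by (rule word_eq_prepend[OF r(2) signed_power_letters[OF j]])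
    also have "?s @ Coef r # standard_word \<beta> L \<rightleftharpoons> Coef r' # ?s @ standard_word \<beta> L"
      using word_eq_append[OF r'(2) standard_word_letters[OF L(1)]] by simp
    also have "standard_word \<beta> L = standard_word (\<beta>(j := \<alpha> j)) L"
      by (rule standard_word_cong) (use L in auto)
    finally have "l # standard_word \<alpha> (j # L) \<rightleftharpoons> Coef r' # standard_word (\<beta>(j := \<alpha> j)) (j # L)"
      by (simp del: fun_upd_apply add: fun_upd_same)
    then show ?thesis using r'(1) by blast
  qed
qed simp

definition "dirs_list = sorted_list_of_set I"

lemma dirs_list: "set dirs_list = I" "distinct dirs_list"
  using fin by (auto simp: dirs_list_def)

lemma word_standard:
  assumes "w \<in> lists letters"
  shows "\<exists>r\<in>R. \<exists>\<alpha>. w \<rightleftharpoons> Coef r # standard_word \<alpha> dirs_list"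
  using assms
proof (induction w)
  case Nil
  have "standard_word (\<lambda>_. 0) L = []" for L by (induction L) (auto simp: signed_power_def)
  then show ?case using basic_word_eq(2) subringD(1)[OF R_sub] by metis
next
  case (Cons l w)
  then obtain r \<alpha> where r: "r \<in> R" "w \<rightleftharpoons> Coef r # standard_word \<alpha> dirs_list" by auto
  let ?z = "standard_word \<alpha> dirs_list"
  have z: "?z \<in> lists letters" using standard_word_letters dirs_list by simp
  have lw: "l # w \<rightleftharpoons> l # Coef r # ?z" by (rule word_eq_Cons[OF r(2) Cons(1)])
  have xy: ?case if sw: "[l, Coef r] \<rightleftharpoons> [Coef s, l]" "s \<in> R" "l \<in> xy i" "i \<in> I" for s i
  proof -
    obtain r' \<beta> where r': "r' \<in> R" "l # ?z \<rightleftharpoons> Coef r' # standard_word \<beta> dirs_list"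
      using letter_standard_word[OF dirs_list(2) _ _ sw(3)] sw(4) dirs_list(1) by blast
    note lw
    also have "l # Coef r # ?z \<rightleftharpoons> Coef s # l # ?z" using word_eq_append[OF that(1) z] by simp
    also have "Coef s # l # ?z \<rightleftharpoons> Coef s # Coef r' # standard_word \<beta> dirs_list"
      by (rule word_eq_Cons[OF r'(2)]) (simp add: that)
    also have "Coef s # Coef r' # standard_word \<beta> dirs_list \<rightleftharpoons> Coef (s * r') # standard_word \<beta> dirs_list"
      using word_eq_append[OF basic_word_eq(1)[OF that(2) r'(1)] standard_word_letters] dirs_list by simp
    finally show ?thesis using that(2) r'(1) subringD(6)[OF R_sub] by blast
  qed
  show ?case
  proof (cases l)
    case (Coef s)
    then have s: "s \<in> R" using Cons(1) by simp
    note lw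
    also have "l # Coef r # ?z \<rightleftharpoons> Coef (s * r) # ?z"
      using word_eq_append[OF basic_word_eq(1)[OF s r(1)] z] Coef by simp
    finally show ?thesis using s r(1) subringD(6)[OF R_sub] by blast
  next
    case (GX i)
    then show ?thesis using xy[of "\<theta> i r" i] basic_word_eq(3) theta_R r(1) Cons(1) by auto
  next
    case (GY i)
    then show ?thesis using xy[of "theta' i r" i] basic_word_eq(4) theta_R r(1) Cons(1) by auto
  qed
qed

abbreviation standard :: "'d \<Rightarrow> (nat \<Rightarrow>\<^sub>0 int) \<Rightarrow> 'd gwa_letter list"
  where "standard r \<alpha> \<equiv> Coef r # standard_word (lookup \<alpha>) dirs_list"

lemma word_standard_poly:
  assumes "w \<in> lists letters"
  shows "\<exists>r\<in>R. \<exists>\<alpha>. keys \<alpha> \<subseteq> I \<and> w \<rightleftharpoons> standard r \<alpha>"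
proof -
  obtain r \<alpha> where r: "r \<in> R" "w \<rightleftharpoons> Coef r # standard_word \<alpha> dirs_list"
    using word_standard[OF assms] by blast
  define \<beta> where "\<beta> = (\<Sum>i\<in>I. single i (\<alpha> i))"
  have l: "lookup \<beta> i = (if i \<in> I then \<alpha> i else 0)" for i
    unfolding \<beta>_def lookup_sum using fin by (simp add: lookup_single when_def)
  have "standard_word (lookup \<beta>) dirs_list = standard_word \<alpha> dirs_list"
    by (rule standard_word_cong) (simp add: l dirs_list)
  moreover have "keys \<beta> \<subseteq> I"
    by (auto simp: in_keys_iff l split: if_splits)
  ultimately show ?thesis using r by metis
qed

lemma standard_add:
  assumes "r \<in> R" "s \<in> R"
  shows "word (standard (r + s) \<alpha>) - word (standard r \<alpha>) - word (standard s \<alpha>) \<in> rel_ideal"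
proof -
  let ?z = "standard_word (lookup \<alpha>) dirs_list"
  have "word [Coef (r + s)] - word [Coef r] - word [Coef s] \<in> rels"
    using assms unfolding gwa_relations_def by blast
  from ideal_props(6)[OF rels_in_ideal[OF this], of "word ?z"]
  show ?thesis using standard_word_letters[of dirs_list] dirs_list by (simp add: monoid_ring_mult_diff)
qed

lemma standard_zero: "word (standard 0 \<alpha>) \<in> rel_ideal"
  using standard_add[of 0 0 \<alpha>] ideal_props(3)[of "- word (standard 0 \<alpha>)"] subringD(2)[OF R_sub] by simp

definition normal_form :: "((nat \<Rightarrow>\<^sub>0 int) \<Rightarrow> 'd) \<Rightarrow> (nat \<Rightarrow>\<^sub>0 int) set \<Rightarrow> ('d gwa_letter list \<Rightarrow>\<^sub>0 int)"
  where "normal_form f A = (\<Sum>\<alpha>\<in>A. word (standard (f \<alpha>) \<alpha>))"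

lemma normal_form_extend:
  assumes "finite B" "A \<subseteq> B" "\<And>\<alpha>. \<alpha> \<notin> A \<Longrightarrow> f \<alpha> = 0"
  shows "normal_form f B - normal_form f A \<in> rel_ideal"
proof -
  have "normal_form f B - normal_form f A = (\<Sum>\<alpha>\<in>B - A. word (standard (f \<alpha>) \<alpha>))"
    unfolding normal_form_def by (rule sum_diff[OF assms(1,2), symmetric])
  also have "\<dots> = (\<Sum>\<alpha>\<in>B - A. word (standard 0 \<alpha>))"
    by (rule sum.cong) (auto simp: assms(3))
  finally show ?thesis by (simp only:) (intro ideal_props(8) standard_zero)
qed

text \<open>
  Additivity of \<open>Coef\<close> absorbs integer multiples of a word into its coefficient.
\<close>

lemma multiple_standard:
  assumes "r \<in> R"
  shows "single (standard r \<alpha>) k - word (standard (of_int k * r) \<alpha>) \<in> rel_ideal"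
proof -
  have kr: "of_int k * r \<in> R" for k using subring_of_int[OF R_sub] subringD(6)[OF R_sub] assms by blast
  have *: "single (standard r \<alpha>) (int m) - word (standard (of_int (int m) * r) \<alpha>) \<in> rel_ideal" for m
  proof (induction m)
    case 0
    then show ?case using ideal_props(3)[OF standard_zero] by simp
  next
    case (Suc m)
    have e: "of_int (int (Suc m)) * r = of_int (int m) * r + r" by (simp add: distrib_right add.commute)
    have "single (standard r \<alpha>) (int (Suc m)) - word (standard (of_int (int (Suc m)) * r) \<alpha>)
      = (single (standard r \<alpha>) (int m) - word (standard (of_int (int m) * r) \<alpha>))
       - (word (standard (of_int (int m) * r + r) \<alpha>) - word (standard (of_int (int m) * r) \<alpha>) - word (standard r \<alpha>))"
      unfolding e by (simp add: single_add algebra_simps)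
    then show ?case using ideal_props(4)[OF Suc standard_add[OF kr assms]] by (simp only:)
  qed
  show ?thesis
  proof (cases k rule: int_cases2)
    case (nonneg m)
    then show ?thesis using *[of m] by simp
  next
    case (nonpos m)
    have z: "of_int (int m) * r + - (of_int (int m) * r) = 0" by simp
    have "single (standard r \<alpha>) k - word (standard (of_int k * r) \<alpha>)
      = - (single (standard r \<alpha>) (int m) - word (standard (of_int (int m) * r) \<alpha>))
       + (word (standard (of_int (int m) * r + - (of_int (int m) * r)) \<alpha>)
          - word (standard (of_int (int m) * r) \<alpha>) - word (standard (- (of_int (int m) * r)) \<alpha>))
       - word (standard 0 \<alpha>)"
      unfolding z nonpos by (simp add: single_uminus algebra_simps)
    then show ?thesis
      using ideal_props(4)[OF ideal_props(2)[OF ideal_props(3)[OF *[of m]]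
          standard_add[OF kr[of "int m"] subringD(3)[OF R_sub kr[of "int m"]]]] standard_zero]
      by (simp only:)
  qed
qed

text \<open>
  Word by word, the reduction to standard form extends to all elements; coefficients of equal standard words add up.
\<close>

lemma normal_form_exists:
  assumes "keys p \<subseteq> lists letters"
  shows "\<exists>A f. finite A \<and> (\<forall>\<alpha>\<in>A. keys \<alpha> \<subseteq> I) \<and> (\<forall>\<alpha>. f \<alpha> \<in> R) \<and> (\<forall>\<alpha>. \<alpha> \<notin> A \<longrightarrow> f \<alpha> = 0) \<and>
     p - normal_form f A \<in> rel_ideal"
  using assms
proof (induction p rule: poly_mapping_support_induct)
  case zero
  show ?case
    by (rule exI[of _ "{}"], rule exI[of _ "\<lambda>_. 0"]) (simp add: normal_form_def ideal_props(1) subringD(2)[OF R_sub])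
next
  case (single w k)
  obtain r \<alpha> where r: "r \<in> R" "keys \<alpha> \<subseteq> I" "w \<rightleftharpoons> standard r \<alpha>"
    using word_standard_poly[OF single] by blast
  have kr: "of_int k * r \<in> R" using subring_of_int[OF R_sub] subringD(6)[OF R_sub] r by blast
  have "single [] k \<otimes>\<^bsub>free_ring\<^esub> (word w - word (standard r \<alpha>)) \<in> rel_ideal"
    using r(3) by (intro ideal_props(5)) (auto simp: word_eq_def)
  then have "single w k - single (standard r \<alpha>) k \<in> rel_ideal"
    by (simp add: monoid_ring_mult_diff)
  from ideal_props(2)[OF this multiple_standard[OF r(1), of \<alpha> k]]
  have "single w k - word (standard (of_int k * r) \<alpha>) \<in> rel_ideal" by simp
  then show ?case
    by (intro exI[of _ "{\<alpha>}"] exI[of _ "\<lambda>\<beta>. if \<beta> = \<alpha> then of_int k * r else 0"])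
      (use r kr subringD(2)[OF R_sub] in \<open>auto simp: normal_form_def\<close>)
next
  case (add p q)
  obtain A f where f: "finite A" "\<And>\<alpha>. \<alpha> \<in> A \<Longrightarrow> keys \<alpha> \<subseteq> I" "\<And>\<alpha>. f \<alpha> \<in> R" "\<And>\<alpha>. \<alpha> \<notin> A \<Longrightarrow> f \<alpha> = 0"
     "p - normal_form f A \<in> rel_ideal" using add(3) by metis
  obtain B g where g: "finite B" "\<And>\<alpha>. \<alpha> \<in> B \<Longrightarrow> keys \<alpha> \<subseteq> I" "\<And>\<alpha>. g \<alpha> \<in> R" "\<And>\<alpha>. \<alpha> \<notin> B \<Longrightarrow> g \<alpha> = 0"
     "q - normal_form g B \<in> rel_ideal" using add(4) by metis
  let ?S = "\<lambda>f. normal_form f (A \<union> B)"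
  have 1: "?S f - normal_form f A \<in> rel_ideal" "?S g - normal_form g B \<in> rel_ideal"
    using f g by (auto intro!: normal_form_extend)
  have 2: "?S (\<lambda>\<alpha>. f \<alpha> + g \<alpha>) - ?S f - ?S g \<in> rel_ideal"
    unfolding normal_form_def sum_subtractf[symmetric]
    using f g by (intro ideal_props(8) standard_add) auto
  have "p + q - ?S (\<lambda>\<alpha>. f \<alpha> + g \<alpha>) = (p - normal_form f A) + (q - normal_form g B)
      - ((?S f - normal_form f A) + (?S g - normal_form g B) + (?S (\<lambda>\<alpha>. f \<alpha> + g \<alpha>) - ?S f - ?S g))"
    by simp
  also have "\<dots> \<in> rel_ideal"
    by (intro ideal_props(2,4) f(5) g(5) 1 2)
  finally have nf: "p + q - ?S (\<lambda>\<alpha>. f \<alpha> + g \<alpha>) \<in> rel_ideal" .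
  show ?case
  proof (intro exI[of _ "A \<union> B"] exI[of _ "\<lambda>\<alpha>. f \<alpha> + g \<alpha>"] conjI ballI allI impI nf)
    show "keys \<alpha> \<subseteq> I" if "\<alpha> \<in> A \<union> B" for \<alpha> using that f(2) g(2) by blast
    show "f \<alpha> + g \<alpha> \<in> R" for \<alpha> by (intro subringD(4)[OF R_sub] f(3) g(3))
  qed (use f g in auto)
qed

text \<open>
  Moving the coefficients of \<open>gy i = theta' i (\<xi> i) * (gx i)\<^sup>-\<^sup>1\<close> to the left turns a standard word into a Laurent monomial.
\<close>

lemma value_standard_word:
  assumes "keys \<alpha> \<subseteq> I"
  shows "left_multiple R (word_value (standard_word (lookup \<alpha>) dirs_list)) (laurent_monomial gx \<alpha>)"
proof -
  have p: "left_multiple R (word_value (signed_power i a)) (gx i powi a)" if i: "i \<in> I" for i a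
  proof -
    have rep: "word_value (replicate m l) = letter_value l ^ m" for m l
      by (induction m) auto
    have 1: "left_multiple R (gx i) (gx i)"
      using gx_normalizer[OF i] subringD(1)[OF R_sub] by (auto simp: left_multiple_def intro!: bexI[of _ 1])
    have "theta' i (\<xi> i) \<noteq> 0"
      using gy_gx[OF i] gx_nonzero[OF i] xi_nonzero[OF i] gx_gy[OF i] by force
    then have 2: "left_multiple R (gy i) (inverse (gx i))"
      using normalizer_inverse[OF gx_normalizer[OF i]] theta_R(2)[OF i xi_R[OF i]]
        gx_coef'[OF i xi_R[OF i]] gy_eq[OF i]
      by (auto simp: left_multiple_def)
    show ?thesis
      using left_multiple_power[OF R_sub 1, of "nat a"] left_multiple_power[OF R_sub 2, of "nat (- a)"]
      by (simp add: signed_power_def rep power_int_def)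
  qed
  have "left_multiple R (word_value (standard_word (lookup \<alpha>) L))
      (prod_list (map (\<lambda>j. gx j powi lookup \<alpha> j) L))" if "set L \<subseteq> I" for L
    using that by (induction L) (auto intro: left_multiple_one[OF R_sub] left_multiple_mult[OF R_sub] p)
  from this[of dirs_list] show ?thesis
    unfolding laurent_monomial_eq[OF fin assms] dirs_list_def[symmetric] by (simp add: dirs_list(1))
qed

text \<open>
  A normal form with value \<open>0\<close> is a relation between Laurent monomials, so all its coefficients vanish and it lies in the ideal.
\<close>

lemma ev_kernel:
  assumes p: "keys p \<subseteq> lists letters" and ev: "ev p = 0"
  shows "p \<in> rel_ideal"
proof -
  obtain A f where f: "finite A" "\<And>\<alpha>. \<alpha> \<in> A \<Longrightarrow> keys \<alpha> \<subseteq> I" "\<And>\<alpha>. f \<alpha> \<in> R"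
    "p - normal_form f A \<in> rel_ideal" using normal_form_exists[OF p] by metis
  have ker: "ev a = 0" if "a \<in> rel_ideal" for a
  proof -
    have "{a \<in> carrier free_ring. ev a = 0} \<supseteq> rel_ideal"
      unfolding rel_ideal_def
    proof (rule ring.genideal_minimal[OF monoid_ring_ring[OF monoid_word_monoid]])
      from ring_hom_ring.kernel_is_ideal[OF ev_hom]
      show "ideal {a \<in> carrier free_ring. ev a = 0} free_ring" by (simp add: a_kernel_def')
    qed (use rels_carrier ev_rels in auto)
    then show ?thesis using that by auto
  qed
  obtain q where q: "\<And>\<alpha>. \<alpha> \<in> A \<Longrightarrow> q \<alpha> \<in> R \<and> q \<alpha> \<noteq> 0 \<and>
     word_value (standard_word (lookup \<alpha>) dirs_list) = q \<alpha> * laurent_monomial gx \<alpha>"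
    using value_standard_word f(2) unfolding left_multiple_def by metis
  have "ev (normal_form f A) = 0" using ker[OF f(4)] ev by simp
  then have "(\<Sum>\<alpha>\<in>A. (f \<alpha> * q \<alpha>) * laurent_monomial gx \<alpha>) = 0"
    unfolding normal_form_def int_scalars.eval_map_sum using q by (simp add: mult.assoc)
  then have "f \<alpha> * q \<alpha> = 0" if "\<alpha> \<in> A" for \<alpha>
    using f q that subringD[OF R_sub]
    by (intro laurent_independentD[OF indep, of A "\<lambda>\<alpha>. f \<alpha> * q \<alpha>"]) auto
  then have "f \<alpha> = 0" if "\<alpha> \<in> A" for \<alpha> using q that by force
  then have "normal_form f A = (\<Sum>\<alpha>\<in>A. word (standard 0 \<alpha>))"
    unfolding normal_form_def by simp
  then have "normal_form f A \<in> rel_ideal"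
    by (simp only:) (intro ideal_props(8) standard_zero)
  from ideal_props(2)[OF f(4) this] show ?thesis by simp
qed

theorem generated_ring_is_gwa:
  "is_gwa (generate_ring DD (R \<union> gx ` I \<union> gy ` I)) R I \<theta> \<xi> gx gy"
proof -
  let ?A = "generate_ring DD (R \<union> gx ` I \<union> gy ` I)"
  have A: "subring ?A DD" by (rule generate_ring_subring)
  have gen: "letter_value l \<in> ?A" if "l \<in> letters" for l
    using that by (auto simp: gwa_letters_def intro: generate_ring.incl)
  have "word_value w \<in> ?A" if "w \<in> lists letters" for w
    unfolding word_value_def using that gen by (intro subring_prod_list[OF A]) auto
  then have le: "ev p \<in> ?A" if "p \<in> carrier free_ring" for p
    unfolding eval_map_def using that
    by (intro subring_sum[OF A] subringD(6)[OF A] subring_of_int[OF A]) auto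
  have sub: "subring (ev ` carrier free_ring) (DD :: 'd ring)"
    by (rule ring_hom_ring.img_is_subring[OF ev_hom ring.carrier_is_subring[OF monoid_ring_ring[OF monoid_word_monoid]]])
  have lv: "letter_value l \<in> ev ` carrier free_ring" if "l \<in> letters" for l
  proof (rule image_eqI)
    show "letter_value l = ev (word [l])" by simp
    show "word [l] \<in> carrier free_ring" using that by simp
  qed
  have "r \<in> ev ` carrier free_ring" if "r \<in> R" for r using lv[of "Coef r"] that by simp
  moreover have "gx i \<in> ev ` carrier free_ring" "gy i \<in> ev ` carrier free_ring" if "i \<in> I" for i
    using lv[of "GX i"] lv[of "GY i"] that by simp_all
  ultimately have "R \<union> gx ` I \<union> gy ` I \<subseteq> ev ` carrier free_ring" by blast
  from generate_ring_least[OF sub this] le have surj: "ev ` carrier free_ring = ?A" by blast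
  have ker: "p \<in> Idl\<^bsub>free_ring\<^esub> rels" if "keys p \<subseteq> carrier (word_monoid letters)" "ev p = 0" for p
    using ev_kernel[of p] that by (simp add: rel_ideal_def)
  have h: "word_value (u \<otimes>\<^bsub>word_monoid letters\<^esub> v) = word_value u * word_value v"
    "word_value \<one>\<^bsub>word_monoid letters\<^esub> = 1" for u v by simp_all
  note iso = int_scalars.presentation_iso[where h = word_value, OF monoid_word_monoid A h surj rels_carrier]
  have iso1: "(\<lambda>Y. the_elem (ev ` Y)) \<in> ring_iso (free_ring Quot Idl\<^bsub>free_ring\<^esub> rels) (sub_ring ?A)"
    by (rule iso(1); (erule ev_rels | erule (1) ker))
  have iso2: "the_elem (ev ` (Idl\<^bsub>free_ring\<^esub> rels +>\<^bsub>free_ring\<^esub> p)) = ev p"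
    if "keys p \<subseteq> carrier (word_monoid letters)" for p
    by (rule iso(2)[OF _ _ that]; (erule ev_rels | erule (1) ker))
  have val: "the_elem (ev ` (Idl\<^bsub>free_ring\<^esub> rels +>\<^bsub>free_ring\<^esub> word [l])) = letter_value l" if "l \<in> letters" for l
  proof -
    have "keys (word [l]) \<subseteq> carrier (word_monoid letters)" using that by simp
    from iso2[OF this] show ?thesis by (simp only: int_scalars.eval_map_single) simp
  qed
  show ?thesis
    unfolding is_gwa_def Let_def gwa_free_ring_def
  proof (rule conjI[OF datum], rule bexI[OF _ iso1], intro conjI ballI)
    show "the_elem (ev ` (Idl\<^bsub>free_ring\<^esub> rels +>\<^bsub>free_ring\<^esub> word [Coef r])) = r" if "r \<in> R" for r
      by (subst val) (simp_all only: letters_iff that word_value_simps)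
    show "the_elem (ev ` (Idl\<^bsub>free_ring\<^esub> rels +>\<^bsub>free_ring\<^esub> word [GX i])) = gx i" if "i \<in> I" for i
      by (subst val) (simp_all only: letters_iff that word_value_simps)
    show "the_elem (ev ` (Idl\<^bsub>free_ring\<^esub> rels +>\<^bsub>free_ring\<^esub> word [GY i])) = gy i" if "i \<in> I" for i
      by (subst val) (simp_all only: letters_iff that word_value_simps)
  qed
qed

end

section \<open>Coefficient rings of Weyl preseeds\<close>

lemma group_ring_iff: "r \<in> group_ring S \<longleftrightarrow> (\<forall>m\<in>keys r. keys m \<subseteq> S)"
  unfolding group_ring_def free_Abelian_group_def by auto

lemma group_ring_mono: "S \<subseteq> T \<Longrightarrow> group_ring S \<subseteq> group_ring T"
  by (auto simp: group_ring_iff) (blast dest: subsetD)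

lemma group_ring_closed:
  "0 \<in> group_ring S" "1 \<in> group_ring S" "\<lbrakk>r \<in> group_ring S; s \<in> group_ring S\<rbrakk> \<Longrightarrow> r + s \<in> group_ring S"
  "r \<in> group_ring S \<Longrightarrow> - r \<in> group_ring S"
  "\<lbrakk>r \<in> group_ring S; s \<in> group_ring S\<rbrakk> \<Longrightarrow> r * s \<in> group_ring S"
  "keys m \<subseteq> S \<Longrightarrow> single m c \<in> group_ring S"
  "f \<in> S \<Longrightarrow> frozen_var f \<in> group_ring S"
proof -
  show "0 \<in> group_ring S" "1 \<in> group_ring S" by (auto simp: group_ring_iff)
  show "r + s \<in> group_ring S" if "r \<in> group_ring S" "s \<in> group_ring S"
    using that keys_add[of r s] by (auto simp: group_ring_iff subset_iff)
  show "r \<in> group_ring S \<Longrightarrow> - r \<in> group_ring S"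
    by (simp add: group_ring_iff in_keys_iff)
  show "r * s \<in> group_ring S" if rs: "r \<in> group_ring S" "s \<in> group_ring S"
    unfolding group_ring_iff
  proof
    fix m assume "m \<in> keys (r * s)"
    then obtain a b where "m = a + b" "a \<in> keys r" "b \<in> keys s"
      using keys_mult[of r s] by blast
    then show "keys m \<subseteq> S"
      using rs keys_add[of a b] unfolding group_ring_iff by blast
  qed
  show "keys m \<subseteq> S \<Longrightarrow> single m c \<in> group_ring S"
    by (auto simp: group_ring_iff)
  show "f \<in> S \<Longrightarrow> frozen_var f \<in> group_ring S"
    by (auto simp: group_ring_iff frozen_var_def)
qed

context ambient
begin

abbreviation "FV S \<equiv> (\<Union>i\<in>S. F i)"

definition coeffs :: "nat set \<Rightarrow> 'd set" where "coeffs S = \<iota> ` group_ring (FV S)"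

lemma FV_mono: "S \<subseteq> {1..n} \<Longrightarrow> r \<in> group_ring (FV S) \<Longrightarrow> r \<in> group_ring (FV {1..n})"
  using group_ring_mono[of "FV S" "FV {1..n}"] by blast

lemma incl_add: "\<lbrakk>r \<in> group_ring (FV {1..n}); s \<in> group_ring (FV {1..n})\<rbrakk> \<Longrightarrow> \<iota> (r + s) = \<iota> r + \<iota> s"
  and incl_mult: "\<lbrakk>r \<in> group_ring (FV {1..n}); s \<in> group_ring (FV {1..n})\<rbrakk> \<Longrightarrow> \<iota> (r * s) = \<iota> r * \<iota> s"
  and incl_one: "\<iota> 1 = 1"
  using incl_hom by (auto simp: ring_hom_def ring_of_type_algebra_def)

lemma incl_zero: "\<iota> 0 = 0"
  using incl_add[OF group_ring_closed(1) group_ring_closed(1)] by simp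

lemma incl_minus: "r \<in> group_ring (FV {1..n}) \<Longrightarrow> \<iota> (- r) = - \<iota> r"
  using incl_add[of r "- r"] group_ring_closed(4)[of r] incl_zero
  by (simp add: eq_neg_iff_add_eq_0 add.commute)

lemma incl_eq_0_iff: "r \<in> group_ring (FV {1..n}) \<Longrightarrow> \<iota> r = 0 \<longleftrightarrow> r = 0"
  using inj_on_eq_iff[OF incl_inj _ group_ring_closed(1)] incl_zero by simp

lemma scalars: "central_scalars (scalar \<iota>)"
proof
  have k: "single 0 a \<in> group_ring (FV {1..n})" for a :: 'k
    by (rule group_ring_closed(6)) simp
  show "scalar \<iota> (a + b) = scalar \<iota> a + scalar \<iota> b" for a b
    unfolding scalar_def single_add by (rule incl_add[OF k k])
  show "scalar \<iota> (a * b) = scalar \<iota> a * scalar \<iota> b" for a b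
    using incl_mult[OF k k, of a b] unfolding scalar_def mult_single by simp
  show "scalar \<iota> 1 = 1" unfolding scalar_def by (simp add: incl_one)
qed (rule scalar_central)

sublocale scal: central_scalars "scalar \<iota>" by (rule scalars)

lemma coeffs_mono: "S \<subseteq> T \<Longrightarrow> coeffs S \<subseteq> coeffs T"
  unfolding coeffs_def by (intro image_mono group_ring_mono) blast

lemma coeffs_subcring:
  assumes "S \<subseteq> {1..n}"
  shows "subcring (coeffs S) DD"
  unfolding subcring_DD_iff subring_DD_iff
proof (intro conjI ballI)
  show "1 \<in> coeffs S" unfolding coeffs_def using incl_one group_ring_closed(2) by (metis imageI)
  fix a assume "a \<in> coeffs S"
  then obtain r where r: "a = \<iota> r" "r \<in> group_ring (FV S)" by (auto simp: coeffs_def)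
  note r' = FV_mono[OF assms r(2)]
  show "- a \<in> coeffs S"
    unfolding r(1) incl_minus[OF r', symmetric] coeffs_def using r(2) by (intro imageI group_ring_closed)
  fix b assume "b \<in> coeffs S"
  then obtain s where s: "b = \<iota> s" "s \<in> group_ring (FV S)" by (auto simp: coeffs_def)
  note s' = FV_mono[OF assms s(2)]
  show "a + b \<in> coeffs S" "a * b \<in> coeffs S"
    unfolding r(1) s(1) incl_add[OF r' s', symmetric] incl_mult[OF r' s', symmetric] coeffs_def
    using group_ring_closed(3,5)[OF r(2) s(2)] by (simp_all only: imageI)
  show "a * b = b * a"
    unfolding r(1) s(1) incl_mult[OF r' s', symmetric] incl_mult[OF s' r', symmetric] by (simp add: mult.commute)
qed

lemma coeffs_subring: "S \<subseteq> {1..n} \<Longrightarrow> subring (coeffs S) DD"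
  using coeffs_subcring by (simp add: subcring_DD_iff)

lemma scalar_coeffs: "scalar \<iota> c \<in> coeffs S"
  unfolding scalar_def coeffs_def by (intro imageI group_ring_closed(6)) simp

lemma frozen_coeffs: "\<lbrakk>i \<in> S; f \<in> F i\<rbrakk> \<Longrightarrow> \<iota> (frozen_var f) \<in> coeffs S"
  unfolding coeffs_def by (intro imageI group_ring_closed(7)) auto

lemma monomial_inverse:
  assumes "keys m \<subseteq> FV {1..n}"
  shows "inverse (\<iota> (single m 1)) = \<iota> (single (- m) 1)"
proof -
  have "\<iota> (single m 1) * \<iota> (single (- m) 1) = \<iota> (single m 1 * single (- m) 1)"
    using assms by (intro incl_mult[symmetric] group_ring_closed(6)) (simp_all add: keys_minus)
  also have "\<dots> = 1" by (simp add: mult_single incl_one)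
  finally show ?thesis by (rule inverse_unique)
qed

lemma frozen_inverse_coeffs:
  assumes "S \<subseteq> {1..n}" "i \<in> S" "f \<in> F i"
  shows "\<iota> (frozen_var f) \<noteq> 0" "inverse (\<iota> (frozen_var f)) \<in> coeffs S"
proof -
  have k: "keys (single f (1::int)) \<subseteq> FV S" using assms by auto
  then have k': "keys (single f (1::int)) \<subseteq> FV {1..n}" using assms(1) by blast
  show "inverse (\<iota> (frozen_var f)) \<in> coeffs S"
    unfolding frozen_var_def monomial_inverse[OF k'] coeffs_def
    using k by (intro imageI group_ring_closed(6)) (simp add: keys_minus)
  have "(frozen_var f :: ('f, 'k) gring) \<in> group_ring (FV {1..n})"
    unfolding frozen_var_def by (rule group_ring_closed(6)[OF k'])
  moreover have "(frozen_var f :: ('f, 'k) gring) \<noteq> 0"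
    unfolding frozen_var_def by (metis lookup_single_eq lookup_zero zero_neq_one)
  ultimately show "\<iota> (frozen_var f) \<noteq> 0" using incl_eq_0_iff by simp
qed

text \<open>
  Induction on a group ring: every element is a sum of scalar multiples of monomials, and every monomial a product of frozen
  variables and their inverses.
\<close>

lemma coeffs_least:
  assumes S: "S \<subseteq> {1..n}" and P: "subring P DD" and sc: "\<And>c. scalar \<iota> c \<in> P"
    and fr: "\<And>i f. \<lbrakk>i \<in> S; f \<in> F i\<rbrakk> \<Longrightarrow> \<iota> (frozen_var f) \<in> P"
    and fri: "\<And>i f. \<lbrakk>i \<in> S; f \<in> F i\<rbrakk> \<Longrightarrow> inverse (\<iota> (frozen_var f)) \<in> P"
  shows "coeffs S \<subseteq> P"
proof -
  have big: "single m c \<in> group_ring (FV {1..n})" if "keys m \<subseteq> FV S" for m and c :: 'k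
    using that S by (intro group_ring_closed(6)) blast
  have monomial: "\<iota> (single m 1) \<in> P \<and> \<iota> (single (- m) 1) \<in> P"
    if "keys m \<subseteq> FV S" for m
    using that
  proof (induction m rule: free_Abelian_group_induct[consumes 1, case_names zero diff gen])
    case zero
    then show ?case using subringD(1)[OF P] incl_one by simp
  next
    case (diff a b)
    have "single (a - b) 1 = single a (1::'k) * single (- b) 1"
      "single (- (a - b)) 1 = single b (1::'k) * single (- a) 1"
      by (simp_all add: mult_single)
    then have "\<iota> (single (a - b) 1) = \<iota> (single a 1) * \<iota> (single (- b) 1)"
       "\<iota> (single (- (a - b)) 1) = \<iota> (single b 1) * \<iota> (single (- a) 1)"
      using diff(1,2) by (simp_all only: incl_mult big keys_minus)
    then show ?case using diff subringD(6)[OF P] by simp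
  next
    case (gen f)
    then obtain i where i: "i \<in> S" "f \<in> F i" by auto
    have k: "keys (single f (1::int)) \<subseteq> FV {1..n}" using i S by auto
    show ?case
      using fr[OF i] fri[OF i] unfolding frozen_var_def monomial_inverse[OF k] by simp
  qed
  have "\<iota> r \<in> P" if "keys r \<subseteq> {m. keys m \<subseteq> FV S}" for r
    using that
  proof (induction r rule: poly_mapping_support_induct)
    case zero
    show ?case using incl_zero subringD(2)[OF P] by simp
  next
    case (single m c)
    have "single m c = single 0 c * single m 1"
      by (simp add: mult_single)
    then have "\<iota> (single m c) = scalar \<iota> c * \<iota> (single m 1)"
      using incl_mult[OF big[of 0 c] big[of m 1]] single by (simp add: scalar_def)
    then show ?case using sc monomial single subringD(6)[OF P] by simp
  next
    case (add r s)
    have "r \<in> group_ring (FV {1..n})" "s \<in> group_ring (FV {1..n})"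
      using add(1,2) FV_mono[OF S, of r] FV_mono[OF S, of s] unfolding group_ring_iff by blast+
    then show ?case using add(3,4) by (simp add: incl_add subringD(4)[OF P])
  qed
  then have "\<iota> r \<in> P" if "r \<in> group_ring (FV S)" for r
    using that unfolding group_ring_iff by blast
  then show ?thesis by (auto simp: coeffs_def)
qed

text \<open>
  \<open>D i\<close> is spanned by monomials in \<open>t 1, \<dots>, t i\<close> with coefficients in the frozen variables up to direction \<open>i\<close>, and all of
  these commute with a frozen variable of a direction \<open>j > i\<close>.
\<close>

lemma generators_frozen_comm:
  assumes "i \<in> {1..n}" "j \<in> {1..n}" "i < j" "f \<in> F j" "z \<in> right_fractions (D i)"
  shows "z * \<iota> (frozen_var f) = \<iota> (frozen_var f) * z"
proof -
  let ?Z = "centralizer {\<iota> (frozen_var f)}"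
  have C: "coeffs {1..i} \<subseteq> ?Z"
  proof -
    have "coeffs {1..i} \<subseteq> coeffs {1..n}" using assms by (intro coeffs_mono) auto
    then show ?thesis
      using coeffs_subcring[of "{1..n}"] frozen_coeffs[OF assms(2,4)] by (auto simp: subcring_DD_iff centralizer_def)
  qed
  have "d \<in> ?Z" if d: "d \<in> D i" for d
  proof -
    obtain c where c: "c \<in> laurent_coeffs (\<iota> ` group_ring (frozen_upto F i)) {1..i}" "d = laurent_sum t c"
      using gen_basis[OF assms(1) d] by blast
    have "t l \<in> ?Z \<and> inverse (t l) \<in> ?Z" if "l \<in> {1..i}" for l
      using gen_frozen_comm[of l j f] assms that by (auto simp: centralizer_def inverse_commute)
    note tZ = this
    have "lookup c \<alpha> * laurent_monomial t \<alpha> \<in> ?Z" if "\<alpha> \<in> keys c" for \<alpha>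
    proof (intro subringD(6)[OF centralizer_subring] laurent_monomial_in_subring centralizer_subring)
      show "lookup c \<alpha> \<in> ?Z"
        using c(1) C unfolding laurent_coeffs_def coeffs_def by blast
      show "t l \<in> ?Z \<and> inverse (t l) \<in> ?Z" if "l \<in> keys \<alpha>" for l
        using c(1) \<open>\<alpha> \<in> keys c\<close> that unfolding laurent_coeffs_def by (intro tZ) blast
    qed
    then show ?thesis
      unfolding c(2) laurent_sum_def by (intro subring_sum[OF centralizer_subring])
  qed
  then have "z \<in> ?Z"
    using assms(5) by (auto simp: right_fractions_def intro: subringD(6)[OF centralizer_subring] centralizer_inverse)
  then show ?thesis by (simp add: centralizer_def)
qed

end

locale weyl_preseed = ambient n F \<iota> D t
  for n :: nat and F :: "nat \<Rightarrow> 'f set" and \<iota> :: "('f, 'k::field_char_0) gring \<Rightarrow> 'd::division_ring"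
    and D :: "nat \<Rightarrow> 'd set" and t :: "nat \<Rightarrow> 'd" +
  fixes p :: "('f, 'd) preseed" and \<theta> :: "nat \<Rightarrow> 'd \<Rightarrow> 'd"
  assumes pre: "is_preseed n F \<iota> D t p" and weyl: "is_weyl \<iota> p \<theta>" and free: "exchange_vars_free \<iota> p"
begin

abbreviation "x \<equiv> exch p"
abbreviation "\<xi> \<equiv> exchange_poly \<iota> p"
abbreviation "I \<equiv> {1..n}"
abbreviation "C \<equiv> coeffs I"
abbreviation "Q \<equiv> right_fractions C"

lemma dirs_p [simp]: "dirs p = I" and frozen_p [simp]: "frozen p = F"
  using pre by (auto simp: is_preseed_def)

lemma coeff_ring_p [simp]: "coeff_ring \<iota> p = C"
  by (simp add: coeff_ring_def coeffs_def)

lemma C_subcring: "subcring C DD" and C_subring: "subring C DD"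
  using coeffs_subcring[of I] coeffs_subring[of I] by auto

lemma C_comm: "\<lbrakk>a \<in> C; b \<in> C\<rbrakk> \<Longrightarrow> a * b = b * a"
  using C_subcring by (auto simp: subcring_DD_iff)

lemma Q_subcring: "subcring Q DD" and Q_subring: "subring Q DD" and Q_inverse: "q \<in> Q \<Longrightarrow> inverse q \<in> Q"
  using right_fractions_subcring[OF C_subcring] by (auto simp: subcring_DD_iff)

lemma Q_comm: "\<lbrakk>a \<in> Q; b \<in> Q\<rbrakk> \<Longrightarrow> a * b = b * a"
  using Q_subcring by (auto simp: subcring_DD_iff)

lemma C_Q: "C \<subseteq> Q" by (rule right_fractions_incl[OF C_subring])

lemma x_comm: "\<lbrakk>i \<in> I; j \<in> I\<rbrakk> \<Longrightarrow> x i * x j = x j * x i"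
  and x_indep: "laurent_independent C I x"
  using free by (auto simp: exchange_vars_free_def)

lemma x_nonzero: "i \<in> I \<Longrightarrow> x i \<noteq> 0"
  by (rule laurent_independent_nonzero[OF x_indep subringD(2)[OF C_subring] subringD(1)[OF C_subring]])

lemma x_indep_Q: "laurent_independent Q I x"
  by (rule laurent_independent_right_fractions[OF C_subcring x_indep])

text \<open>
  For \<open>j < i\<close> this holds because the automorphism taking \<open>t i\<close> to \<open>x i\<close> fixes the frozen variables, for \<open>j > i\<close> because \<open>x i\<close> is a
  fraction of elements that commute with \<open>f\<close>.
\<close>

lemma x_frozen_comm:
  assumes "i \<in> I" "j \<in> I" "i \<noteq> j" "f \<in> F j"
  shows "x i * \<iota> (frozen_var f) = \<iota> (frozen_var f) * x i"
proof -
  obtain \<phi> where \<phi>: "\<phi> \<in> ring_iso (sub_ring (right_fractions (D i))) (sub_ring (right_fractions (D i)))"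
    "\<And>r. r \<in> group_ring (frozen_upto F i) \<Longrightarrow> \<phi> (\<iota> r) = \<iota> r" "x i = \<phi> (t i)"
  proof -
    have "\<exists>\<phi>\<in>ring_iso (sub_ring (right_fractions (D i))) (sub_ring (right_fractions (D i))).
            (\<forall>r\<in>group_ring (frozen_upto F i). \<phi> (\<iota> r) = \<iota> r) \<and> exch p i = \<phi> (t i)"
      using pre assms(1) unfolding is_preseed_def by (elim conjE) (drule bspec, assumption, elim conjE, assumption)
    then show ?thesis using that by (elim bexE conjE) (erule that, simp_all)
  qed
  have sub: "D i \<subseteq> right_fractions (D i)"
    using ore[OF assms(1)] by (intro right_fractions_incl) (simp add: ore_domain_def)
  have t: "t i \<in> right_fractions (D i)" using gen_unit[OF assms(1)] sub by auto
  have cl: "\<phi> a \<in> right_fractions (D i)" if "a \<in> right_fractions (D i)" for a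
    using \<phi>(1) that unfolding ring_iso_sub_ring_iff by blast
  have mult: "\<phi> (a * b) = \<phi> a * \<phi> b" if "a \<in> right_fractions (D i)" "b \<in> right_fractions (D i)" for a b
    using \<phi>(1) that unfolding ring_iso_sub_ring_iff by blast
  show ?thesis
  proof (cases "i < j")
    case True
    show ?thesis
      by (rule generators_frozen_comm[OF assms(1,2) True assms(4)]) (simp only: \<phi>(3) cl[OF t])
  next
    case False
    have f: "frozen_var f \<in> group_ring (frozen_upto F i)"
      by (rule group_ring_closed(7)) (use assms False in auto)
    have rf: "\<iota> (frozen_var f) \<in> right_fractions (D i)"
      using group_ring_sub[OF assms(1)] f sub by blast
    have "x i * \<iota> (frozen_var f) = \<phi> (t i * \<iota> (frozen_var f))"
      by (simp only: mult[OF t rf] \<phi>(2)[OF f] \<phi>(3))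
    also have "\<dots> = \<iota> (frozen_var f) * x i"
      by (simp only: gen_frozen_comm[OF assms] mult[OF rf t] \<phi>(2)[OF f] \<phi>(3))
    finally show ?thesis .
  qed
qed

lemma x_coeffs_comm:
  assumes "i \<in> I" "S \<subseteq> I" "i \<notin> S" "c \<in> coeffs S"
  shows "x i * c = c * x i"
proof -
  have "coeffs S \<subseteq> centralizer {x i}"
  proof (rule coeffs_least[OF assms(2) centralizer_subring])
    show "scalar \<iota> c \<in> centralizer {x i}" for c using scalar_central by (simp add: centralizer_def)
    fix j f assume "j \<in> S" "f \<in> F j"
    then have "x i * \<iota> (frozen_var f) = \<iota> (frozen_var f) * x i"
      using assms(2,3) by (intro x_frozen_comm[OF assms(1), of j f]) auto
    then show "\<iota> (frozen_var f) \<in> centralizer {x i}" by (simp add: centralizer_def)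
    then show "inverse (\<iota> (frozen_var f)) \<in> centralizer {x i}" by (rule centralizer_inverse)
  qed
  then show ?thesis using assms(4) by (auto simp: centralizer_def)
qed

text \<open>
  On the frozen variables of direction \<open>i\<close> conjugation by \<open>x i\<close> is \<open>\<theta> i\<close>, on the others it is trivial.
  Besides \<open>p\<close> itself, \<open>q\<close> may be one of its rank one restrictions.
\<close>

lemma x_normalizer_gen:
  assumes w: "is_weyl \<iota> q \<theta>" "i \<in> dirs q" "dirs q \<subseteq> I" "frozen q = F" "exch q = x"
  shows "x i \<in> normalizer (coeffs (dirs q))"
proof -
  let ?C = "coeffs (dirs q)"
  have q: "coeff_ring \<iota> q = ?C" using w by (simp add: coeff_ring_def coeffs_def)
  have S: "subring ?C DD" by (rule coeffs_subring[OF w(3)])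
  have i: "i \<in> I" using w by auto
  have W: "\<theta> i \<in> ring_iso DD DD \<and> \<theta> i ` ?C = ?C \<and>
     (\<forall>j\<in>dirs q. \<theta> i (x j) = x j) \<and>
     (\<forall>f\<in>F i. x i * \<iota> (frozen_var f) = \<theta> i (\<iota> (frozen_var f)) * x i \<and>
        inverse (x i) * \<iota> (frozen_var f) = inv_into UNIV (\<theta> i) (\<iota> (frozen_var f)) * inverse (x i))"
    using w(1,2) unfolding is_weyl_def q w(4,5) by (elim ballE[of _ _ i]) simp_all
  then have iso: "\<theta> i \<in> ring_iso DD DD" and img: "\<theta> i ` ?C = ?C"
    and f: "\<And>f. f \<in> F i \<Longrightarrow> x i * \<iota> (frozen_var f) = \<theta> i (\<iota> (frozen_var f)) * x i"
    and f': "\<And>f. f \<in> F i \<Longrightarrow> inverse (x i) * \<iota> (frozen_var f) = inv_into UNIV (\<theta> i) (\<iota> (frozen_var f)) * inverse (x i)"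
    by simp_all
  have bij: "bij (\<theta> i)" using iso by (simp add: ring_iso_def)
  have mem: "\<theta> i c \<in> ?C" "inv_into UNIV (\<theta> i) c \<in> ?C" if "c \<in> ?C" for c
  proof -
    show "\<theta> i c \<in> ?C" using imageI[OF that, of "\<theta> i"] by (simp only: img)
    have "c \<in> \<theta> i ` ?C" using that by (simp only: img)
    then obtain c' where "c = \<theta> i c'" "c' \<in> ?C" by (rule imageE)
    then show "inv_into UNIV (\<theta> i) c \<in> ?C" using bij by (simp add: bij_is_inj)
  qed
  have key: "?C \<subseteq> {z. m * z * inverse m \<in> ?C}"
    if m: "m \<noteq> 0" and m_comm: "\<And>j f. \<lbrakk>j \<in> dirs q; j \<noteq> i; f \<in> F j\<rbrakk> \<Longrightarrow> m * \<iota> (frozen_var f) = \<iota> (frozen_var f) * m"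
      and \<tau>: "\<tau> \<in> ring_iso DD DD" "\<And>f. f \<in> F i \<Longrightarrow> m * \<iota> (frozen_var f) = \<tau> (\<iota> (frozen_var f)) * m"
      "\<And>c. c \<in> ?C \<Longrightarrow> \<tau> c \<in> ?C" for m :: 'd and \<tau> :: "'d \<Rightarrow> 'd"
  proof (rule coeffs_least[OF w(3)])
    have assoc: "m * (a * b) * inverse m = (m * a * inverse m) * (m * b * inverse m)" for a b
      using m by (simp add: mult.assoc inverse_cancel)
    show "subring {z. m * z * inverse m \<in> ?C} DD"
      unfolding subring_DD_iff mem_Collect_eq
    proof (intro conjI ballI)
      fix a assume a: "a \<in> {z. m * z * inverse m \<in> ?C}"
      then show "m * (- a) * inverse m \<in> ?C" using subringD(3)[OF S] by simp
      fix b assume b: "b \<in> {z. m * z * inverse m \<in> ?C}"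
      show "m * (a + b) * inverse m \<in> ?C"
        using subringD(4)[OF S] a b by (simp add: distrib_left distrib_right)
      show "m * (a * b) * inverse m \<in> ?C"
        unfolding assoc using subringD(6)[OF S] a b by blast
    qed (use m subringD(1)[OF S] in simp)
    show "scalar \<iota> c \<in> {z. m * z * inverse m \<in> ?C}" for c
    proof -
      have "m * scalar \<iota> c * inverse m = scalar \<iota> c * (m * inverse m)"
        by (simp only: scalar_central[of c m, symmetric] mult.assoc)
      then show ?thesis using scalar_coeffs m by simp
    qed
    fix j f assume jf: "j \<in> dirs q" "f \<in> F j"
    let ?f = "\<iota> (frozen_var f)"
    have f0: "?f \<noteq> 0" and fi: "inverse ?f \<in> ?C" using frozen_inverse_coeffs[OF w(3) jf] by auto
    have *: "m * ?f * inverse m \<in> ?C \<and> inverse (m * ?f * inverse m) \<in> ?C"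
    proof (cases "j = i")
      case True
      have "m * ?f * inverse m = \<tau> ?f" using \<tau>(2)[of f] jf True m by (simp add: mult.assoc)
      moreover have "\<tau> (inverse ?f) * \<tau> ?f = 1"
        using \<tau>(1) f0 unfolding ring_iso_def ring_hom_def by simp (metis left_inverse)
      then have "inverse (\<tau> ?f) = \<tau> (inverse ?f)" by (metis inverse_unique inverse_inverse_eq)
      ultimately show ?thesis using \<tau>(3) frozen_coeffs[OF jf] fi by simp
    next
      case False
      have "m * ?f * inverse m = ?f" using m_comm[OF jf(1) False jf(2)] m by (simp add: mult.assoc)
      then show ?thesis using frozen_coeffs[OF jf] fi by simp
    qed
    then show "?f \<in> {z. m * z * inverse m \<in> ?C}" by simp
    have "inverse (m * ?f * inverse m) = m * inverse ?f * inverse m"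
      using m f0 by (simp add: nonzero_inverse_mult_distrib mult.assoc)
    then show "inverse ?f \<in> {z. m * z * inverse m \<in> ?C}" using * by simp
  qed
  have xf: "x i * \<iota> (frozen_var f) = \<iota> (frozen_var f) * x i" if "j \<in> dirs q" "j \<noteq> i" "f \<in> F j" for j f
    using x_frozen_comm[OF i, of j f] that w(3) by auto
  have iso': "inv_into UNIV (\<theta> i) \<in> ring_iso DD DD"
    using ring_iso_set_sym[OF ring_DD iso] by simp
  have k1: "?C \<subseteq> {z. x i * z * inverse (x i) \<in> ?C}"
    by (rule key[OF x_nonzero[OF i] xf iso f mem(1)])
  have k2: "?C \<subseteq> {z. inverse (x i) * z * inverse (inverse (x i)) \<in> ?C}"
    by (rule key[OF _ inverse_commute[OF xf] iso' f' mem(2)]) (simp_all add: x_nonzero[OF i])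
  show ?thesis
    unfolding normalizer_def using x_nonzero[OF i] k1 k2 by auto
qed

lemma x_normalizer: "i \<in> I \<Longrightarrow> x i \<in> normalizer C"
  using x_normalizer_gen[OF weyl] by simp

lemma x_normalizer_Q: "i \<in> I \<Longrightarrow> x i \<in> normalizer Q"
  using x_normalizer normalizer_right_fractions by blast

section \<open>Exchange polynomials\<close>

lemma exchange_poly_in:
  assumes k: "k \<in> I" and P: "subring P DD" and f: "\<And>f. f \<in> F k \<Longrightarrow> \<iota> (frozen_var f) \<in> P"
  shows "\<xi> k \<in> P"
proof -
  define G where "G r \<longleftrightarrow> r \<in> group_ring (FV {1..n}) \<and> \<iota> r \<in> P" for r
  have one: "G 1" by (simp add: G_def group_ring_closed incl_one subringD(1)[OF P])
  have mult: "G (r * s)" if "G r" "G s" for r s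
    using that by (simp add: G_def group_ring_closed incl_mult subringD(6)[OF P])
  have add: "G (r + s)" if "G r" "G s" for r s
    using that by (simp add: G_def group_ring_closed incl_add subringD(4)[OF P])
  have var: "G (frozen_var g)" if "g \<in> F k" for g
  proof -
    have "g \<in> FV {1..n}" using that k by blast
    then show ?thesis using f[OF that] by (simp add: G_def group_ring_closed(7))
  qed
  have pow: "G (frozen_var g ^ m)" if "g \<in> F k" for g m
    by (induction m) (auto intro: one mult var[OF that])
  have prod: "G (\<Prod>f\<in>A. frozen_var f ^ e f)" if "A \<subseteq> F k" for A and e :: "'f \<Rightarrow> nat"
    using that by (induction A rule: infinite_finite_induct) (auto intro: one mult pow)
  show ?thesis
    unfolding exchange_poly_def Let_def frozen_p
    using add[OF prod prod, of "{f \<in> F k. (Some f, None) \<in> arrows (quiv p k)}" "{f \<in> F k. (None, Some f) \<in> arrows (quiv p k)}"]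
    by (auto simp: G_def)
qed

lemma xi_coeffs: "k \<in> I \<Longrightarrow> \<xi> k \<in> coeffs {k}"
  by (rule exchange_poly_in[OF _ coeffs_subring]) (auto intro: frozen_coeffs)

lemma xi_C: "k \<in> I \<Longrightarrow> \<xi> k \<in> C"
  using xi_coeffs coeffs_mono[of "{k}" I] by auto

text \<open>
  An exchange polynomial is a sum of two monomials with coefficient \<open>1\<close>; even if they coincide, the sum is not
  zero in characteristic \<open>0\<close>.
\<close>

lemma xi_nonzero:
  assumes k: "k \<in> I"
  shows "\<xi> k \<noteq> 0"
proof -
  define G where "G r \<longleftrightarrow> (\<exists>m. keys m \<subseteq> FV {1..n} \<and> r = single m 1)" for r :: "('f, 'k) gring"
  have one: "G 1" unfolding G_def by (rule exI[of _ 0]) simp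
  have mult: "G (r * s)" if rs: "G r" "G s" for r s
  proof -
    obtain m m' where m: "keys m \<subseteq> FV {1..n}" "r = single m 1"
      "keys m' \<subseteq> FV {1..n}" "s = single m' 1" using rs unfolding G_def by blast
    have "keys (m + m') \<subseteq> FV {1..n}" using m keys_add[of m m'] by blast
    then show ?thesis unfolding G_def m by (intro exI[of _ "m + m'"]) (simp add: mult_single)
  qed
  have var: "G (frozen_var g)" if "g \<in> F k" for g
    unfolding G_def frozen_var_def by (rule exI[of _ "single g 1"]) (use that k in auto)
  have pow: "G (frozen_var g ^ m)" if "g \<in> F k" for g m
    by (induction m) (auto intro: one mult var[OF that])
  have prod: "G (\<Prod>f\<in>A. frozen_var f ^ e f)" if "A \<subseteq> F k" for A and e :: "'f \<Rightarrow> nat"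
    using that by (induction A rule: infinite_finite_induct) (auto intro: one mult pow)
  let ?A = "{f \<in> F k. (Some f, None) \<in> arrows (quiv p k)}" and ?B = "{f \<in> F k. (None, Some f) \<in> arrows (quiv p k)}"
  have "?A \<subseteq> F k" "?B \<subseteq> F k" by auto
  then obtain m m' where m: "keys m \<subseteq> FV {1..n}" "keys m' \<subseteq> FV {1..n}"
    "(\<Prod>f\<in>?A. frozen_var f ^ qval (quiv p k) (Some f) None) = single m (1::'k)"
    "(\<Prod>f\<in>?B. frozen_var f ^ qval (quiv p k) None (Some f)) = single m' (1::'k)"
    using prod unfolding G_def by meson
  have xi: "\<xi> k = \<iota> (single m 1 + single m' 1)"
    unfolding exchange_poly_def Let_def frozen_p m(3,4) ..
  have "lookup (single m 1 + single m' (1::'k)) m \<noteq> 0"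
    by (simp add: lookup_add lookup_single when_def)
  then have "single m 1 + single m' (1::'k) \<noteq> 0" by (metis lookup_zero)
  then show ?thesis
    unfolding xi using m(1,2) by (subst incl_eq_0_iff) (auto intro: group_ring_closed)
qed

lemma x_xi_comm: "\<lbrakk>i \<in> I; k \<in> I; i \<noteq> k\<rbrakk> \<Longrightarrow> x i * \<xi> k = \<xi> k * x i"
  using x_coeffs_comm[of i "{k}"] xi_coeffs by auto

lemma weyl_iso: "i \<in> I \<Longrightarrow> \<theta> i \<in> ring_iso DD DD"
  and weyl_frozen: "\<lbrakk>i \<in> I; f \<in> F i\<rbrakk> \<Longrightarrow> x i * \<iota> (frozen_var f) = \<theta> i (\<iota> (frozen_var f)) * x i"
  using weyl by (auto simp: is_weyl_def)

lemma theta_bij: "i \<in> I \<Longrightarrow> bij (\<theta> i)"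
  using weyl_iso[of i] by (simp add: ring_iso_def)

lemma theta_hom:
  "i \<in> I \<Longrightarrow> \<theta> i (a + b) = \<theta> i a + \<theta> i b" "i \<in> I \<Longrightarrow> \<theta> i (a * b) = \<theta> i a * \<theta> i b" "i \<in> I \<Longrightarrow> \<theta> i 1 = 1"
  using weyl_iso[of i] by (auto simp: ring_iso_def ring_hom_def)

lemma theta_agree_subring:
  assumes i: "i \<in> I"
  shows "subring {z. x i * z = \<theta> i z * x i} DD"
proof -
  have z: "\<theta> i 0 = 0" using theta_hom(1)[OF i, of 0 0] by simp
  have m: "\<theta> i (- a) = - \<theta> i a" for a
    using theta_hom(1)[OF i, of "- a" a] z by (simp add: eq_neg_iff_add_eq_0)
  have "x i * (a * b) = \<theta> i a * \<theta> i b * x i" if "x i * a = \<theta> i a * x i" "x i * b = \<theta> i b * x i" for a b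
  proof -
    have "x i * (a * b) = x i * a * b" by (simp only: mult.assoc)
    also have "\<dots> = \<theta> i a * (x i * b)" by (simp only: that(1) mult.assoc)
    finally show ?thesis by (simp only: that(2) mult.assoc)
  qed
  then show ?thesis
    unfolding subring_DD_iff by (simp add: theta_hom[OF i] m distrib_left distrib_right)
qed

text \<open>
  Conjugation by \<open>x i\<close> and \<open>\<theta> i\<close> agree on the frozen variables of direction \<open>i\<close>, hence on integral polynomials in
  them; on the scalars they may differ.
\<close>

lemma theta_xi:
  assumes "i \<in> I"
  shows "x i * \<xi> i = \<theta> i (\<xi> i) * x i"
  using exchange_poly_in[OF assms theta_agree_subring[OF assms]] weyl_frozen[OF assms] by simp

lemma inv_theta_xi:
  assumes i: "i \<in> I"
  shows "inv_into UNIV (\<theta> i) (\<xi> i) = inverse (x i) * \<xi> i * x i"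
proof -
  have "\<theta> i (x i) = x i" using weyl i by (auto simp: is_weyl_def)
  moreover have "\<theta> i (inverse (x i)) * \<theta> i (x i) = 1"
    using theta_hom(2,3)[OF i] x_nonzero[OF i] by (metis left_inverse)
  ultimately have "\<theta> i (inverse (x i)) = inverse (x i)"
    by (metis inverse_unique inverse_inverse_eq)
  then have "\<theta> i (inverse (x i) * \<xi> i * x i) = inverse (x i) * (\<theta> i (\<xi> i) * x i)"
    using \<open>\<theta> i (x i) = x i\<close> by (simp add: theta_hom[OF i] mult.assoc)
  also have "\<dots> = \<xi> i"
    unfolding theta_xi[OF i, symmetric] using x_nonzero[OF i] by (simp add: mult.assoc[symmetric])
  finally show ?thesis using theta_bij[OF i] by (metis bij_is_inj inv_f_f)
qed

end

section \<open>The isomorphisms induced by mutations\<close>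

lemma conj_generated_ring_iso:
  fixes c :: "'d::division_ring"
  assumes c: "c \<noteq> 0" and 1: "\<And>h. h \<in> H \<Longrightarrow> c * h * inverse c \<in> generate_ring DD H'"
    and 2: "\<And>h. h \<in> H' \<Longrightarrow> \<exists>g\<in>generate_ring DD H. h = c * g * inverse c"
  shows "(\<lambda>a. c * a * inverse c) \<in> ring_iso (sub_ring (generate_ring DD H)) (sub_ring (generate_ring DD H'))"
proof -
  let ?\<psi> = "\<lambda>a. c * a * inverse c"
  have add: "?\<psi> (a + b) = ?\<psi> a + ?\<psi> b" and mult: "?\<psi> (a * b) = ?\<psi> a * ?\<psi> b" and one: "?\<psi> 1 = 1" for a b
    using c by (simp_all add: distrib_left distrib_right mult.assoc inverse_cancel)
  have sub: "subring (?\<psi> ` generate_ring DD H) (DD :: 'd ring)"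
    by (rule subring_bij_image[OF generate_ring_subring add mult one])
  have "subring {a. ?\<psi> a \<in> generate_ring DD H'} (DD :: 'd ring)"
    unfolding subring_DD_iff mem_Collect_eq
  proof (intro conjI ballI)
    note g = generate_ring_subring[of H']
    show "?\<psi> 1 \<in> generate_ring DD H'" unfolding one by (rule subringD(1)[OF g])
    fix a assume a: "a \<in> {a. ?\<psi> a \<in> generate_ring DD H'}"
    then show "?\<psi> (- a) \<in> generate_ring DD H'" using subringD(3)[OF g] by simp
    fix b assume b: "b \<in> {a. ?\<psi> a \<in> generate_ring DD H'}"
    show "?\<psi> (a + b) \<in> generate_ring DD H'" "?\<psi> (a * b) \<in> generate_ring DD H'"
      unfolding add mult using a b subringD(4,6)[OF g] by simp_all
  qed
  from generate_ring_least[OF this, of H] 1 have "?\<psi> ` generate_ring DD H \<subseteq> generate_ring DD H'" by blast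
  moreover have "generate_ring DD H' \<subseteq> ?\<psi> ` generate_ring DD H"
    by (rule generate_ring_least[OF sub]) (use 2 in blast)
  moreover have "inj ?\<psi>"
    using c by (intro injI) (metis mult.assoc inverse_cancel(1) mult_cancel_left mult_cancel_right inverse_zero_imp_zero)
  ultimately have "bij_betw ?\<psi> (generate_ring DD H) (generate_ring DD H')"
    by (intro bij_betw_imageI) (auto intro: inj_on_subset)
  then show ?thesis
    unfolding ring_iso_sub_ring_iff using add mult one by (auto dest: bij_betwE)
qed

text \<open>
  Conjugation by \<open>c\<close> interchanges the roles of the two generators in direction \<open>k\<close> and fixes the
  other generators; the two products \<open>x' * y'\<close> and \<open>y' * x'\<close> provide the exchange polynomial and its conjugate.
\<close>

lemma conj_exchange_iso:
  fixes c :: "'d::division_ring"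
  assumes c: "c \<noteq> 0" and k: "k \<in> I"
    and S: "\<And>s. s \<in> S \<Longrightarrow> c * s * inverse c = s"
    and fix_gens: "\<And>i. \<lbrakk>i \<in> I; i \<noteq> k\<rbrakk> \<Longrightarrow> c * x i * inverse c = x i \<and> c * y i * inverse c = y i \<and> c * \<xi> i * inverse c = \<xi> i"
    and x': "c * y k * inverse c = x'" and y': "c * x k * inverse c = y'"
    and xi: "\<xi> k \<in> {x' * y', y' * x'}" and xi_conj: "c * \<xi> k * inverse c \<in> {x' * y', y' * x'}"
  shows "(\<lambda>a. c * a * inverse c) \<in> ring_iso
      (sub_ring (generate_ring DD (S \<union> \<xi> ` I \<union> x ` I \<union> y ` I)))
      (sub_ring (generate_ring DD (S \<union> \<xi> ` I \<union> (x(k := x')) ` I \<union> (y(k := y')) ` I)))"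
    (is "_ \<in> ring_iso (sub_ring (generate_ring DD ?H)) (sub_ring (generate_ring DD ?H'))")
proof (rule conj_generated_ring_iso[OF c])
  note g = generate_ring_subring[of ?H] and g' = generate_ring_subring[of ?H']
  have in': "h \<in> generate_ring DD ?H'" if "h \<in> ?H'" for h using that by (rule generate_ring.incl)
  have in1: "h \<in> generate_ring DD ?H" if "h \<in> ?H" for h using that by (rule generate_ring.incl)
  have x'_in: "x' \<in> generate_ring DD ?H'" by (rule in') (use k in force)
  have y'_in: "y' \<in> generate_ring DD ?H'" by (rule in') (use k in force)
  have fx: "(x(k := x')) i \<in> ?H'" "(y(k := y')) i \<in> ?H'" "\<xi> i \<in> ?H'" if "i \<in> I" for i using that by blast+
  show "c * h * inverse c \<in> generate_ring DD ?H'" if h: "h \<in> ?H" for h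
  proof -
    consider "h \<in> S" | i where "i \<in> I" "h = \<xi> i" | i where "i \<in> I" "h = x i" | i where "i \<in> I" "h = y i"
      using h by (elim UnE imageE) blast+
    then show ?thesis
    proof cases
      case 1
      then show ?thesis using S in' by simp
    next
      case 2
      show ?thesis
      proof (cases "i = k")
        case True
        then show ?thesis using xi_conj 2 x'_in y'_in subringD(6)[OF g'] by auto
      next
        case False
        then show ?thesis using fix_gens[OF 2(1) False] in'[OF fx(3)[OF 2(1)]] 2 by simp
      qed
    next
      case 3
      show ?thesis
      proof (cases "i = k")
        case True
        then show ?thesis using y' y'_in 3 by simp
      next
        case False
        then show ?thesis using fix_gens[OF 3(1) False] in'[OF fx(1)[OF 3(1)]] 3 by simp
      qed
    next
      case 4
      show ?thesis
      proof (cases "i = k")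
        case True
        then show ?thesis using x' x'_in 4 by simp
      next
        case False
        then show ?thesis using fix_gens[OF 4(1) False] in'[OF fx(2)[OF 4(1)]] 4 by simp
      qed
    qed
  qed
  have ex: "\<exists>g\<in>generate_ring DD ?H. h = c * g * inverse c" if "g \<in> generate_ring DD ?H" "c * g * inverse c = h" for g h
    using that by blast
  have gx: "x i \<in> generate_ring DD ?H" "y i \<in> generate_ring DD ?H" "\<xi> i \<in> generate_ring DD ?H" if "i \<in> I" for i
    using that by (intro in1; blast)+
  have conj_mult: "c * (a * b) * inverse c = (c * a * inverse c) * (c * b * inverse c)" for a b
    using c by (simp add: mult.assoc inverse_cancel)
  show "\<exists>g\<in>generate_ring DD ?H. h = c * g * inverse c" if h: "h \<in> ?H'" for h
  proof -
    consider "h \<in> S" | i where "i \<in> I" "h = \<xi> i" | i where "i \<in> I" "h = (x(k := x')) i" | i where "i \<in> I" "h = (y(k := y')) i"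
      using h by (elim UnE imageE) blast+
    then show ?thesis
    proof cases
      case 1
      then show ?thesis using S in1 by (intro ex[of h]) simp_all
    next
      case 2
      show ?thesis
      proof (cases "i = k")
        case True
        have "c * (y k * x k) * inverse c = x' * y'" "c * (x k * y k) * inverse c = y' * x'"
          unfolding conj_mult x' y' by simp_all
        then show ?thesis
          using xi 2 True ex[of "y k * x k" "x' * y'"] ex[of "x k * y k" "y' * x'"] gx[OF k] subringD(6)[OF g] by auto
      next
        case False
        then show ?thesis using fix_gens[OF 2(1) False] gx[OF 2(1)] 2 by (intro ex[of "\<xi> i"]) simp_all
      qed
    next
      case 3
      show ?thesis
      proof (cases "i = k")
        case True
        then show ?thesis using x' gx[OF k] 3 by (intro ex[of "y k"]) simp_all
      next
        case False
        then show ?thesis using fix_gens[OF 3(1) False] gx[OF 3(1)] 3 by (intro ex[of "x i"]) simp_all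
      qed
    next
      case 4
      show ?thesis
      proof (cases "i = k")
        case True
        then show ?thesis using y' gx[OF k] 4 by (intro ex[of "x k"]) simp_all
      next
        case False
        then show ?thesis using fix_gens[OF 4(1) False] gx[OF 4(1)] 4 by (intro ex[of "y i"]) simp_all
      qed
    qed
  qed
qed

lemma exchange_poly_mut [simp]:
  "exchange_poly \<iota> (mut_R \<iota> k q) = exchange_poly \<iota> q" "exchange_poly \<iota> (mut_L \<iota> k q) = exchange_poly \<iota> q"
  by (rule ext; simp add: exchange_poly_def mut_R_def mut_L_def Let_def rev_quiver_def add.commute)+

lemma mut_simps [simp]:
  "dirs (mut_R \<iota> k q) = dirs q" "frozen (mut_R \<iota> k q) = frozen q"
  "exch (mut_R \<iota> k q) = (exch q)(k := exchange_poly \<iota> q k * inverse (exch q k))"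
  "dirs (mut_L \<iota> k q) = dirs q" "frozen (mut_L \<iota> k q) = frozen q"
  "exch (mut_L \<iota> k q) = (exch q)(k := inverse (exch q k) * exchange_poly \<iota> q k)"
  by (simp_all add: mut_R_def mut_L_def)

lemma exchange_ring_mut [simp]:
  "exchange_ring \<iota> (mut_R \<iota> k q) = exchange_ring \<iota> q" "exchange_ring \<iota> (mut_L \<iota> k q) = exchange_ring \<iota> q"
  by (simp_all add: exchange_ring_def)

lemma H_alg_generators:
  fixes \<iota> :: "('f, 'k::field_char_0) gring \<Rightarrow> 'd::division_ring"
  shows "H_alg \<mu> \<iota> q = generate_ring DD (range (scalar \<iota>) \<union> exchange_poly \<iota> q ` dirs q \<union> exch q ` dirs q
     \<union> (\<lambda>i. exch (\<mu> i q) i) ` dirs q)"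
proof -
  have sub: "generate_ring DD A \<subseteq> generate_ring DD (A \<union> B)" for A B :: "'d set"
    by (intro generate_ring_mono) (auto intro: generate_ring.incl)
  show ?thesis
    unfolding H_alg_def exchange_ring_def
  proof (intro subset_antisym generate_ring_mono)
    show "range (scalar \<iota>) \<union> exchange_poly \<iota> q ` dirs q \<union> exch q ` dirs q \<union> (\<lambda>i. exch (\<mu> i q) i) ` dirs q
      \<subseteq> generate_ring DD (generate_ring DD (range (scalar \<iota>) \<union> exchange_poly \<iota> q ` dirs q) \<union>
           exch q ` dirs q \<union> (\<lambda>i. exch (\<mu> i q) i) ` dirs q)"
      by (auto intro!: generate_ring.incl)
    show "generate_ring DD (range (scalar \<iota>) \<union> exchange_poly \<iota> q ` dirs q) \<union> exch q ` dirs q \<union> (\<lambda>i. exch (\<mu> i q) i) ` dirs q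
      \<subseteq> generate_ring DD (range (scalar \<iota>) \<union> exchange_poly \<iota> q ` dirs q \<union> exch q ` dirs q \<union> (\<lambda>i. exch (\<mu> i q) i) ` dirs q)"
      using sub[of "range (scalar \<iota>) \<union> exchange_poly \<iota> q ` dirs q" "exch q ` dirs q \<union> (\<lambda>i. exch (\<mu> i q) i) ` dirs q"]
      by (auto simp: Un_assoc intro: generate_ring.incl)
  qed
qed

context weyl_preseed
begin

lemma conj_fixes:
  fixes c z :: 'd
  assumes "c \<noteq> 0" "z * c = c * z"
  shows "c * z * inverse c = z"
  using assms by (simp add: assms(2)[symmetric] mult.assoc)

lemma other_direction_comm:
  assumes "i \<in> I" "k \<in> I" "i \<noteq> k"
  shows "{x i, \<xi> i} \<subseteq> centralizer {x k, \<xi> k}"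
proof -
  have "\<xi> i * \<xi> k = \<xi> k * \<xi> i" by (rule C_comm[OF xi_C[OF assms(1)] xi_C[OF assms(2)]])
  then show ?thesis
    using x_comm[OF assms(1,2)] x_xi_comm[OF assms] x_xi_comm[OF assms(2,1)] assms(3)
    by (simp add: centralizer_def)
qed

lemma other_direction_conj:
  assumes ik: "i \<in> I" "k \<in> I" "i \<noteq> k" and c: "c \<noteq> 0" "c \<in> {\<xi> k * inverse (x k), inverse (inverse (x k) * \<xi> k)}"
    and z: "z \<in> {x i, \<xi> i, \<xi> i * inverse (x i), inverse (x i) * \<xi> i}"
  shows "c * z * inverse c = z"
proof (rule conj_fixes[OF c(1)])
  note cs = centralizer_subring and inv = centralizer_inverse
  have z1: "z \<in> centralizer {x k, \<xi> k}"
    using z other_direction_comm[OF ik] by (auto intro!: subringD(6)[OF cs] inv)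
  then have "x k \<in> centralizer {z}" "\<xi> k \<in> centralizer {z}"
    by (simp_all add: centralizer_def)
  then have "c \<in> centralizer {z}"
    using c(2) by (auto intro!: subringD(6)[OF cs] inv)
  then show "z * c = c * z" by (simp add: centralizer_def)
qed

text \<open>
  Conjugation by \<open>y = \<xi> k * (x k)\<^sup>-\<^sup>1\<close> fixes \<open>y\<close> and takes \<open>x k\<close> to \<open>\<xi> k * y\<^sup>-\<^sup>1\<close>, which is the exchange variable after two mutations.
\<close>

lemma induced_iso_R:
  assumes k: "k \<in> I"
  shows "\<exists>\<psi>. induced_iso (mut_R \<iota>) \<iota> p k \<psi>"
proof -
  let ?y = "\<lambda>i. \<xi> i * inverse (x i)"
  define c where "c = ?y k"
  have x0: "x k \<noteq> 0" and xi0: "\<xi> k \<noteq> 0" and c0: "c \<noteq> 0"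
    using x_nonzero[OF k] xi_nonzero[OF k] by (simp_all add: c_def)
  have other: "c * z * inverse c = z" if "i \<in> I" "i \<noteq> k" "z \<in> {x i, \<xi> i, ?y i}" for i z
    by (rule other_direction_conj[OF that(1) k that(2) c0]) (use that c_def in auto)
  have oth: "c * x i * inverse c = x i" "c * ?y i * inverse c = ?y i" "c * \<xi> i * inverse c = \<xi> i"
    if "i \<in> I" "i \<noteq> k" for i using other[OF that] by simp_all
  have cx: "c * x k * inverse c = \<xi> k * inverse c"
    using x0 by (simp add: c_def mult.assoc)
  have cy: "c * ?y k * inverse c = c" using c0 by (simp add: c_def[symmetric] mult.assoc)
  have sc: "c * scalar \<iota> a * inverse c = scalar \<iota> a" for a
    by (rule conj_fixes[OF c0 scalar_central])
  have "(\<lambda>a. c * a * inverse c) \<in> ring_iso (sub_ring (H_alg (mut_R \<iota>) \<iota> p)) (sub_ring (H_alg (mut_R \<iota>) \<iota> (mut_R \<iota> k p)))"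
  proof -
    have y': "(\<lambda>i. exch (mut_R \<iota> i (mut_R \<iota> k p)) i) = ?y(k := \<xi> k * inverse c)"
      by (rule ext) (simp add: c_def)
    have "(\<lambda>a. c * a * inverse c) \<in> ring_iso
      (sub_ring (generate_ring DD (range (scalar \<iota>) \<union> \<xi> ` I \<union> x ` I \<union> ?y ` I)))
      (sub_ring (generate_ring DD (range (scalar \<iota>) \<union> \<xi> ` I \<union> (x(k := c)) ` I \<union> (?y(k := \<xi> k * inverse c)) ` I)))"
    proof (rule conj_exchange_iso[OF c0 k])
      show "\<xi> k \<in> {c * (\<xi> k * inverse c), \<xi> k * inverse c * c}" using c0 by (simp add: mult.assoc)
      show "c * \<xi> k * inverse c \<in> {c * (\<xi> k * inverse c), \<xi> k * inverse c * c}" by (simp add: mult.assoc)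
    qed (use oth cx cy sc in auto)
    then show ?thesis
      unfolding H_alg_generators y' by (simp add: c_def)
  qed
  then have "induced_iso (mut_R \<iota>) \<iota> p k (\<lambda>a. c * a * inverse c)"
    unfolding induced_iso_def using sc cx cy oth by (simp add: c_def[symmetric])
  then show ?thesis by blast
qed

text \<open>
  Mirror image of the right mutation: conjugation by the inverse of \<open>y = (x k)\<^sup>-\<^sup>1 * \<xi> k\<close> fixes \<open>y\<close> and takes \<open>x k\<close> to \<open>y\<^sup>-\<^sup>1 * \<xi> k\<close>.
\<close>

lemma induced_iso_L:
  assumes k: "k \<in> I"
  shows "\<exists>\<psi>. induced_iso (mut_L \<iota>) \<iota> p k \<psi>"
proof -
  let ?y = "\<lambda>i. inverse (x i) * \<xi> i"
  define c where "c = inverse (?y k)"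
  have x0: "x k \<noteq> 0" and xi0: "\<xi> k \<noteq> 0" and c0: "c \<noteq> 0"
    using x_nonzero[OF k] xi_nonzero[OF k] by (simp_all add: c_def)
  have ic: "inverse c = ?y k" by (simp add: c_def)
  have other: "c * z * inverse c = z" if "i \<in> I" "i \<noteq> k" "z \<in> {x i, \<xi> i, ?y i}" for i z
    by (rule other_direction_conj[OF that(1) k that(2) c0]) (use that c_def in auto)
  have oth: "c * x i * inverse c = x i" "c * ?y i * inverse c = ?y i" "c * \<xi> i * inverse c = \<xi> i"
    if "i \<in> I" "i \<noteq> k" for i using other[OF that] by simp_all
  have cx: "c * x k * inverse c = c * \<xi> k"
    using x0 by (simp add: ic mult.assoc inverse_cancel)
  have cy: "c * ?y k * inverse c = inverse c" using c0 by (simp add: ic[symmetric])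
  have sc: "c * scalar \<iota> a * inverse c = scalar \<iota> a" for a
    by (rule conj_fixes[OF c0 scalar_central])
  have "(\<lambda>a. c * a * inverse c) \<in> ring_iso (sub_ring (H_alg (mut_L \<iota>) \<iota> p)) (sub_ring (H_alg (mut_L \<iota>) \<iota> (mut_L \<iota> k p)))"
  proof -
    have y': "(\<lambda>i. exch (mut_L \<iota> i (mut_L \<iota> k p)) i) = ?y(k := c * \<xi> k)"
      by (rule ext) (simp add: c_def)
    have "(\<lambda>a. c * a * inverse c) \<in> ring_iso
      (sub_ring (generate_ring DD (range (scalar \<iota>) \<union> \<xi> ` I \<union> x ` I \<union> ?y ` I)))
      (sub_ring (generate_ring DD (range (scalar \<iota>) \<union> \<xi> ` I \<union> (x(k := inverse c)) ` I \<union> (?y(k := c * \<xi> k)) ` I)))"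
    proof (rule conj_exchange_iso[OF c0 k])
      show "\<xi> k \<in> {inverse c * (c * \<xi> k), c * \<xi> k * inverse c}" using c0 by (simp add: inverse_cancel)
    qed (use oth cx cy sc in auto)
    then show ?thesis
      unfolding H_alg_generators y' by (simp add: ic)
  qed
  then have "induced_iso (mut_L \<iota>) \<iota> p k (\<lambda>a. c * a * inverse c)"
    unfolding induced_iso_def using sc cx cy oth by (simp add: c_def[symmetric] ic[symmetric])
  then show ?thesis by blast
qed

section \<open>The algebras generated by one step mutations are generalized Weyl algebras\<close>

abbreviation "ER \<equiv> exchange_ring \<iota> p"

lemma ER_C: "ER \<subseteq> C"
  unfolding exchange_ring_def
  by (rule generate_ring_least[OF C_subring]) (auto intro: scalar_coeffs xi_C)

text \<open>
  For \<open>j \<noteq> i\<close> the datum of a generalized Weyl algebra forces \<open>\<theta> i\<close> to fix \<open>\<xi> j\<close>, as conjugation by \<open>x i\<close> does.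
\<close>

lemma theta_ER:
  assumes datum: "gwa_datum ER I \<theta> \<xi>" and sc: "\<And>i c. i \<in> I \<Longrightarrow> \<theta> i (scalar \<iota> c) = scalar \<iota> c"
    and i: "i \<in> I" and r: "r \<in> ER"
  shows "x i * r = \<theta> i r * x i"
proof -
  have "ER \<subseteq> {z. x i * z = \<theta> i z * x i}"
    unfolding exchange_ring_def
  proof (rule generate_ring_least[OF theta_agree_subring[OF i]])
    have "x i * \<xi> j = \<theta> i (\<xi> j) * x i" if j: "j \<in> I" for j
    proof (cases "j = i")
      case False
      then have "\<theta> i (\<xi> j) = \<xi> j" using datum i j by (simp add: gwa_datum_def)
      then show ?thesis using x_xi_comm[OF i j] False by simp
    qed (simp add: theta_xi[OF i])
    moreover have "x i * scalar \<iota> c = \<theta> i (scalar \<iota> c) * x i" for c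
      using sc[OF i] scalar_central[of c "x i"] by simp
    ultimately show "range (scalar \<iota>) \<union> \<xi> ` dirs p \<subseteq> {z. x i * z = \<theta> i z * x i}" by auto
  qed
  then show ?thesis using r by blast
qed

text \<open>
  Up to units \<open>a i\<close> of the fraction field of the coefficient ring, every choice of generators is \<open>x i\<close>
  with the automorphism \<open>\<theta> i\<close>, or \<open>(x i)\<^sup>-\<^sup>1\<close> with its inverse.
\<close>

lemma is_gwa_rescaled:
  assumes datum: "gwa_datum ER I \<theta> \<xi>" and sc: "\<And>i c. i \<in> I \<Longrightarrow> \<theta> i (scalar \<iota> c) = scalar \<iota> c"
    and a: "\<And>i. i \<in> I \<Longrightarrow> a i \<in> Q \<and> a i \<noteq> 0"
    and a_comm: "\<And>i j. \<lbrakk>i \<in> I; j \<in> I; i \<noteq> j\<rbrakk> \<Longrightarrow> a i * x j = x j * a i"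
    and gx: "\<And>i. i \<in> I \<Longrightarrow> (gx i = a i * x i \<and> \<tau> i = \<theta> i) \<or> (gx i = a i * inverse (x i) \<and> \<tau> i = inv_into UNIV (\<theta> i))"
    and gy: "\<And>i. i \<in> I \<Longrightarrow> gy i = inverse (gx i) * \<xi> i"
  shows "is_gwa (generate_ring DD (ER \<union> gx ` I \<union> gy ` I)) ER I \<tau> \<xi> gx gy"
proof -
  have bij: "bij_betw (\<theta> i) ER ER" and iso: "\<theta> i \<in> ring_iso (sub_ring ER) (sub_ring ER)" if "i \<in> I" for i
    using datum that by (simp_all add: gwa_datum_def ring_iso_def)
  have sub: "subring ER DD" using datum by (simp add: gwa_datum_def subcring_def)
  have inv_eq: "inv_into UNIV (\<theta> i) r = inv_into ER (\<theta> i) r" if "i \<in> I" "r \<in> ER" for i r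
    using inv_f_f[OF bij_is_inj[OF theta_bij[OF that(1)]]] bij_betw_inv_into_right[OF bij[OF that(1)] that(2)] by metis
  have inv_ER: "inv_into UNIV (\<theta> i) r \<in> ER" if "i \<in> I" "r \<in> ER" for i r
    using bij_betwE[OF bij_betw_inv_into[OF bij[OF that(1)]]] that(2) inv_eq[OF that] by simp
  have th_inv: "\<theta> i (inv_into UNIV (\<theta> i) r) = r" if "i \<in> I" for i r
    by (rule surj_f_inv_f[OF bij_is_surj[OF theta_bij[OF that]]])
  have inv_iso: "inv_into UNIV (\<theta> i) \<in> ring_iso (sub_ring ER) (sub_ring ER)" if i: "i \<in> I" for i
  proof -
    have I1: "inv_into ER (\<theta> i) \<in> ring_iso (sub_ring ER) (sub_ring ER)"
      using ring_iso_set_sym[OF sub_ring_ring[OF sub] iso[OF i]] by simp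
    have "bij_betw (inv_into UNIV (\<theta> i)) ER ER"
      using bij_betw_cong[of ER "inv_into UNIV (\<theta> i)" "inv_into ER (\<theta> i)" ER] inv_eq[OF i] bij_betw_inv_into[OF bij[OF i]] by blast
    then show ?thesis
      using I1 inv_eq[OF i] inv_ER[OF i] subringD(1,4,6)[OF sub] unfolding ring_iso_sub_ring_iff by simp
  qed
  have tau_xi: "\<tau> i (\<xi> j) = \<xi> j" if ij: "i \<in> I" "j \<in> I" "i \<noteq> j" for i j
  proof -
    have "\<theta> i (\<xi> j) = \<xi> j" using datum ij by (simp add: gwa_datum_def)
    then show ?thesis using gx[OF ij(1)] inv_f_f[OF bij_is_inj[OF theta_bij[OF ij(1)]], of "\<xi> j"] by auto
  qed
  have tau_iso: "\<tau> i \<in> ring_iso (sub_ring ER) (sub_ring ER)" if "i \<in> I" for i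
    using gx[OF that] iso[OF that] inv_iso[OF that] by auto
  have datum': "gwa_datum ER I \<tau> \<xi>"
    using datum tau_xi tau_iso by (simp add: gwa_datum_def)
  have gx0: "gx i \<noteq> 0" if "i \<in> I" for i using gx[OF that] a[OF that] x_nonzero[OF that] by auto
  have ER_Q: "r \<in> Q" if "r \<in> ER" for r using that ER_C C_Q by blast
  have coef: "gx i * r = \<tau> i r * gx i" if i: "i \<in> I" and r: "r \<in> ER" for i r
  proof -
    have tr: "\<tau> i r \<in> ER" using tau_iso[OF i] r by (auto simp: ring_iso_sub_ring_iff)
    have shift: "a i * (\<tau> i r * m) = \<tau> i r * (a i * m)" for m
      using Q_comm[OF _ ER_Q[OF tr], of "a i"] a[OF i] by (simp add: mult.assoc[symmetric])
    from gx[OF i] show ?thesis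
    proof (elim disjE conjE)
      assume g: "gx i = a i * x i" "\<tau> i = \<theta> i"
      show ?thesis
        using shift[of "x i"] theta_ER[OF datum sc i r] by (simp add: g mult.assoc)
    next
      assume g: "gx i = a i * inverse (x i)" "\<tau> i = inv_into UNIV (\<theta> i)"
      have "x i * \<tau> i r = r * x i"
        using theta_ER[OF datum sc i tr] th_inv[OF i] by (simp add: g)
      then have "inverse (x i) * (x i * \<tau> i r) * inverse (x i) = inverse (x i) * (r * x i) * inverse (x i)" by simp
      then have "\<tau> i r * inverse (x i) = inverse (x i) * r"
        using x_nonzero[OF i] by (simp add: mult.assoc inverse_cancel)
      then show ?thesis using shift[of "inverse (x i)"] by (simp add: g(1) mult.assoc)
    qed
  qed
  have comm: "gx i * gx j = gx j * gx i" if ij: "i \<in> I" "j \<in> I" for i j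
  proof (cases "i = j")
    case False
    note cs = subringD(6)[OF centralizer_subring] and inv = centralizer_inverse
    have "x j \<in> centralizer {a i, x i}" "a j \<in> centralizer {a i, x i}"
      using a_comm[OF ij False] a_comm[OF ij(2,1)] False x_comm[OF ij] Q_comm[of "a i" "a j"] a[OF ij(1)] a[OF ij(2)]
      by (simp_all add: centralizer_def)
    then have "gx j \<in> centralizer {a i, x i}" using gx[OF ij(2)] by (auto intro!: cs inv)
    then have "a i \<in> centralizer {gx j}" "x i \<in> centralizer {gx j}" by (simp_all add: centralizer_def)
    then have "gx i \<in> centralizer {gx j}" using gx[OF ij(1)] by (auto intro!: cs inv)
    then show ?thesis by (simp add: centralizer_def)
  qed simp
  define \<epsilon> where "\<epsilon> i = (if gx i = a i * x i then 1 else - 1 :: int)" for i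
  have "laurent_independent Q I gx"
  proof (rule laurent_independent_rescale[OF Q_subring Q_inverse x_normalizer_Q x_indep_Q a])
    show "\<epsilon> i = 1 \<or> \<epsilon> i = - 1" for i by (simp add: \<epsilon>_def)
    show "gx i = a i * x i powi \<epsilon> i" if "i \<in> I" for i using gx[OF that] by (auto simp: \<epsilon>_def)
  qed
  then have indep: "laurent_independent ER I gx"
    by (rule laurent_independent_mono) (use ER_Q in blast)
  interpret gwa_realization ER I \<tau> \<xi> gx gy
    by unfold_locales (use datum' xi_nonzero gx0 coef comm gy indep in auto)
  show ?thesis by (rule generated_ring_is_gwa)
qed

lemma conj_Q: "\<lbrakk>i \<in> I; q \<in> Q\<rbrakk> \<Longrightarrow> x i * q * inverse (x i) \<in> Q" "\<lbrakk>i \<in> I; q \<in> Q\<rbrakk> \<Longrightarrow> inverse (x i) * q * x i \<in> Q"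
  using x_normalizer_Q[of i] by (auto simp: normalizer_def)

lemma xi_Q: "i \<in> I \<Longrightarrow> \<xi> i \<in> Q"
  using xi_C C_Q by blast

lemma direction_comm:
  assumes "i \<in> I" "j \<in> I" "i \<noteq> j"
  shows "\<xi> i \<in> centralizer {x j}" "x i \<in> centralizer {x j}"
  using other_direction_comm[OF assms] by (auto simp: centralizer_def)

lemma HR_gwa:
  assumes datum: "gwa_datum ER I \<theta> \<xi>" and sc: "\<And>i c. i \<in> I \<Longrightarrow> \<theta> i (scalar \<iota> c) = scalar \<iota> c" and k: "k \<in> I"
  shows "HR_is_gwa \<iota> p \<theta>" "HR_is_gwa \<iota> (mut_R \<iota> k p) (\<theta>(k := inv_into UNIV (\<theta> k)))"
proof -
  show "HR_is_gwa \<iota> p \<theta>"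
  proof -
    have "is_gwa (generate_ring DD (ER \<union> (\<lambda>i. exch (mut_R \<iota> i p) i) ` I \<union> x ` I)) ER I (\<lambda>i. inv_into UNIV (\<theta> i)) \<xi>
        (\<lambda>i. exch (mut_R \<iota> i p) i) x"
    proof (rule is_gwa_rescaled[OF datum sc, where a = \<xi>])
      show "\<xi> i * x j = x j * \<xi> i" if "i \<in> I" "j \<in> I" "i \<noteq> j" for i j
        using direction_comm(1)[OF that] by (simp add: centralizer_def)
      show "x i = inverse (exch (mut_R \<iota> i p) i) * \<xi> i" if "i \<in> I" for i
        using xi_nonzero[OF that] x_nonzero[OF that] by (simp add: nonzero_inverse_mult_distrib mult.assoc)
    qed (use xi_Q xi_nonzero in auto)
    then show ?thesis
      unfolding HR_is_gwa_def H_alg_def by (simp add: Un_ac)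
  qed
  let ?p = "mut_R \<iota> k p" and ?\<theta> = "\<theta>(k := inv_into UNIV (\<theta> k))"
  show "HR_is_gwa \<iota> ?p ?\<theta>"
  proof -
    \<comment> \<open>In direction \<open>k\<close> the first generator is \<open>\<xi> x \<xi>\<^sup>-\<^sup>1 = \<xi> (x \<xi>\<^sup>-\<^sup>1 x\<^sup>-\<^sup>1) x\<close>.\<close>
    define a where "a = \<xi>(k := \<xi> k * (x k * inverse (\<xi> k) * inverse (x k)))"
    have "is_gwa (generate_ring DD (ER \<union> (\<lambda>i. exch (mut_R \<iota> i ?p) i) ` I \<union> exch ?p ` I)) ER I (\<lambda>i. inv_into UNIV (?\<theta> i)) \<xi>
        (\<lambda>i. exch (mut_R \<iota> i ?p) i) (exch ?p)"
    proof (rule is_gwa_rescaled[OF datum sc, where a = a])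
      show "a i \<in> Q \<and> a i \<noteq> 0" if "i \<in> I" for i
        using that xi_Q xi_nonzero x_nonzero k conj_Q(1)[OF k Q_inverse[OF xi_Q[OF k]]]
        by (auto simp: a_def intro!: subringD(6)[OF Q_subring])
      show "a i * x j = x j * a i" if "i \<in> I" "j \<in> I" "i \<noteq> j" for i j
      proof -
        have "a i \<in> centralizer {x j}"
          using direction_comm[OF that]
          by (auto simp: a_def intro!: subringD(6)[OF centralizer_subring] centralizer_inverse)
        then show ?thesis by (simp add: centralizer_def)
      qed
      show "(exch (mut_R \<iota> i ?p) i = a i * x i \<and> inv_into UNIV (?\<theta> i) = \<theta> i) \<or>
          (exch (mut_R \<iota> i ?p) i = a i * inverse (x i) \<and> inv_into UNIV (?\<theta> i) = inv_into UNIV (\<theta> i))" if "i \<in> I" for i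
        using that x_nonzero[OF k] xi_nonzero[OF k] inv_inv_eq[OF theta_bij[OF k]]
        by (simp add: a_def nonzero_inverse_mult_distrib mult.assoc)
      show "exch ?p i = inverse (exch (mut_R \<iota> i ?p) i) * \<xi> i" if "i \<in> I" for i
      proof -
        have "exch ?p i \<noteq> 0" using x_nonzero[OF that] x_nonzero[OF k] xi_nonzero[OF k] by simp
        moreover have "exch (mut_R \<iota> i ?p) i = \<xi> i * inverse (exch ?p i)"
          by (simp only: mut_simps exchange_poly_mut fun_upd_same)
        ultimately show ?thesis
          using xi_nonzero[OF that] by (simp only: nonzero_inverse_mult_distrib nonzero_inverse_inverse_eq
            inverse_nonzero_iff_nonzero mult.assoc left_inverse mult_1_right not_False_eq_True)
      qed
    qed
    then show ?thesis
      unfolding HR_is_gwa_def H_alg_def by (simp add: Un_ac del: mut_simps(3) fun_upd_apply)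
  qed
qed

lemma HL_gwa:
  assumes datum: "gwa_datum ER I \<theta> \<xi>" and sc: "\<And>i c. i \<in> I \<Longrightarrow> \<theta> i (scalar \<iota> c) = scalar \<iota> c" and k: "k \<in> I"
  shows "HL_is_gwa \<iota> p \<theta>" "HL_is_gwa \<iota> (mut_L \<iota> k p) (\<theta>(k := inv_into UNIV (\<theta> k)))"
proof -
  show "HL_is_gwa \<iota> p \<theta>"
  proof -
    have "is_gwa (generate_ring DD (ER \<union> x ` I \<union> (\<lambda>i. exch (mut_L \<iota> i p) i) ` I)) ER I \<theta> \<xi>
        x (\<lambda>i. exch (mut_L \<iota> i p) i)"
      by (rule is_gwa_rescaled[OF datum sc, where a = "\<lambda>_. 1"]) (use subringD(1)[OF Q_subring] in auto)
    then show ?thesis unfolding HL_is_gwa_def H_alg_def by simp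
  qed
  let ?p = "mut_L \<iota> k p" and ?\<theta> = "\<theta>(k := inv_into UNIV (\<theta> k))"
  show "HL_is_gwa \<iota> ?p ?\<theta>"
  proof -
    \<comment> \<open>In direction \<open>k\<close> the first generator is \<open>x\<^sup>-\<^sup>1 \<xi> = (x\<^sup>-\<^sup>1 \<xi> x) x\<^sup>-\<^sup>1\<close>.\<close>
    define a where "a = (\<lambda>_. 1)(k := inverse (x k) * \<xi> k * x k)"
    have "is_gwa (generate_ring DD (ER \<union> exch ?p ` I \<union> (\<lambda>i. exch (mut_L \<iota> i ?p) i) ` I)) ER I ?\<theta> \<xi>
        (exch ?p) (\<lambda>i. exch (mut_L \<iota> i ?p) i)"
    proof (rule is_gwa_rescaled[OF datum sc, where a = a])
      show "a i \<in> Q \<and> a i \<noteq> 0" if "i \<in> I" for i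
        using xi_nonzero[OF k] x_nonzero[OF k] conj_Q(2)[OF k xi_Q[OF k]] subringD(1)[OF Q_subring]
        by (simp add: a_def)
      show "a i * x j = x j * a i" if "i \<in> I" "j \<in> I" "i \<noteq> j" for i j
      proof -
        have "a i \<in> centralizer {x j}"
          using direction_comm[OF that]
          by (auto simp: a_def intro!: subringD(1,6)[OF centralizer_subring] centralizer_inverse)
        then show ?thesis by (simp add: centralizer_def)
      qed
      show "(exch ?p i = a i * x i \<and> ?\<theta> i = \<theta> i) \<or>
          (exch ?p i = a i * inverse (x i) \<and> ?\<theta> i = inv_into UNIV (\<theta> i))" if "i \<in> I" for i
        using x_nonzero[OF k] by (simp add: a_def mult.assoc)
      show "exch (mut_L \<iota> i ?p) i = inverse (exch ?p i) * \<xi> i" for i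
        by (simp only: mut_simps exchange_poly_mut fun_upd_same)
    qed
    then show ?thesis
      unfolding HL_is_gwa_def H_alg_def by (simp del: mut_simps(6) fun_upd_apply)
  qed
qed

section \<open>Cluster variables and Laurent polynomials\<close>

text \<open>
  Both mutations replace an exchange variable by a product of its inverse and its exchange polynomial, and the
  exchange polynomials never change.
\<close>

lemma mutation_class_invariant:
  assumes q: "q \<in> mutation_class \<iota> p'" and P: "\<And>i. i \<in> dirs p' \<Longrightarrow> subring (P i) DD"
    and init: "\<And>i. i \<in> dirs p' \<Longrightarrow> {exch p' i, inverse (exch p' i), exchange_poly \<iota> p' i, inverse (exchange_poly \<iota> p' i)} \<subseteq> P i"
    and nz: "\<And>i. i \<in> dirs p' \<Longrightarrow> exchange_poly \<iota> p' i \<noteq> 0 \<and> exch p' i \<noteq> 0"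
  shows "dirs q = dirs p' \<and> exchange_poly \<iota> q = exchange_poly \<iota> p' \<and>
    (\<forall>i\<in>dirs p'. exch q i \<noteq> 0 \<and> exch q i \<in> P i \<and> inverse (exch q i) \<in> P i)"
  using q
proof induction
  case init
  then show ?case using assms(3) nz by auto
next
  case (right q k)
  then have k: "k \<in> dirs p'" by simp
  have "exchange_poly \<iota> p' k * inverse (exch q k) \<in> P k" "inverse (exchange_poly \<iota> p' k * inverse (exch q k)) \<in> P k"
    using right nz[OF k] init[OF k] k by (auto simp: nonzero_inverse_mult_distrib intro!: subringD(6)[OF P[OF k]])
  then show ?case using right nz k by auto
next
  case (left q k)
  then have k: "k \<in> dirs p'" by simp
  have "inverse (exch q k) * exchange_poly \<iota> p' k \<in> P k" "inverse (inverse (exch q k) * exchange_poly \<iota> p' k) \<in> P k"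
    using left nz[OF k] init[OF k] k by (auto simp: nonzero_inverse_mult_distrib intro!: subringD(6)[OF P[OF k]])
  then show ?case using left nz k by auto
qed

text \<open>
  The additional generators of the coefficients are conjugates of \<open>(\<xi> i)\<^sup>-\<^sup>1\<close> by \<open>x i\<close> or its inverse.
\<close>

lemma laurent_coeff_ring_Q: "laurent_coeff_ring \<iota> p \<theta> \<subseteq> Q"
  unfolding laurent_coeff_ring_def
proof (rule generate_ring_least[OF Q_subring])
  have "\<theta> i (inverse (\<xi> i)) \<in> Q" "inv_into UNIV (\<theta> i) (inverse (\<xi> i)) \<in> Q" if i: "i \<in> I" for i
  proof -
    have inv: "\<tau> (inverse (\<xi> i)) = inverse (\<tau> (\<xi> i))" if "\<tau> \<in> ring_iso DD DD" for \<tau> :: "'d \<Rightarrow> 'd"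
    proof -
      have "\<tau> (inverse (\<xi> i)) * \<tau> (\<xi> i) = 1"
        using that xi_nonzero[OF i] unfolding ring_iso_def ring_hom_def by simp (metis left_inverse)
      then show ?thesis by (metis inverse_unique inverse_inverse_eq)
    qed
    have "x i * \<xi> i * inverse (x i) = \<theta> i (\<xi> i)"
      unfolding theta_xi[OF i] using x_nonzero[OF i] by (simp add: mult.assoc)
    then have "\<theta> i (\<xi> i) \<in> Q" using conj_Q(1)[OF i xi_Q[OF i]] by simp
    then show "\<theta> i (inverse (\<xi> i)) \<in> Q" unfolding inv[OF weyl_iso[OF i]] by (rule Q_inverse)
    have "inv_into UNIV (\<theta> i) \<in> ring_iso DD DD"
      using ring_iso_set_sym[OF ring_DD weyl_iso[OF i]] by simp
    moreover have "inv_into UNIV (\<theta> i) (\<xi> i) \<in> Q"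
      unfolding inv_theta_xi[OF i] by (rule conj_Q(2)[OF i xi_Q[OF i]])
    ultimately show "inv_into UNIV (\<theta> i) (inverse (\<xi> i)) \<in> Q" using inv Q_inverse by metis
  qed
  then show "coeff_ring \<iota> p \<union> (\<lambda>i. \<theta> i (inverse (\<xi> i))) ` dirs p \<union> (\<lambda>i. inv_into UNIV (\<theta> i) (inverse (\<xi> i))) ` dirs p \<subseteq> Q"
    using C_Q by auto
qed

lemma laurent_coeff_independent: "laurent_independent (laurent_coeff_ring \<iota> p \<theta>) I x"
  by (rule laurent_independent_mono[OF x_indep_Q laurent_coeff_ring_Q])

text \<open>
  The inverse of an exchange polynomial is the conjugate by \<open>x i\<close> of a generator of the coefficients, so all exchange
  variables and exchange polynomials are units of the ring of Laurent polynomials.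
\<close>

lemma weyl_cluster_algebra_laurent:
  "subring (weyl_cluster_algebra \<iota> p) (sub_ring (laurent_ring (laurent_coeff_ring \<iota> p \<theta>) I x))"
proof -
  let ?L = "laurent_ring (laurent_coeff_ring \<iota> p \<theta>) I x"
  have L: "subring ?L DD" unfolding laurent_ring_def by (rule generate_ring_subring)
  have gen: "h \<in> ?L" if "h \<in> laurent_coeff_ring \<iota> p \<theta> \<union> x ` I \<union> (\<lambda>i. inverse (x i)) ` I" for h
    unfolding laurent_ring_def using that by (rule generate_ring.incl)
  have CL: "C \<subseteq> laurent_coeff_ring \<iota> p \<theta>"
    unfolding laurent_coeff_ring_def by (auto intro: generate_ring.incl)
  have xL: "x i \<in> ?L" "inverse (x i) \<in> ?L" if "i \<in> I" for i using gen that by blast+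
  have xiL: "inverse (\<xi> i) \<in> ?L" if i: "i \<in> I" for i
  proof -
    have e: "inv_into UNIV (\<theta> i) (inverse (\<xi> i)) = inverse (x i) * inverse (\<xi> i) * x i"
    proof -
      let ?\<tau> = "inv_into UNIV (\<theta> i)"
      have "?\<tau> \<in> ring_iso DD DD" using ring_iso_set_sym[OF ring_DD weyl_iso[OF i]] by simp
      then have "?\<tau> (inverse (\<xi> i)) * ?\<tau> (\<xi> i) = 1"
        using xi_nonzero[OF i] unfolding ring_iso_def ring_hom_def by simp (metis left_inverse)
      then have "?\<tau> (inverse (\<xi> i)) = inverse (?\<tau> (\<xi> i))" by (metis inverse_unique inverse_inverse_eq)
      then show ?thesis
        unfolding inv_theta_xi[OF i] using x_nonzero[OF i] xi_nonzero[OF i]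
        by (simp add: nonzero_inverse_mult_distrib mult.assoc)
    qed
    have "inv_into UNIV (\<theta> i) (inverse (\<xi> i)) \<in> laurent_coeff_ring \<iota> p \<theta>"
      unfolding laurent_coeff_ring_def using i by (intro generate_ring.incl) auto
    then have "inverse (x i) * inverse (\<xi> i) * x i \<in> ?L" using gen e by simp
    from subringD(6)[OF L subringD(6)[OF L xL(1)[OF i] this] xL(2)[OF i]] show ?thesis using x_nonzero[OF i] by (simp add: mult.assoc inverse_cancel)
  qed
  have "cluster_vars \<iota> p \<subseteq> ?L"
  proof
    fix z assume "z \<in> cluster_vars \<iota> p"
    then obtain q i where q: "q \<in> mutation_class \<iota> p" "i \<in> I" "z = exch q i" by (auto simp: cluster_vars_def)
    have "dirs q = dirs p \<and> exchange_poly \<iota> q = \<xi> \<and> (\<forall>i\<in>dirs p. exch q i \<noteq> 0 \<and> exch q i \<in> ?L \<and> inverse (exch q i) \<in> ?L)"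
    proof (rule mutation_class_invariant[OF q(1) L])
      fix i assume "i \<in> dirs p"
      then have i: "i \<in> I" by simp
      show "\<xi> i \<noteq> 0 \<and> x i \<noteq> 0" using x_nonzero[OF i] xi_nonzero[OF i] by simp
      have "\<xi> i \<in> ?L" using gen CL xi_C[OF i] by blast
      then show "{x i, inverse (x i), \<xi> i, inverse (\<xi> i)} \<subseteq> ?L" using xL[OF i] xiL[OF i] by simp
    qed
    then show "z \<in> ?L" using q by simp
  qed
  moreover have "C \<subseteq> ?L" using CL gen by blast
  ultimately have "weyl_cluster_algebra \<iota> p \<subseteq> ?L"
    unfolding weyl_cluster_algebra_def by (intro generate_ring_least[OF L]) simp
  moreover have "ring (sub_ring ?L \<lparr>carrier := weyl_cluster_algebra \<iota> p\<rparr>)"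
    using sub_ring_ring[OF generate_ring_subring] by (simp add: weyl_cluster_algebra_def)
  ultimately show ?thesis
    using ring.ring_incl_imp_subring[OF sub_ring_ring[OF L]] by simp
qed

end

section \<open>Cluster variables of rank one preseeds\<close>

lemma rank_one_simps [simp]:
  "dirs (rank_one p k) = {k}" "frozen (rank_one p k) = frozen p" "exch (rank_one p k) = exch p"
  "quiv (rank_one p k) = quiv p" "exchange_poly \<iota> (rank_one p k) = exchange_poly \<iota> p"
  by (auto simp: rank_one_def exchange_poly_def)

lemma mutation_class_invariants:
  assumes "q \<in> mutation_class \<iota> p"
  shows "dirs q = dirs p" "exchange_poly \<iota> q = exchange_poly \<iota> p"
  using assms by (induction; simp)+

text \<open>
  A mutation in direction \<open>i\<close> only changes the \<open>i\<close>-th exchange variable, so the cluster variables in direction \<open>k\<close> are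
  those of the rank one preseed.
\<close>

lemma mutation_class_to_rank_one:
  assumes "q \<in> mutation_class \<iota> p"
  shows "\<exists>q'\<in>mutation_class \<iota> (rank_one p k). exch q' k = exch q k"
  using assms
proof induction
  case init
  show ?case by (rule bexI[OF _ mutation_class.init]) simp
next
  case (right q i)
  then obtain q' where q': "q' \<in> mutation_class \<iota> (rank_one p k)" "exch q' k = exch q k" by blast
  show ?case
  proof (cases "i = k")
    case True
    have "mut_R \<iota> k q' \<in> mutation_class \<iota> (rank_one p k)" by (rule mutation_class.right[OF q'(1)]) simp
    then show ?thesis
      by (rule bexI[rotated]) (simp add: True q'(2) mutation_class_invariants(2)[OF q'(1)] mutation_class_invariants(2)[OF right(1)])
  next
    case False
    then show ?thesis using q' by (intro bexI[of _ q']) simp_all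
  qed
next
  case (left q i)
  then obtain q' where q': "q' \<in> mutation_class \<iota> (rank_one p k)" "exch q' k = exch q k" by blast
  show ?case
  proof (cases "i = k")
    case True
    have "mut_L \<iota> k q' \<in> mutation_class \<iota> (rank_one p k)" by (rule mutation_class.left[OF q'(1)]) simp
    then show ?thesis
      by (rule bexI[rotated]) (simp add: True q'(2) mutation_class_invariants(2)[OF q'(1)] mutation_class_invariants(2)[OF left(1)])
  next
    case False
    then show ?thesis using q' by (intro bexI[of _ q']) simp_all
  qed
qed

lemma mutation_class_from_rank_one:
  assumes "q' \<in> mutation_class \<iota> (rank_one p k)" "k \<in> dirs p"
  shows "\<exists>q\<in>mutation_class \<iota> p. exch q k = exch q' k"
  using assms(1)
proof induction
  case init
  show ?case by (rule bexI[OF _ mutation_class.init]) simp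
next
  case (right q' i)
  then have i: "i = k" by simp
  obtain q where q: "q \<in> mutation_class \<iota> p" "exch q k = exch q' k" using right by blast
  show ?case
    by (rule bexI[OF _ mutation_class.right[OF q(1) assms(2)]])
      (simp add: i q(2) mutation_class_invariants(2)[OF q(1)] mutation_class_invariants(2)[OF right(1)])
next
  case (left q' i)
  then have i: "i = k" by simp
  obtain q where q: "q \<in> mutation_class \<iota> p" "exch q k = exch q' k" using left by blast
  show ?case
    by (rule bexI[OF _ mutation_class.left[OF q(1) assms(2)]])
      (simp add: i q(2) mutation_class_invariants(2)[OF q(1)] mutation_class_invariants(2)[OF left(1)])
qed

lemma cluster_vars_rank_one: "cluster_vars \<iota> p = (\<Union>k\<in>dirs p. cluster_vars \<iota> (rank_one p k))"
proof (intro subset_antisym subsetI)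
  fix z assume "z \<in> cluster_vars \<iota> p"
  then obtain q i where q: "q \<in> mutation_class \<iota> p" "i \<in> dirs p" "z = exch q i" by (auto simp: cluster_vars_def)
  obtain q' where "q' \<in> mutation_class \<iota> (rank_one p i)" "exch q' i = exch q i"
    using mutation_class_to_rank_one[OF q(1), of i] by blast
  then have "exch q i \<in> cluster_vars \<iota> (rank_one p i)"
    unfolding cluster_vars_def rank_one_simps by (intro CollectI exI[of _ q'] exI[of _ i]) simp
  then show "z \<in> (\<Union>k\<in>dirs p. cluster_vars \<iota> (rank_one p k))" using q(2,3) by blast
next
  fix z assume "z \<in> (\<Union>k\<in>dirs p. cluster_vars \<iota> (rank_one p k))"
  then obtain k q' where q': "k \<in> dirs p" "q' \<in> mutation_class \<iota> (rank_one p k)" "z = exch q' k" by (auto simp: cluster_vars_def)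
  obtain q where "q \<in> mutation_class \<iota> p" "exch q k = exch q' k"
    using mutation_class_from_rank_one[OF q'(2,1)] by blast
  then show "z \<in> cluster_vars \<iota> p"
    unfolding cluster_vars_def using q'(1,3) by (intro CollectI exI[of _ q] exI[of _ k]) simp
qed

section \<open>Linear disjointness over the ground field\<close>

context weyl_preseed
begin

interpretation V: vector_space "\<lambda>c (z :: 'd). scalar \<iota> c * z"
  by unfold_locales (simp_all add: distrib_left distrib_right scal.scal_add scal.scal_mult mult.assoc)

abbreviation "frozen_monomial m \<equiv> \<iota> (single m 1)"

definition exponents :: "nat set \<Rightarrow> (('f \<Rightarrow>\<^sub>0 int) \<times> (nat \<Rightarrow>\<^sub>0 int)) set"
  where "exponents S = {(m, \<alpha>). keys m \<subseteq> FV S \<and> keys \<alpha> \<subseteq> S}"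

lemma exponents_iff [simp]:
  "(m, \<alpha>) \<in> exponents S \<longleftrightarrow> keys m \<subseteq> FV S \<and> keys \<alpha> \<subseteq> S"
  by (simp add: exponents_def)

lemma exponentsD:
  "a \<in> exponents S \<Longrightarrow> keys (fst a) \<subseteq> FV S" "a \<in> exponents S \<Longrightarrow> keys (snd a) \<subseteq> S"
  by (cases a; simp)+

lemma FV_le: "S \<subseteq> T \<Longrightarrow> K \<subseteq> FV S \<Longrightarrow> K \<subseteq> FV T"
  by blast

lemma keys_add_le: "keys m \<subseteq> K \<Longrightarrow> keys m' \<subseteq> K \<Longrightarrow> keys (m + m') \<subseteq> K"
  by (rule order_trans[OF keys_add]) simp

definition monomial :: "('f \<Rightarrow>\<^sub>0 int) \<times> (nat \<Rightarrow>\<^sub>0 int) \<Rightarrow> 'd"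
  where "monomial a = frozen_monomial (fst a) * laurent_monomial x (snd a)"

definition laurent_span :: "nat set \<Rightarrow> 'd set"
  where "laurent_span S = V.span (monomial ` exponents S)"

text \<open>The localization of \<open>laurent_span S\<close> at the nonzero coefficients, with denominators on the left.\<close>

definition laurent_loc :: "nat set \<Rightarrow> 'd set"
  where "laurent_loc S = {z. \<exists>d\<in>coeffs S. d \<noteq> 0 \<and> d * z \<in> laurent_span S}"

lemma laurent_locE: "z \<in> laurent_loc S \<Longrightarrow> \<exists>d\<in>coeffs S. d \<noteq> 0 \<and> d * z \<in> laurent_span S"
  and laurent_locI: "\<lbrakk>d \<in> coeffs S; d \<noteq> 0; d * z \<in> laurent_span S\<rbrakk> \<Longrightarrow> z \<in> laurent_loc S"
  unfolding laurent_loc_def by blast+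

lemma scalar_pull: "z * (scalar \<iota> c * w) = scalar \<iota> c * (z * w)"
  by (simp only: mult.assoc[symmetric] scalar_central[of c z])

lemma frozen_monomial_group_ring: "\<lbrakk>S \<subseteq> I; keys m \<subseteq> FV S\<rbrakk> \<Longrightarrow> single m c \<in> group_ring (FV I)"
  by (rule group_ring_closed(6)) blast

lemma frozen_monomial_coeffs: "keys m \<subseteq> FV S \<Longrightarrow> frozen_monomial m \<in> coeffs S"
  unfolding coeffs_def by (intro imageI group_ring_closed(6))

lemma frozen_monomial_add: "\<lbrakk>keys m \<subseteq> FV I; keys m' \<subseteq> FV I\<rbrakk> \<Longrightarrow> frozen_monomial (m + m') = frozen_monomial m * frozen_monomial m'"
  using incl_mult[OF frozen_monomial_group_ring[OF subset_refl] frozen_monomial_group_ring[OF subset_refl], of m m' 1 1] by (simp add: mult_single)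

lemma x_monomial_add: "\<lbrakk>keys \<alpha> \<subseteq> I; keys \<beta> \<subseteq> I\<rbrakk> \<Longrightarrow>
    laurent_monomial x (\<alpha> + \<beta>) = laurent_monomial x \<alpha> * laurent_monomial x \<beta>"
  by (rule laurent_monomial_add[of I]) (use x_comm x_nonzero in auto)

lemma x_monomial_coeffs_comm:
  assumes "S \<subseteq> I" "T \<subseteq> I" "S \<inter> T = {}" "keys \<alpha> \<subseteq> S" "c \<in> coeffs T"
  shows "laurent_monomial x \<alpha> * c = c * laurent_monomial x \<alpha>"
proof -
  have "x i \<in> centralizer {c}" if "i \<in> S" for i
  proof -
    have "x i * c = c * x i"
      by (rule x_coeffs_comm[OF _ assms(2) _ assms(5)]) (use that assms in auto)
    then show ?thesis by (simp add: centralizer_def)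
  qed
  then have "laurent_monomial x \<alpha> \<in> centralizer {c}"
    using assms(4) by (intro laurent_monomial_in_subring[OF centralizer_subring]) (blast intro: centralizer_inverse)
  then show ?thesis by (simp add: centralizer_def)
qed

lemma monomial_mult:
  assumes "S \<subseteq> I" "T \<subseteq> I" "S \<inter> T = {}" "a \<in> exponents S" "b \<in> exponents T"
  shows "monomial a * monomial b = monomial (a + b)" "a + b \<in> exponents (S \<union> T)"
proof -
  obtain m \<alpha> m' \<beta> where ab: "a = (m, \<alpha>)" "b = (m', \<beta>)" by (cases a, cases b) blast
  have k: "keys m \<subseteq> FV S" "keys \<alpha> \<subseteq> S" "keys m' \<subseteq> FV T" "keys \<beta> \<subseteq> T"
    using assms(4,5) unfolding ab exponents_iff by simp_all
  have kI: "keys m \<subseteq> FV I" "keys m' \<subseteq> FV I" "keys \<alpha> \<subseteq> I" "keys \<beta> \<subseteq> I"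
    using FV_le[OF assms(1) k(1)] FV_le[OF assms(2) k(3)] order_trans[OF k(2) assms(1)] order_trans[OF k(4) assms(2)]
    by simp_all
  have "monomial a * monomial b = frozen_monomial m * (laurent_monomial x \<alpha> * frozen_monomial m') * laurent_monomial x \<beta>"
    by (simp add: monomial_def ab mult.assoc)
  also have "\<dots> = frozen_monomial m * (frozen_monomial m' * laurent_monomial x \<alpha>) * laurent_monomial x \<beta>"
    by (simp only: x_monomial_coeffs_comm[OF assms(1-3) k(2) frozen_monomial_coeffs[OF k(3)]])
  also have "\<dots> = (frozen_monomial m * frozen_monomial m') * (laurent_monomial x \<alpha> * laurent_monomial x \<beta>)"
    by (simp only: mult.assoc)
  finally show "monomial a * monomial b = monomial (a + b)"
    by (simp add: monomial_def ab frozen_monomial_add[OF kI(1,2)] x_monomial_add[OF kI(3,4)])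
  have "keys (m + m') \<subseteq> FV (S \<union> T)" "keys (\<alpha> + \<beta>) \<subseteq> S \<union> T"
    using FV_le[OF _ k(1), of "S \<union> T"] FV_le[OF _ k(3), of "S \<union> T"] k(2,4) by (simp_all add: keys_add_le le_supI1 le_supI2)
  then show "a + b \<in> exponents (S \<union> T)" by (simp add: ab exponents_def)
qed

lemma exponents_mono:
  assumes "S \<subseteq> T"
  shows "exponents S \<subseteq> exponents T"
proof (rule subsetI)
  fix a assume "a \<in> exponents S"
  moreover obtain m \<alpha> where a: "a = (m, \<alpha>)" by (cases a)
  ultimately show "a \<in> exponents T"
    using FV_le[OF assms, of "keys m"] order_trans[OF _ assms, of "keys \<alpha>"] by simp
qed

lemma monomial_in_span: "a \<in> exponents S \<Longrightarrow> monomial a \<in> laurent_span S"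
  unfolding laurent_span_def by (rule V.span_base) blast

lemma laurent_span_closed:
  "0 \<in> laurent_span S" "\<lbrakk>z \<in> laurent_span S; w \<in> laurent_span S\<rbrakk> \<Longrightarrow> z + w \<in> laurent_span S"
  "z \<in> laurent_span S \<Longrightarrow> scalar \<iota> c * z \<in> laurent_span S" "z \<in> laurent_span S \<Longrightarrow> - z \<in> laurent_span S"
  "(\<And>i. i \<in> A \<Longrightarrow> f i \<in> laurent_span S) \<Longrightarrow> sum f A \<in> laurent_span S"
  unfolding laurent_span_def
  by (auto intro: V.span_zero V.span_add V.span_scale V.span_neg V.span_sum)

lemma laurent_span_induct [consumes 1, case_names zero step]:
  assumes "z \<in> laurent_span S" "P 0" "\<And>c a z. \<lbrakk>a \<in> exponents S; z \<in> laurent_span S; P z\<rbrakk> \<Longrightarrow> P (scalar \<iota> c * monomial a + z)"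
  shows "P z"
proof -
  have "z \<in> laurent_span S \<and> P z"
    using assms(1) unfolding laurent_span_def
  proof (induction rule: V.span_induct_alt)
    case base
    then show ?case using assms(2) V.span_zero by simp
  next
    case (step c b y)
    then obtain a where a: "b = monomial a" "a \<in> exponents S" by blast
    show ?case using step assms(3)[OF a(2), of y c] a by (auto simp: laurent_span_def intro: V.span_add V.span_scale V.span_base)
  qed
  then show ?thesis ..
qed

lemma laurent_span_coeffs_mult:
  assumes S: "S \<subseteq> I" and c: "c \<in> coeffs S" and z: "z \<in> laurent_span S"
  shows "c * z \<in> laurent_span S"
proof -
  have frozen_monomial: "frozen_monomial m * z \<in> laurent_span S" if m: "keys m \<subseteq> FV S" and z: "z \<in> laurent_span S" for m z
    using z
  proof (induction rule: laurent_span_induct)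
    case zero
    then show ?case by (simp add: laurent_span_closed)
  next
    case (step c a z)
    obtain m' \<alpha> where a: "a = (m', \<alpha>)" by (cases a)
    have k: "keys m' \<subseteq> FV S" "keys \<alpha> \<subseteq> S" using step(1) unfolding a exponents_iff by simp_all
    have kI: "keys m \<subseteq> FV I" "keys m' \<subseteq> FV I" using FV_le[OF S m] FV_le[OF S k(1)] by simp_all
    have "frozen_monomial m * monomial a = monomial (m + m', \<alpha>)"
      by (simp add: a monomial_def frozen_monomial_add[OF kI] mult.assoc)
    moreover have "(m + m', \<alpha>) \<in> exponents S"
      using keys_add_le[OF m k(1)] k(2) by simp
    ultimately have "frozen_monomial m * monomial a \<in> laurent_span S" by (simp add: monomial_in_span)
    moreover have "frozen_monomial m * (scalar \<iota> c * monomial a + z) = scalar \<iota> c * (frozen_monomial m * monomial a) + frozen_monomial m * z"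
      by (simp add: distrib_left scalar_pull)
    ultimately show ?case using step by (simp add: laurent_span_closed)
  qed
  have "coeffs S \<subseteq> {c. \<forall>z\<in>laurent_span S. c * z \<in> laurent_span S}"
  proof (rule coeffs_least[OF S])
    show "subring {c. \<forall>z\<in>laurent_span S. c * z \<in> laurent_span S} DD"
      unfolding subring_DD_iff by (auto simp: distrib_right mult.assoc intro: laurent_span_closed)
    show "scalar \<iota> c \<in> {c. \<forall>z\<in>laurent_span S. c * z \<in> laurent_span S}" for c
      by (simp add: laurent_span_closed)
    fix i f assume f: "i \<in> S" "f \<in> F i"
    have k: "keys (single f (1::int)) \<subseteq> FV S"
      "keys (- single f (1::int)) \<subseteq> FV S"
      using f by (auto simp: keys_minus)
    have kI: "keys (single f (1::int)) \<subseteq> FV I" using k S by blast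
    show "\<iota> (frozen_var f) \<in> {c. \<forall>z\<in>laurent_span S. c * z \<in> laurent_span S}"
      unfolding frozen_var_def using frozen_monomial[OF k(1)] by blast
    show "inverse (\<iota> (frozen_var f)) \<in> {c. \<forall>z\<in>laurent_span S. c * z \<in> laurent_span S}"
      unfolding frozen_var_def monomial_inverse[OF kI] using frozen_monomial[OF k(2)] by blast
  qed
  then show ?thesis using c z by blast
qed

lemma one_in_laurent_span: "1 \<in> laurent_span S"
  using monomial_in_span[of "(0, 0)" S] by (simp add: monomial_def incl_one exponents_def)

lemma coeffs_in_laurent_span: "\<lbrakk>S \<subseteq> I; c \<in> coeffs S\<rbrakk> \<Longrightarrow> c \<in> laurent_span S"
  using laurent_span_coeffs_mult[OF _ _ one_in_laurent_span] by simp

lemma laurent_span_explicit: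
  assumes "z \<in> laurent_span S"
  shows "\<exists>A k. finite A \<and> A \<subseteq> exponents S \<and> (\<forall>a. a \<notin> A \<longrightarrow> k a = 0) \<and> z = (\<Sum>a\<in>A. scalar \<iota> (k a) * monomial a)"
  using assms
proof (induction rule: laurent_span_induct)
  case zero
  show ?case by (rule exI[of _ "{}"], rule exI[of _ "\<lambda>_. 0"]) simp
next
  case (step c b z)
  from step(3) obtain A k where A: "finite A" "A \<subseteq> exponents S" "\<forall>a. a \<notin> A \<longrightarrow> k a = 0" "z = (\<Sum>a\<in>A. scalar \<iota> (k a) * monomial a)"
    by (elim exE conjE)
  define k' where "k' = k(b := k b + c)"
  have fin: "finite (insert b A)" using A(1) by simp
  have "(\<Sum>a\<in>insert b A. scalar \<iota> (k a) * monomial a) = z"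
    unfolding A(4) by (rule sum.mono_neutral_right) (use A(1,3) in auto)
  then have "z = scalar \<iota> (k b) * monomial b + (\<Sum>a\<in>insert b A - {b}. scalar \<iota> (k a) * monomial a)"
    using sum.remove[OF fin, of b "\<lambda>a. scalar \<iota> (k a) * monomial a"] by simp
  moreover have "(\<Sum>a\<in>insert b A. scalar \<iota> (k' a) * monomial a)
      = scalar \<iota> (k b + c) * monomial b + (\<Sum>a\<in>insert b A - {b}. scalar \<iota> (k a) * monomial a)"
    by (subst sum.remove[OF fin, of b]) (simp_all add: k'_def)
  ultimately have "scalar \<iota> c * monomial b + z = (\<Sum>a\<in>insert b A. scalar \<iota> (k' a) * monomial a)"
    by (simp add: scal.scal_add distrib_right add_ac)
  moreover have "\<forall>a. a \<notin> insert b A \<longrightarrow> k' a = 0" using A(3) by (simp add: k'_def)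
  ultimately show ?case using A(2) step(1) fin by (intro exI[of _ "insert b A"] exI[of _ k']) simp
qed

lemma laurent_span_explicit_family:
  assumes "finite J" "\<forall>j\<in>J. z j \<in> laurent_span S"
  shows "\<exists>A k. finite A \<and> A \<subseteq> exponents S \<and> (\<forall>j\<in>J. z j = (\<Sum>a\<in>A. scalar \<iota> (k j a) * monomial a))"
proof -
  have "\<forall>j\<in>J. \<exists>A k. finite A \<and> A \<subseteq> exponents S \<and> (\<forall>a. a \<notin> A \<longrightarrow> k a = 0) \<and> z j = (\<Sum>a\<in>A. scalar \<iota> (k a) * monomial a)"
    by (rule ballI, rule laurent_span_explicit, rule bspec[OF assms(2)])
  from bchoice[OF this] obtain A where "\<forall>j\<in>J. \<exists>k. finite (A j) \<and> A j \<subseteq> exponents S \<and> (\<forall>a. a \<notin> A j \<longrightarrow> k a = 0) \<and>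
     z j = (\<Sum>a\<in>A j. scalar \<iota> (k a) * monomial a)" by (elim exE)
  from bchoice[OF this] obtain k where A': "\<forall>j\<in>J. finite (A j) \<and> A j \<subseteq> exponents S \<and> (\<forall>a. a \<notin> A j \<longrightarrow> k j a = 0) \<and>
     z j = (\<Sum>a\<in>A j. scalar \<iota> (k j a) * monomial a)" by (elim exE)
  note A = bspec[OF A']
  have fin: "finite (\<Union>j\<in>J. A j)" using A assms(1) by simp
  show ?thesis
  proof (rule exI, rule exI, intro conjI ballI)
    show "finite (\<Union>j\<in>J. A j)" by (rule fin)
    show "(\<Union>j\<in>J. A j) \<subseteq> exponents S" using A by (intro UN_least) simp
    show "z j = (\<Sum>a\<in>(\<Union>j\<in>J. A j). scalar \<iota> (k j a) * monomial a)" if "j \<in> J" for j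
    proof -
      have "(\<Sum>a\<in>A j. scalar \<iota> (k j a) * monomial a) = (\<Sum>a\<in>(\<Union>j\<in>J. A j). scalar \<iota> (k j a) * monomial a)"
      proof (rule sum.mono_neutral_left[OF fin])
        show "A j \<subseteq> (\<Union>j\<in>J. A j)" using that by blast
        show "\<forall>a\<in>(\<Union>j\<in>J. A j) - A j. scalar \<iota> (k j a) * monomial a = 0"
          using A[OF that] by (simp del: split_paired_All)
      qed
      then show ?thesis using A[OF that] by simp
    qed
  qed
qed

text \<open>
  Collecting the monomials with equal \<open>x\<close>-part gives a relation over the coefficient ring, whose coefficients vanish;
  they are images of elements of the group ring, where the frozen monomials are a basis.
\<close>

lemma monomial_independent:
  assumes A: "finite A" "A \<subseteq> exponents I" and s: "(\<Sum>a\<in>A. scalar \<iota> (k a) * monomial a) = 0" and b: "b \<in> A"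
  shows "k b = 0"
proof -
  \<comment> \<open>The coefficient of the Laurent monomial with exponent \<open>\<alpha>\<close>, before applying \<open>\<iota>\<close>.\<close>
  define r where "r \<alpha> = (\<Sum>a\<in>{a\<in>A. snd a = \<alpha>}. single (fst a) (k a))" for \<alpha>
  have in_gr: "single (fst a) c \<in> group_ring (FV I)" if "a \<in> A" for a and c :: 'k
    using A(2) that exponentsD(1)[of a I] by (intro group_ring_closed(6)) blast
  have sum_gr: "(\<Sum>a\<in>B. single (fst a) (k a)) \<in> group_ring (FV I) \<and>
      \<iota> (\<Sum>a\<in>B. single (fst a) (k a)) = (\<Sum>a\<in>B. scalar \<iota> (k a) * frozen_monomial (fst a))" if "finite B" "B \<subseteq> A" for B
    using that
  proof (induction B rule: finite_induct)
    case (insert a B)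
    have "scalar \<iota> (k a) * frozen_monomial (fst a) = \<iota> (single 0 (k a) * single (fst a) 1)"
      unfolding scalar_def
      by (rule incl_mult[symmetric]) (use in_gr[of a] insert in \<open>auto intro: group_ring_closed(6)\<close>)
    then have "\<iota> (single (fst a) (k a)) = scalar \<iota> (k a) * frozen_monomial (fst a)" by (simp add: mult_single)
    then show ?case using insert in_gr[of a] by (simp add: group_ring_closed incl_add)
  qed (simp add: group_ring_closed incl_zero)
  have r: "r \<alpha> \<in> group_ring (FV I)" "\<iota> (r \<alpha>) = (\<Sum>a\<in>{a\<in>A. snd a = \<alpha>}. scalar \<iota> (k a) * frozen_monomial (fst a))" for \<alpha>
    using sum_gr[of "{a\<in>A. snd a = \<alpha>}"] A(1) by (auto simp: r_def)
  have "(\<Sum>\<alpha>\<in>snd ` A. \<iota> (r \<alpha>) * laurent_monomial x \<alpha>) = (\<Sum>\<alpha>\<in>snd ` A. \<Sum>a\<in>{a\<in>A. snd a = \<alpha>}. scalar \<iota> (k a) * monomial a)"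
    by (rule sum.cong) (auto simp: r sum_distrib_right monomial_def mult.assoc intro!: sum.cong)
  also have "\<dots> = (\<Sum>a\<in>A. scalar \<iota> (k a) * monomial a)"
    by (rule sum.image_gen[OF A(1), symmetric])
  finally have s0: "(\<Sum>\<alpha>\<in>snd ` A. \<iota> (r \<alpha>) * laurent_monomial x \<alpha>) = 0" using s by simp
  have "\<iota> (r (snd b)) = 0"
  proof (rule laurent_independentD[OF x_indep subringD(2)[OF C_subring] finite_imageI[OF A(1)] _ _ s0 imageI[OF b]])
    show "keys \<alpha> \<subseteq> I" if "\<alpha> \<in> snd ` A" for \<alpha> using that A(2) exponentsD(2) by blast
    show "\<iota> (r \<alpha>) \<in> C" for \<alpha> using r(1) by (auto simp: coeffs_def)
  qed
  then have r0: "r (snd b) = 0" using incl_eq_0_iff[OF r(1)] by simp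
  have "lookup (r (snd b)) (fst b) = (\<Sum>a\<in>{a\<in>A. snd a = snd b}. if a = b then k a else 0)"
    unfolding r_def lookup_sum by (rule sum.cong) (auto simp: lookup_single when_def prod_eq_iff)
  also have "\<dots> = k b" using A(1) b by (simp add: sum.delta)
  finally show ?thesis using r0 by simp
qed

lemma exponents_add_inj:
  assumes "S \<subseteq> I" "T \<subseteq> I" "S \<inter> T = {}" "a \<in> exponents S" "a' \<in> exponents S" "b \<in> exponents T" "b' \<in> exponents T"
    and "a + b = a' + b'"
  shows "a = a' \<and> b = b'"
proof -
  have disj: "FV S \<inter> FV T = {}"
  proof -
    have "F i \<inter> F j = {}" if ij: "i \<in> S" "j \<in> T" for i j
    proof -
      have "i \<in> I" "j \<in> I" "i \<noteq> j" using ij assms(1-3) by auto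
      then show ?thesis using frozen_disjoint unfolding disjoint_family_on_def by simp
    qed
    then show ?thesis by blast
  qed
  have gen: "u = u' \<and> v = v'"
    if k: "keys u \<subseteq> U" "keys u' \<subseteq> U" "keys v \<subseteq> W" "keys v' \<subseteq> W"
      and d: "U \<inter> W = {}" and e: "u + v = u' + v'" for u u' v v' :: "'z \<Rightarrow>\<^sub>0 int" and U W
  proof -
    have l: "lookup u i + lookup v i = lookup u' i + lookup v' i" for i
      using arg_cong[OF e, of "\<lambda>p. lookup p i"] by (simp only: lookup_add)
    have "lookup u i = lookup u' i" for i
    proof (cases "i \<in> U")
      case True
      then have "i \<notin> keys v" "i \<notin> keys v'" using k d by blast+
      then show ?thesis using l[of i] by (simp add: in_keys_iff)
    next
      case False
      then have "i \<notin> keys u" "i \<notin> keys u'" using k by blast+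
      then show ?thesis by (simp add: in_keys_iff)
    qed
    then have "u = u'" by (rule poly_mapping_eqI)
    then show ?thesis using e by simp
  qed
  have "fst a + fst b = fst a' + fst b'" "snd a + snd b = snd a' + snd b'"
    using assms(8) by (simp_all add: prod_eq_iff)
  from gen[OF exponentsD(1)[OF assms(4)] exponentsD(1)[OF assms(5)] exponentsD(1)[OF assms(6)] exponentsD(1)[OF assms(7)] disj this(1)]
    gen[OF exponentsD(2)[OF assms(4)] exponentsD(2)[OF assms(5)] exponentsD(2)[OF assms(6)] exponentsD(2)[OF assms(7)] assms(3) this(2)]
  have "fst a = fst a' \<and> fst b = fst b'" "snd a = snd a' \<and> snd b = snd b'" .
  then show ?thesis by (simp add: prod_eq_iff)
qed

text \<open>
  Expanding the \<open>e a\<close> in monomials of \<open>T\<close> gives a relation between products of a monomial of \<open>S\<close> and one of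
  \<open>T\<close>; since \<open>S\<close> and \<open>T\<close> are disjoint, different pairs have different products.
\<close>

lemma monomial_independent_over_span:
  assumes ST: "S \<subseteq> I" "T \<subseteq> I" "S \<inter> T = {}" and A: "finite A" "A \<subseteq> exponents S"
    and e: "\<And>a. a \<in> A \<Longrightarrow> e a \<in> laurent_span T" and s: "(\<Sum>a\<in>A. monomial a * e a) = 0" and b: "b \<in> A"
  shows "e b = 0"
proof -
  have "\<forall>a\<in>A. e a \<in> laurent_span T" using e by blast
  from laurent_span_explicit_family[OF A(1) this]
  obtain B k where B': "finite B" "B \<subseteq> exponents T" "\<forall>a\<in>A. e a = (\<Sum>b\<in>B. scalar \<iota> (k a b) * monomial b)"
    by (elim exE conjE)
  note B = B'(1,2) bspec[OF B'(3)]
  define plus_pair where "plus_pair p = fst p + snd p"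
    for p :: "(('f \<Rightarrow>\<^sub>0 int) \<times> (nat \<Rightarrow>\<^sub>0 int)) \<times> (('f \<Rightarrow>\<^sub>0 int) \<times> (nat \<Rightarrow>\<^sub>0 int))"
  \<comment> \<open>The coefficient of a product monomial, read off from the unique pair of factors.\<close>
  define K where "K c = (let ab = inv_into (A \<times> B) plus_pair c in k (fst ab) (snd ab))" for c
  have inj: "inj_on plus_pair (A \<times> B)"
  proof (rule inj_onI)
    fix p q assume p: "p \<in> A \<times> B" and q: "q \<in> A \<times> B" and pq: "plus_pair p = plus_pair q"
    have "fst p \<in> exponents S" "fst q \<in> exponents S" "snd p \<in> exponents T" "snd q \<in> exponents T"
      using p q A(2) B(2) by (auto simp del: exponents_iff)
    from exponents_add_inj[OF ST this pq[unfolded plus_pair_def]] show "p = q"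
      by (simp add: prod_eq_iff)
  qed
  have K: "K (a + b) = k a b" if "a \<in> A" "b \<in> B" for a b
  proof -
    have "inv_into (A \<times> B) plus_pair (plus_pair (a, b)) = (a, b)"
      by (rule inv_into_f_f[OF inj]) (use that in simp)
    then show ?thesis by (simp add: K_def plus_pair_def)
  qed
  let ?E = "plus_pair ` (A \<times> B)"
  have "(\<Sum>c\<in>?E. scalar \<iota> (K c) * monomial c) = (\<Sum>p\<in>A \<times> B. scalar \<iota> (K (plus_pair p)) * monomial (plus_pair p))"
    by (subst sum.reindex[OF inj]) (simp add: o_def)
  also have "\<dots> = (\<Sum>(a, b)\<in>A \<times> B. scalar \<iota> (K (a + b)) * monomial (a + b))"
    by (simp add: plus_pair_def case_prod_unfold)
  also have "\<dots> = (\<Sum>a\<in>A. \<Sum>b\<in>B. scalar \<iota> (K (a + b)) * monomial (a + b))"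
    by (simp add: sum.cartesian_product)
  also have "\<dots> = (\<Sum>a\<in>A. monomial a * e a)"
  proof (rule sum.cong[OF refl])
    fix a assume a: "a \<in> A"
    have "monomial a * e a = (\<Sum>b\<in>B. monomial a * (scalar \<iota> (k a b) * monomial b))"
      by (simp add: B(3)[OF a] sum_distrib_left)
    also have "\<dots> = (\<Sum>b\<in>B. scalar \<iota> (K (a + b)) * monomial (a + b))"
    proof (rule sum.cong[OF refl])
      fix b assume b: "b \<in> B"
      have "monomial a * (scalar \<iota> (k a b) * monomial b) = scalar \<iota> (k a b) * (monomial a * monomial b)"
        by (rule scalar_pull)
      also have "monomial a * monomial b = monomial (a + b)" by (rule monomial_mult(1)[OF ST]) (use a b A B in auto)
      finally show "monomial a * (scalar \<iota> (k a b) * monomial b) = scalar \<iota> (K (a + b)) * monomial (a + b)"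
        by (simp add: K[OF a b])
    qed
    finally show "(\<Sum>b\<in>B. scalar \<iota> (K (a + b)) * monomial (a + b)) = monomial a * e a" by simp
  qed
  finally have s0: "(\<Sum>c\<in>?E. scalar \<iota> (K c) * monomial c) = 0" using s by simp
  have sub: "?E \<subseteq> exponents I"
  proof -
    have "a + b \<in> exponents (S \<union> T)" if "a \<in> A" "b \<in> B" for a b
      by (rule monomial_mult(2)[OF ST]) (use that A B in auto)
    moreover have "exponents (S \<union> T) \<subseteq> exponents I" by (rule exponents_mono) (use ST in blast)
    ultimately show ?thesis by (auto simp: plus_pair_def simp del: exponents_iff)
  qed
  have "k b c = 0" if c: "c \<in> B" for c
  proof -
    have "K (b + c) = 0"
    proof (rule monomial_independent[OF _ sub s0])
      show "finite ?E" using A(1) B(1) by simp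
      show "b + c \<in> ?E" by (rule image_eqI[of _ _ "(b, c)"]) (simp_all add: plus_pair_def b c)
    qed
    then show ?thesis by (simp add: K[OF b c])
  qed
  then show ?thesis by (simp add: B(3)[OF b])
qed

lemma laurent_loc_common_denominator:
  assumes S: "S \<subseteq> I" and J: "finite J" "\<forall>j\<in>J. z j \<in> laurent_loc S"
  shows "\<exists>d\<in>coeffs S. d \<noteq> 0 \<and> (\<forall>j\<in>J. d * z j \<in> laurent_span S)"
proof -
  note R = coeffs_subring[OF S]
  have com: "a * b = b * a" if "a \<in> coeffs S" "b \<in> coeffs S" for a b
    using coeffs_subcring[OF S] that by (auto simp: subcring_DD_iff)
  show ?thesis
    using J
  proof (induction J rule: finite_induct)
    case empty
    show ?case using subringD(1)[OF R] by (intro bexI[of _ 1]) auto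
  next
    case (insert j J)
    have "\<forall>j\<in>J. z j \<in> laurent_loc S" "z j \<in> laurent_loc S" using insert.prems by simp_all
    from insert.IH[OF this(1)] laurent_locE[OF this(2)] obtain d c
      where d: "d \<in> coeffs S" "d \<noteq> 0" "\<forall>j\<in>J. d * z j \<in> laurent_span S"
        and c: "c \<in> coeffs S" "c \<noteq> 0" "c * z j \<in> laurent_span S"
      by (elim bexE conjE)
    have "c * d * z i \<in> laurent_span S" if "i \<in> insert j J" for i
    proof (cases "i = j")
      case True
      have "c * d * z i = d * (c * z j)" using com[OF c(1) d(1)] True by (simp add: mult.assoc)
      then show ?thesis using laurent_span_coeffs_mult[OF S d(1) c(3)] by simp
    next
      case False
      then show ?thesis using laurent_span_coeffs_mult[OF S c(1), of "d * z i"] d(3) that by (simp add: mult.assoc)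
    qed
    then show ?case using c d subringD(6)[OF R] by (intro bexI[of _ "c * d"]) auto
  qed
qed

lemma laurent_span_loc: "S \<subseteq> I \<Longrightarrow> laurent_span S \<subseteq> laurent_loc S"
  using subringD(1)[OF coeffs_subring] by (intro subsetI laurent_locI[of 1]) auto

lemma laurent_loc_closed:
  assumes S: "S \<subseteq> I"
  shows "\<lbrakk>z \<in> laurent_loc S; w \<in> laurent_loc S\<rbrakk> \<Longrightarrow> z + w \<in> laurent_loc S"
    "z \<in> laurent_loc S \<Longrightarrow> - z \<in> laurent_loc S" "z \<in> laurent_loc S \<Longrightarrow> scalar \<iota> c * z \<in> laurent_loc S"
    "0 \<in> laurent_loc S"
    "(\<And>j. j \<in> J \<Longrightarrow> f j \<in> laurent_loc S) \<Longrightarrow> sum f J \<in> laurent_loc S"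
proof -
  show add: "z + w \<in> laurent_loc S" if zw: "z \<in> laurent_loc S" "w \<in> laurent_loc S" for z w
  proof -
    have "finite {z, w}" "\<forall>j\<in>{z, w}. j \<in> laurent_loc S" using zw by simp_all
    from laurent_loc_common_denominator[OF S this]
    obtain d where d: "d \<in> coeffs S" "d \<noteq> 0" "\<forall>j\<in>{z, w}. d * j \<in> laurent_span S" by (elim bexE conjE)
    then have "d * (z + w) \<in> laurent_span S" using laurent_span_closed(2) by (simp add: distrib_left)
    then show ?thesis by (rule laurent_locI[OF d(1,2)])
  qed
  show "- z \<in> laurent_loc S" if "z \<in> laurent_loc S"
  proof -
    from laurent_locE[OF that] obtain d where d: "d \<in> coeffs S" "d \<noteq> 0" "d * z \<in> laurent_span S" by (elim bexE conjE)
    then have "d * (- z) \<in> laurent_span S" using laurent_span_closed(4)[OF d(3)] by simp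
    then show ?thesis by (rule laurent_locI[OF d(1,2)])
  qed
  show "scalar \<iota> c * z \<in> laurent_loc S" if "z \<in> laurent_loc S"
  proof -
    from laurent_locE[OF that] obtain d where d: "d \<in> coeffs S" "d \<noteq> 0" "d * z \<in> laurent_span S" by (elim bexE conjE)
    have "d * (scalar \<iota> c * z) = scalar \<iota> c * (d * z)"
      by (rule scalar_pull)
    then have "d * (scalar \<iota> c * z) \<in> laurent_span S" using laurent_span_closed(3)[OF d(3)] by simp
    then show ?thesis by (rule laurent_locI[OF d(1,2)])
  qed
  show 0: "0 \<in> laurent_loc S" using laurent_span_loc[OF S] laurent_span_closed(1) by blast
  show "(\<And>j. j \<in> J \<Longrightarrow> f j \<in> laurent_loc S) \<Longrightarrow> sum f J \<in> laurent_loc S"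
    by (induction J rule: infinite_finite_induct) (auto intro: 0 add)
qed

lemma laurent_loc_coeffs_comm:
  assumes "S \<subseteq> I" "T \<subseteq> I" "S \<inter> T = {}" "z \<in> laurent_loc S" "c \<in> coeffs T"
  shows "z * c = c * z"
proof -
  have cc: "b * c = c * b" if "b \<in> coeffs S" for b
    by (rule C_comm) (use that assms(5) coeffs_mono[OF assms(1)] coeffs_mono[OF assms(2)] in blast)+
  have "laurent_span S \<subseteq> centralizer {c}"
  proof
    fix u assume "u \<in> laurent_span S"
    then show "u \<in> centralizer {c}"
    proof (induction rule: laurent_span_induct)
      case zero
      then show ?case by (rule subringD(2)[OF centralizer_subring])
    next
      case (step k a z)
      obtain m \<alpha> where a: "a = (m, \<alpha>)" by (cases a)
      have k: "keys m \<subseteq> FV S" "keys \<alpha> \<subseteq> S" using step(1) unfolding a exponents_iff by simp_all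
      have "frozen_monomial m \<in> centralizer {c}" "laurent_monomial x \<alpha> \<in> centralizer {c}" "scalar \<iota> k \<in> centralizer {c}"
        using cc[OF frozen_monomial_coeffs[OF k(1)]] x_monomial_coeffs_comm[OF assms(1-3) k(2) assms(5)] scalar_central
        by (simp_all add: centralizer_def)
      then show ?case using step(3) unfolding a monomial_def fst_conv snd_conv
        by (intro subringD(4,6)[OF centralizer_subring])
    qed
  qed
  moreover obtain d where d: "d \<in> coeffs S" "d \<noteq> 0" "d * z \<in> laurent_span S" using laurent_locE[OF assms(4)] by (elim bexE conjE)
  moreover have "inverse d \<in> centralizer {c}"
    by (rule centralizer_inverse) (use cc[OF d(1)] in \<open>simp add: centralizer_def\<close>)
  ultimately have "inverse d * (d * z) \<in> centralizer {c}"
    using subringD(6)[OF centralizer_subring] by blast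
  then show ?thesis using d(2) by (simp add: inverse_cancel centralizer_def)
qed

lemma laurent_loc_mult:
  assumes ST: "S \<subseteq> I" "T \<subseteq> I" "S \<inter> T = {}" and zw: "z \<in> laurent_loc S" "w \<in> laurent_loc T"
  shows "z * w \<in> laurent_loc (S \<union> T)"
proof -
  obtain d where d: "d \<in> coeffs S" "d \<noteq> 0" "d * z \<in> laurent_span S" using laurent_locE[OF zw(1)] by (elim bexE conjE)
  obtain e where e: "e \<in> coeffs T" "e \<noteq> 0" "e * w \<in> laurent_span T" using laurent_locE[OF zw(2)] by (elim bexE conjE)
  have mm: "u * v \<in> laurent_span (S \<union> T)" if "u \<in> laurent_span S" "v \<in> laurent_span T" for u v
    using that(1)
  proof (induction rule: laurent_span_induct)
    case zero
    then show ?case by (simp add: laurent_span_closed)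
  next
    case (step c a u)
    have "monomial a * v \<in> laurent_span (S \<union> T)" using that(2)
    proof (induction rule: laurent_span_induct)
      case zero
      then show ?case by (simp add: laurent_span_closed)
    next
      case (step c' b v)
      have "monomial a * (scalar \<iota> c' * monomial b + v) = scalar \<iota> c' * (monomial a * monomial b) + monomial a * v"
        by (simp add: distrib_left scalar_pull)
      moreover have "monomial a * monomial b \<in> laurent_span (S \<union> T)"
        using monomial_mult[OF ST \<open>a \<in> exponents S\<close> step(1)] monomial_in_span by simp
      ultimately show ?case using step by (simp add: laurent_span_closed)
    qed
    then show ?case using step by (simp add: distrib_right mult.assoc laurent_span_closed)
  qed
  have "d * e * (z * w) = d * (e * z) * w" by (simp only: mult.assoc)
  also have "\<dots> = (d * z) * (e * w)"
    by (simp only: laurent_loc_coeffs_comm[OF ST zw(1) e(1), symmetric] mult.assoc)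
  finally have "d * e * (z * w) \<in> laurent_span (S \<union> T)" using mm[OF d(3) e(3)] by simp
  moreover have "d * e \<in> coeffs (S \<union> T)"
    using d(1) e(1) coeffs_mono[of S "S \<union> T"] coeffs_mono[of T "S \<union> T"] ST
    by (intro subringD(6)[OF coeffs_subring]) auto
  moreover have "d * e \<noteq> 0" using d(2) e(2) by simp
  ultimately show ?thesis by (intro laurent_locI)
qed

text \<open>
  If conjugation by the \<open>x i\<close>, \<open>i \<in> S\<close>, preserves the coefficients, then a denominator can be moved from the right
  to the left of a Laurent polynomial, so the localization is a ring.
\<close>

lemma laurent_loc_subring:
  assumes S: "S \<subseteq> I" and norm: "\<And>i. i \<in> S \<Longrightarrow> x i \<in> normalizer (coeffs S)"
  shows "subring (laurent_loc S) DD"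
proof -
  note R = coeffs_subring[OF S]
  have com: "a * b = b * a" if "a \<in> coeffs S" "b \<in> coeffs S" for a b
    using coeffs_subcring[OF S] that by (auto simp: subcring_DD_iff)
  have lmn: "laurent_monomial x \<alpha> \<in> normalizer (coeffs S)" if "keys \<alpha> \<subseteq> S" for \<alpha>
    using norm that by (intro laurent_monomial_normalizer) blast
  have cm: "c * laurent_monomial x \<alpha> \<in> laurent_span S" if "c \<in> coeffs S" "keys \<alpha> \<subseteq> S" for c \<alpha>
  proof -
    have "laurent_monomial x \<alpha> = monomial (0, \<alpha>)" by (simp add: monomial_def incl_one)
    then show ?thesis using laurent_span_coeffs_mult[OF S that(1) monomial_in_span[of "(0, \<alpha>)" S]] that(2)
      by (simp add: exponents_def)
  qed
  have mm: "u * v \<in> laurent_span S" if "u \<in> laurent_span S" "v \<in> laurent_span S" for u v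
    using that(1)
  proof (induction rule: laurent_span_induct)
    case zero
    then show ?case by (simp add: laurent_span_closed)
  next
    case (step c a u)
    obtain m \<alpha> where a: "a = (m, \<alpha>)" by (cases a)
    have k: "keys m \<subseteq> FV S" "keys \<alpha> \<subseteq> S" using step(1) unfolding a exponents_iff by simp_all
    have "monomial a * v \<in> laurent_span S" using that(2)
    proof (induction rule: laurent_span_induct)
      case zero
      then show ?case by (simp add: laurent_span_closed)
    next
      case (step c' b v)
      obtain m' \<beta> where b: "b = (m', \<beta>)" by (cases b)
      have k': "keys m' \<subseteq> FV S" "keys \<beta> \<subseteq> S" using step(1) unfolding b exponents_iff by simp_all
      obtain c'' where c'': "c'' \<in> coeffs S" "laurent_monomial x \<alpha> * frozen_monomial m' = c'' * laurent_monomial x \<alpha>"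
        by (rule normalizer_shift[OF lmn[OF k(2)] frozen_monomial_coeffs[OF k'(1)]])
      have "monomial a * monomial b = frozen_monomial m * (laurent_monomial x \<alpha> * frozen_monomial m') * laurent_monomial x \<beta>"
        by (simp only: a b monomial_def mult.assoc fst_conv snd_conv)
      also have "\<dots> = frozen_monomial m * c'' * laurent_monomial x (\<alpha> + \<beta>)"
        by (simp only: c''(2) x_monomial_add[OF order_trans[OF k(2) S] order_trans[OF k'(2) S]] mult.assoc)
      also have "\<dots> \<in> laurent_span S"
        by (rule cm[OF subringD(6)[OF R frozen_monomial_coeffs[OF k(1)] c''(1)] keys_add_le[OF k(2) k'(2)]])
      finally have "monomial a * monomial b \<in> laurent_span S" .
      moreover have "monomial a * (scalar \<iota> c' * monomial b + v) = scalar \<iota> c' * (monomial a * monomial b) + monomial a * v"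
        by (simp add: distrib_left scalar_pull)
      ultimately show ?case using step by (simp add: laurent_span_closed)
    qed
    then show ?case using step by (simp add: distrib_right mult.assoc laurent_span_closed)
  qed
  have ore: "\<exists>D\<in>coeffs S. D \<noteq> 0 \<and> D * u * inverse e \<in> laurent_span S"
    if e: "e \<in> coeffs S" "e \<noteq> 0" and u: "u \<in> laurent_span S" for u e
    using u
  proof (induction rule: laurent_span_induct)
    case zero
    then show ?case using subringD(1)[OF R] by (intro bexI[of _ 1]) (simp_all add: laurent_span_closed)
  next
    case (step c a u)
    then obtain D where D: "D \<in> coeffs S" "D \<noteq> 0" "D * u * inverse e \<in> laurent_span S" by blast
    obtain m \<alpha> where a: "a = (m, \<alpha>)" by (cases a)
    have k: "keys m \<subseteq> FV S" "keys \<alpha> \<subseteq> S" using step(1) unfolding a exponents_iff by simp_all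
    obtain D' where D'': "D' \<in> coeffs S" "laurent_monomial x \<alpha> * e = D' * laurent_monomial x \<alpha>" "e \<noteq> 0 \<longrightarrow> D' \<noteq> 0"
      by (rule normalizer_shift[OF lmn[OF k(2)] e(1)])
    note D' = D''(1,2) mp[OF D''(3) e(2)]
    have "D' * monomial a * inverse e = (D' * frozen_monomial m) * laurent_monomial x \<alpha> * inverse e"
      by (simp only: a monomial_def mult.assoc fst_conv snd_conv)
    also have "\<dots> = frozen_monomial m * (D' * laurent_monomial x \<alpha>) * inverse e"
      by (simp only: com[OF D'(1) frozen_monomial_coeffs[OF k(1)]] mult.assoc)
    also have "\<dots> = monomial a"
      unfolding D'(2)[symmetric] using e(2) by (simp add: a monomial_def mult.assoc)
    finally have m1: "D' * monomial a * inverse e = monomial a" .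
    have "D * D' * (scalar \<iota> c * monomial a + u) * inverse e
       = scalar \<iota> c * (D * (D' * monomial a * inverse e)) + D' * (D * u * inverse e)"
    proof -
      have "D * D' * (scalar \<iota> c * monomial a) = scalar \<iota> c * (D * D' * monomial a)"
        by (rule scalar_pull)
      moreover have "D * D' * u = D' * D * u" by (simp only: com[OF D(1) D'(1)])
      ultimately show ?thesis by (simp only: distrib_left distrib_right) (simp only: mult.assoc)
    qed
    also have "\<dots> \<in> laurent_span S"
      unfolding m1
      by (intro laurent_span_closed(2,3) laurent_span_coeffs_mult[OF S] D(1,3) D'(1) monomial_in_span step(1))
    finally show ?case using D D' subringD(6)[OF R] by (intro bexI[of _ "D * D'"]) auto
  qed
  show ?thesis
    unfolding subring_DD_iff
  proof (intro conjI ballI)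
    show "1 \<in> laurent_loc S" using laurent_span_loc[OF S] one_in_laurent_span by blast
    fix z assume z: "z \<in> laurent_loc S"
    then show "- z \<in> laurent_loc S" by (rule laurent_loc_closed(2)[OF S])
    fix w assume w: "w \<in> laurent_loc S"
    with z show "z + w \<in> laurent_loc S" by (rule laurent_loc_closed(1)[OF S])
    obtain d where d: "d \<in> coeffs S" "d \<noteq> 0" "d * z \<in> laurent_span S" using laurent_locE[OF z] by (elim bexE conjE)
    obtain e where e: "e \<in> coeffs S" "e \<noteq> 0" "e * w \<in> laurent_span S" using laurent_locE[OF w] by (elim bexE conjE)
    obtain D where D: "D \<in> coeffs S" "D \<noteq> 0" "D * (d * z) * inverse e \<in> laurent_span S"
      using ore[OF e(1,2) d(3)] by blast
    have "D * d * (z * w) = (D * (d * z) * inverse e) * (e * w)"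
      using e(2) by (simp add: mult.assoc inverse_cancel)
    then have "D * d * (z * w) \<in> laurent_span S" using mm[OF D(3) e(3)] by simp
    then show "z * w \<in> laurent_loc S"
      using d D subringD(6)[OF R] by (intro laurent_locI[of "D * d"]) auto
  qed
qed

lemma monomial_independent_over_loc:
  assumes ST: "S \<subseteq> I" "T \<subseteq> I" "S \<inter> T = {}" and A: "finite A" "A \<subseteq> exponents S"
    and e: "\<And>a. a \<in> A \<Longrightarrow> e a \<in> laurent_loc T" and s: "(\<Sum>a\<in>A. monomial a * e a) = 0" and b: "b \<in> A"
  shows "e b = 0"
proof -
  have "\<forall>a\<in>A. e a \<in> laurent_loc T" using e by blast
  from laurent_loc_common_denominator[OF ST(2) A(1) this]
  obtain d where d': "d \<in> coeffs T" "d \<noteq> 0" "\<forall>a\<in>A. d * e a \<in> laurent_span T" by (elim bexE conjE)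
  note d = d'(1,2) bspec[OF d'(3)]
  have "monomial a * (d * e a) = d * (monomial a * e a)" if "a \<in> A" for a
  proof -
    have "monomial a \<in> laurent_loc S" using A(2) that laurent_span_loc[OF ST(1)] monomial_in_span by blast
    from laurent_loc_coeffs_comm[OF ST this d(1)] show ?thesis by (simp add: mult.assoc[symmetric])
  qed
  then have "(\<Sum>a\<in>A. monomial a * (d * e a)) = d * (\<Sum>a\<in>A. monomial a * e a)"
    by (simp add: sum_distrib_left)
  then have "(\<Sum>a\<in>A. monomial a * (d * e a)) = 0" using s by simp
  from monomial_independent_over_span[OF ST A d(3) this b] d(2) show ?thesis by simp
qed

text \<open>
  After multiplication by a common denominator the coefficients \<open>c b\<close> are linear combinations of monomials of
  \<open>S\<close> over the ground field.  These are independent over the localization of \<open>T\<close>, so each of them carries a linear relation between the elements of \<open>B\<close>.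
\<close>

lemma laurent_loc_linearly_disjoint:
  assumes ST: "S \<subseteq> I" "T \<subseteq> I" "S \<inter> T = {}" and B: "finite B" "B \<subseteq> laurent_loc T" "V.independent B"
    and c: "\<And>b. b \<in> B \<Longrightarrow> c b \<in> laurent_loc S" and s: "(\<Sum>b\<in>B. c b * b) = 0" and b: "b \<in> B"
  shows "c b = 0"
proof -
  have "\<forall>b\<in>B. c b \<in> laurent_loc S" using c by blast
  from laurent_loc_common_denominator[OF ST(1) B(1) this]
  obtain d where d: "d \<in> coeffs S" "d \<noteq> 0" "\<forall>b\<in>B. d * c b \<in> laurent_span S" by (elim bexE conjE)
  from laurent_span_explicit_family[OF B(1) d(3)]
  obtain A k where A': "finite A" "A \<subseteq> exponents S" "\<forall>b\<in>B. d * c b = (\<Sum>a\<in>A. scalar \<iota> (k b a) * monomial a)"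
    by (elim exE conjE)
  note A = A'(1,2) bspec[OF A'(3)]
  have "(\<Sum>a\<in>A. monomial a * (\<Sum>b\<in>B. scalar \<iota> (k b a) * b)) = (\<Sum>a\<in>A. \<Sum>b\<in>B. scalar \<iota> (k b a) * (monomial a * b))"
    by (simp add: sum_distrib_left scalar_pull)
  also have "\<dots> = (\<Sum>b\<in>B. \<Sum>a\<in>A. scalar \<iota> (k b a) * (monomial a * b))" by (rule sum.swap)
  also have "\<dots> = (\<Sum>b\<in>B. (d * c b) * b)"
    by (rule sum.cong) (simp_all only: A(3) sum_distrib_right mult.assoc)
  also have "\<dots> = d * (\<Sum>b\<in>B. c b * b)" by (simp add: sum_distrib_left mult.assoc)
  finally have s0: "(\<Sum>a\<in>A. monomial a * (\<Sum>b\<in>B. scalar \<iota> (k b a) * b)) = 0" using s by simp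
  have "k b a = 0" if a: "a \<in> A" for a
  proof -
    have "(\<Sum>b\<in>B. scalar \<iota> (k b a) * b) = 0"
    proof (rule monomial_independent_over_loc[OF ST A(1,2) _ s0 a])
      show "(\<Sum>b\<in>B. scalar \<iota> (k b a) * b) \<in> laurent_loc T" for a
        using B(2) by (intro laurent_loc_closed(5,3)[OF ST(2)]) blast
    qed
    then show ?thesis
      using V.independentD[OF B(3,1) subset_refl, of "\<lambda>b. k b a" b] b by simp
  qed
  then have "d * c b = 0" by (simp add: A(3)[OF b])
  then show ?thesis using d(2) by simp
qed

text \<open>
  Induction on the number of factors: grouping the products by their last factor gives a relation
  between elements of the last basis whose coefficients come from the directions before it.
\<close>

lemma basis_products_independent:
  assumes B: "\<And>i. i \<in> I \<Longrightarrow> B i \<subseteq> laurent_loc {i} \<and> V.independent (B i)"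
    and l: "l \<le> n" and W: "finite W" "\<And>w i. \<lbrakk>w \<in> W; i \<in> {1..l}\<rbrakk> \<Longrightarrow> w i \<in> B i" "inj_on (\<lambda>w. restrict w {1..l}) W"
    and s: "(\<Sum>w\<in>W. scalar \<iota> (c w) * prod_list (map w [1..<Suc l])) = 0" and w: "w \<in> W"
  shows "c w = 0"
  using l W s w
proof (induction l arbitrary: W w)
  case 0
  have "W = {w}" using 0(4,6) by (auto simp: inj_on_def)
  then have "scalar \<iota> (c w) = 0" using 0(5) by simp
  then have "\<iota> (single 0 (c w)) = 0" by (simp add: scalar_def)
  then have "single (0 :: 'f \<Rightarrow>\<^sub>0 int) (c w) = 0"
    using incl_eq_0_iff[OF group_ring_closed(6), of 0 "c w"] by simp
  then show ?case by (metis lookup_single_eq lookup_zero)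
next
  case (Suc l)
  let ?k = "Suc l"
  have k: "?k \<in> I" using Suc.prems(1) by auto
  have loc: "prod_list (map w [1..<Suc l']) \<in> laurent_loc {1..l'}" if "w \<in> W" "l' \<le> ?k" for w l'
    using that(2)
  proof (induction l')
    case 0
    then show ?case using laurent_span_loc[of "{}"] one_in_laurent_span[of "{}"] by auto
  next
    case (Suc m)
    have "prod_list (map w [1..<Suc m]) * w (Suc m) \<in> laurent_loc ({1..m} \<union> {Suc m})"
    proof (rule laurent_loc_mult)
      show "w (Suc m) \<in> laurent_loc {Suc m}"
        using Suc.prems \<open>Suc l \<le> n\<close> B[of "Suc m"] \<open>\<And>w i. \<lbrakk>w \<in> W; i \<in> {1..Suc l}\<rbrakk> \<Longrightarrow> w i \<in> B i\<close>[OF that(1), of "Suc m"]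
        by auto
    qed (use Suc \<open>Suc l \<le> n\<close> in auto)
    moreover have "{1..m} \<union> {Suc m} = {1..Suc m}" by auto
    ultimately show ?case by simp
  qed
  define Wb where "Wb b = {w \<in> W. w ?k = b}" for b
  define cb where "cb b = (\<Sum>w\<in>Wb b. scalar \<iota> (c w) * prod_list (map w [1..<Suc l]))" for b
  have fin: "finite (Wb b)" for b using Suc.prems(2) by (simp add: Wb_def)
  have "(\<Sum>b\<in>(\<lambda>w. w ?k) ` W. cb b * b) = (\<Sum>b\<in>(\<lambda>w. w ?k) ` W. \<Sum>w\<in>Wb b. scalar \<iota> (c w) * prod_list (map w [1..<Suc ?k]))"
    by (rule sum.cong[OF refl]) (simp add: cb_def sum_distrib_right Wb_def mult.assoc)
  also have "\<dots> = 0"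
    unfolding Wb_def using sum.image_gen[OF Suc.prems(2), of "\<lambda>w. scalar \<iota> (c w) * prod_list (map w [1..<Suc ?k])" "\<lambda>w. w ?k"]
      Suc.prems(5) by simp
  finally have s0: "(\<Sum>b\<in>(\<lambda>w. w ?k) ` W. cb b * b) = 0" .
  have sub: "(\<lambda>w. w ?k) ` W \<subseteq> B ?k" using Suc.prems(3) by auto
  have "cb (w ?k) = 0"
  proof (rule laurent_loc_linearly_disjoint[OF _ _ _ finite_imageI[OF Suc.prems(2)] _ _ _ s0])
    show "{1..l} \<subseteq> I" "{?k} \<subseteq> I" "{1..l} \<inter> {?k} = {}" using Suc.prems(1) by auto
    show "(\<lambda>w. w ?k) ` W \<subseteq> laurent_loc {?k}" using sub B[OF k] by blast
    show "V.independent ((\<lambda>w. w ?k) ` W)" using sub B[OF k] V.independent_mono by blast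
    show "cb b \<in> laurent_loc {1..l}" for b
      unfolding cb_def using Suc.prems(1) by (intro laurent_loc_closed(5,3) loc) (auto simp: Wb_def)
    show "w ?k \<in> (\<lambda>w. w ?k) ` W" using Suc.prems(6) by blast
  qed
  then have z: "(\<Sum>w\<in>Wb (w ?k). scalar \<iota> (c w) * prod_list (map w [1..<Suc l])) = 0" by (simp add: cb_def)
  have inj: "inj_on (\<lambda>w. restrict w {1..l}) (Wb (w ?k))"
  proof (rule inj_onI)
    fix u v assume u: "u \<in> Wb (w ?k)" and v: "v \<in> Wb (w ?k)" and e: "restrict u {1..l} = restrict v {1..l}"
    have "u i = v i" if "i \<in> {1..?k}" for i
    proof (cases "i = ?k")
      case False
      then have "i \<in> {1..l}" using that by auto
      then show ?thesis using fun_cong[OF e, of i] by simp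
    qed (use u v in \<open>simp add: Wb_def\<close>)
    then have "restrict u {1..?k} = restrict v {1..?k}" by (intro restrict_ext)
    then show "u = v" using inj_onD[OF Suc.prems(4), of u v] u v by (simp add: Wb_def)
  qed
  show ?case
    by (rule Suc.IH[OF _ fin _ inj z]) (use Suc.prems in \<open>auto simp: Wb_def\<close>)
qed

section \<open>The tensor product decomposition\<close>

abbreviation "A k \<equiv> weyl_cluster_algebra \<iota> (rank_one p k)"

lemma coeff_ring_rank_one: "coeff_ring \<iota> (rank_one p k) = coeffs {k}"
  by (simp add: coeff_ring_def coeffs_def)

lemma A_subring: "subring (A k) DD"
  unfolding weyl_cluster_algebra_def by (rule generate_ring_subring)

lemma coeffs_A: "coeffs {k} \<subseteq> A k"
  unfolding weyl_cluster_algebra_def coeff_ring_rank_one by (auto intro: generate_ring.incl)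

lemma scalar_A: "scalar \<iota> c \<in> A k"
  using coeffs_A scalar_coeffs by blast

lemma A_scale: "a \<in> A k \<Longrightarrow> scalar \<iota> c * a \<in> A k"
  by (intro subringD(6)[OF A_subring] scalar_A)

text \<open>
  In rank one all cluster variables are products of \<open>x k\<close>, \<open>\<xi> k\<close> and their inverses.
\<close>

lemma A_least:
  assumes k: "k \<in> I" and P: "subring P DD" and C: "coeffs {k} \<subseteq> P"
    and gens: "x k \<in> P" "inverse (x k) \<in> P" "inverse (\<xi> k) \<in> P"
  shows "A k \<subseteq> P"
  unfolding weyl_cluster_algebra_def
proof (rule generate_ring_least[OF P])
  have "exch q k \<in> P" if "q \<in> mutation_class \<iota> (rank_one p k)" for q
  proof -
    have "\<xi> k \<in> P" using C xi_coeffs[OF k] by blast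
    with mutation_class_invariant[OF that, of "\<lambda>_. P"] P gens x_nonzero[OF k] xi_nonzero[OF k]
    show ?thesis by simp
  qed
  then show "coeff_ring \<iota> (rank_one p k) \<union> cluster_vars \<iota> (rank_one p k) \<subseteq> P"
    using C unfolding coeff_ring_rank_one cluster_vars_def by auto
qed

lemma A_comm:
  assumes ij: "i \<in> I" "j \<in> I" "i \<noteq> j" and a: "a \<in> A i" and b: "b \<in> A j"
  shows "a * b = b * a"
proof -
  have cent: "A i \<subseteq> centralizer T"
    if i: "i \<in> I" and T: "coeffs {i} \<subseteq> centralizer T" "x i \<in> centralizer T" for i T
    using T xi_coeffs[OF i] by (intro A_least[OF i centralizer_subring] centralizer_inverse) blast+
  have co: "coeffs {i} \<subseteq> centralizer (coeffs {j} \<union> {x j})" "x i \<in> centralizer (coeffs {j} \<union> {x j})"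
    if "i \<in> I" "j \<in> I" "i \<noteq> j" for i j
  proof -
    have "c * d = d * c" if "c \<in> coeffs {i}" "d \<in> coeffs {j}" for c d
      using that coeffs_mono[of "{i}" I] coeffs_mono[of "{j}" I] \<open>i \<in> I\<close> \<open>j \<in> I\<close> by (intro C_comm) auto
    moreover have "x j * c = c * x j" if "c \<in> coeffs {i}" for c
      by (rule x_coeffs_comm[of j "{i}"]) (use that \<open>i \<in> I\<close> \<open>j \<in> I\<close> \<open>i \<noteq> j\<close> in auto)
    moreover have "x i * c = c * x i" if "c \<in> coeffs {j}" for c
      by (rule x_coeffs_comm[of i "{j}"]) (use that \<open>i \<in> I\<close> \<open>j \<in> I\<close> \<open>i \<noteq> j\<close> in auto)
    ultimately show "coeffs {i} \<subseteq> centralizer (coeffs {j} \<union> {x j})" "x i \<in> centralizer (coeffs {j} \<union> {x j})"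
      using x_comm[OF \<open>i \<in> I\<close> \<open>j \<in> I\<close>] by (auto simp: centralizer_def)
  qed
  have "A i \<subseteq> centralizer (coeffs {j} \<union> {x j})" by (rule cent[OF ij(1) co[OF ij]])
  then have "coeffs {j} \<union> {x j} \<subseteq> centralizer (A i)" by (simp add: centralizer_sym)
  then have "A j \<subseteq> centralizer (A i)" using cent[OF ij(2), of "A i"] by simp
  then show ?thesis using a b by (auto simp: centralizer_def)
qed

lemma A_laurent_loc:
  assumes k: "k \<in> I" and w: "is_weyl \<iota> (rank_one p k) \<theta>"
  shows "A k \<subseteq> laurent_loc {k}"
proof (rule A_least[OF k])
  have S: "{k} \<subseteq> I" using k by simp
  have "x k \<in> normalizer (coeffs {k})" using x_normalizer_gen[OF w] k by simp
  then show "subring (laurent_loc {k}) DD" by (intro laurent_loc_subring[OF S]) simp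
  have sp: "laurent_span {k} \<subseteq> laurent_loc {k}" by (rule laurent_span_loc[OF S])
  show "coeffs {k} \<subseteq> laurent_loc {k}" using coeffs_in_laurent_span[OF S] sp by blast
  have "x k powi a \<in> laurent_loc {k}" for a
  proof -
    have "monomial (0, single k a) \<in> laurent_span {k}" by (rule monomial_in_span) simp
    then show ?thesis using sp by (auto simp: monomial_def incl_one)
  qed
  from this[of 1] this[of "- 1"] show "x k \<in> laurent_loc {k}" "inverse (x k) \<in> laurent_loc {k}" by simp_all
  show "inverse (\<xi> k) \<in> laurent_loc {k}"
    by (rule laurent_locI[OF xi_coeffs[OF k] xi_nonzero[OF k]])
      (simp add: xi_nonzero[OF k] one_in_laurent_span)
qed

abbreviation "M \<equiv> product_group I (\<lambda>i. sub_ring (A i))"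
abbreviation "T \<equiv> tensor_free I A :: ((nat \<Rightarrow> 'd) \<Rightarrow>\<^sub>0 'k) ring"
abbreviation "rels \<equiv> tensor_relations (scalar \<iota>) I A"
abbreviation "J \<equiv> tensor_ideal (scalar \<iota>) I A"

definition mult_all :: "(nat \<Rightarrow> 'd) \<Rightarrow> 'd"
  where "mult_all u = prod_list (map u [1..<Suc n])"

lemma set_dirs_list: "set [1..<Suc n] = I" by auto

lemma M_simps [simp]:
  "carrier M = Pi\<^sub>E I A" "u \<otimes>\<^bsub>M\<^esub> v = (\<lambda>i\<in>I. u i * v i)" "\<one>\<^bsub>M\<^esub> = (\<lambda>i\<in>I. 1)"
  by simp_all

lemma one_M: "(\<lambda>i\<in>I. 1) \<in> Pi\<^sub>E I A"
  by (rule restrict_PiE_iff[THEN iffD2]) (rule ballI, rule subringD(1)[OF A_subring])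

lemma M_monoid: "monoid M"
proof (rule monoidI, unfold M_simps)
  fix u assume u: "u \<in> Pi\<^sub>E I A"
  show "(\<lambda>i\<in>I. (\<lambda>i\<in>I. 1) i * u i) = u" "(\<lambda>i\<in>I. u i * (\<lambda>i\<in>I. 1) i) = u"
    by (rule ext; use PiE_arb[OF u] in \<open>simp add: restrict_def\<close>)+
  fix v assume v: "v \<in> Pi\<^sub>E I A"
  show "(\<lambda>i\<in>I. u i * v i) \<in> Pi\<^sub>E I A"
    unfolding restrict_PiE_iff using subringD(6)[OF A_subring] PiE_mem[OF u] PiE_mem[OF v] by blast
  fix w assume "w \<in> Pi\<^sub>E I A"
  show "(\<lambda>i\<in>I. (\<lambda>i\<in>I. u i * v i) i * w i) = (\<lambda>i\<in>I. u i * (\<lambda>i\<in>I. v i * w i) i)"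
    by (rule restrict_ext) (simp add: mult.assoc)
qed (rule one_M)

lemma T_ring: "ring T"
  unfolding tensor_free_def by (rule monoid_ring_ring[OF M_monoid])

lemma mult_all_mult:
  assumes "u \<in> Pi\<^sub>E I A" "v \<in> Pi\<^sub>E I A"
  shows "mult_all (\<lambda>i\<in>I. u i * v i) = mult_all u * mult_all v"
proof -
  have "mult_all (\<lambda>i\<in>I. u i * v i) = prod_list (map (\<lambda>i. u i * v i) [1..<Suc n])"
    unfolding mult_all_def by (intro arg_cong[of _ _ prod_list] map_cong refl) (auto simp: set_dirs_list)
  also have "\<dots> = mult_all u * mult_all v"
    unfolding mult_all_def
  proof (rule prod_list_mult_commuting)
    fix i j assume "i \<in> set [1..<Suc n]" "j \<in> set [1..<Suc n]" "i \<noteq> j"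
    then show "u i * v j = v j * u i"
      using assms unfolding set_dirs_list by (intro A_comm) auto
  qed simp
  finally show ?thesis .
qed

lemma mult_all_one: "mult_all (\<lambda>i\<in>I. 1) = 1"
proof -
  have "map (\<lambda>i\<in>I. 1) [1..<Suc n] = map (\<lambda>_. 1 :: 'd) [1..<Suc n]"
    by (intro map_cong refl) (auto simp: set_dirs_list)
  moreover have "prod_list (map (\<lambda>_. 1 :: 'd) L) = 1" for L :: "nat list" by (induction L) auto
  ultimately show ?thesis by (simp only: mult_all_def)
qed

lemma upd_PiE: "\<lbrakk>u \<in> Pi\<^sub>E I A; i \<in> I; a \<in> A i\<rbrakk> \<Longrightarrow> u(i := a) \<in> Pi\<^sub>E I A"
  by (auto simp: PiE_iff extensional_def)

lemma rels_cases:
  assumes "r \<in> rels"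
  obtains u i a b where "u \<in> Pi\<^sub>E I A" "i \<in> I" "a \<in> A i" "b \<in> A i"
      "r = single (u(i := a + b)) 1 - single (u(i := a)) 1 - single (u(i := b)) 1"
    | u i a c where "u \<in> Pi\<^sub>E I A" "i \<in> I" "a \<in> A i"
      "r = single (u(i := scalar \<iota> c * a)) 1 - single (u(i := a)) c"
  using assms unfolding tensor_relations_def by blast

lemma rels_carrier: "rels \<subseteq> carrier T"
proof
  have diff: "keys (p - q) \<subseteq> S" if "keys p \<subseteq> S" "keys q \<subseteq> S"
    for p q :: "(nat \<Rightarrow> 'd) \<Rightarrow>\<^sub>0 'k" and S using that keys_diff[of p q] by blast
  have sing: "keys (single w c) \<subseteq> Pi\<^sub>E I A" if "w \<in> Pi\<^sub>E I A" for w and c :: 'k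
    using that by simp
  fix r assume "r \<in> rels"
  then have "keys r \<subseteq> Pi\<^sub>E I A"
  proof (cases rule: rels_cases)
    case (1 u i a b)
    show ?thesis unfolding 1(5)
      by (intro diff sing upd_PiE[OF 1(1,2)] subringD(4)[OF A_subring] 1(3,4))
  next
    case (2 u i a c)
    show ?thesis unfolding 2(4)
      by (intro diff sing upd_PiE[OF 2(1,2)] A_scale 2(3))
  qed
  then show "r \<in> carrier T" by (simp add: tensor_free_def)
qed

abbreviation ev :: "((nat \<Rightarrow> 'd) \<Rightarrow>\<^sub>0 'k) \<Rightarrow> 'd"
  where "ev \<equiv> eval_map (scalar \<iota>) mult_all"

lemma ev_rels:
  assumes "r \<in> rels"
  shows "ev r = 0"
  using assms
proof (cases rule: rels_cases)
  case (1 u i a b)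
  obtain g h where "\<forall>z. mult_all (u(i := z)) = g * z * h"
    using prod_list_fun_upd[of "[1..<Suc n]" i u] 1(2) unfolding mult_all_def set_dirs_list by auto
  then show ?thesis unfolding 1(5) by (simp add: distrib_left distrib_right)
next
  case (2 u i a c)
  obtain g h where gh: "\<forall>z. mult_all (u(i := z)) = g * z * h"
    using prod_list_fun_upd[of "[1..<Suc n]" i u] 2(2) unfolding mult_all_def set_dirs_list by auto
  have "g * (scalar \<iota> c * a) * h = scalar \<iota> c * (g * a * h)"
    unfolding scalar_pull by (simp only: mult.assoc)
  then show ?thesis unfolding 2(4) by (simp add: gh)
qed

lemma J_ideal: "ideal J T"
  unfolding tensor_ideal_def by (rule ring.genideal_ideal[OF T_ring rels_carrier])

lemmas J_props = monoid_ring_ideal[OF M_monoid J_ideal[unfolded tensor_free_def], unfolded M_simps]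

lemma rels_J: "r \<in> rels \<Longrightarrow> r \<in> J"
  using ring.genideal_self[OF T_ring rels_carrier] by (auto simp: tensor_ideal_def)

lemma scale_J:
  assumes "r \<in> J"
  shows "single (\<lambda>i\<in>I. 1) c \<otimes>\<^bsub>monoid_ring M\<^esub> r \<in> J"
  using assms one_M by (intro J_props(5)) auto

lemma scale_single: "u \<in> Pi\<^sub>E I A \<Longrightarrow>
    single (\<lambda>i\<in>I. 1) c \<otimes>\<^bsub>monoid_ring M\<^esub> single u a = single u (c * a)"
  using monoid.l_one[OF M_monoid, of u] by simp

lemma single_add_J:
  assumes "u \<in> Pi\<^sub>E I A" "i \<in> I" "a \<in> A i" "b \<in> A i"
  shows "single (u(i := a + b)) c - single (u(i := a)) c - single (u(i := b)) c \<in> J"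
proof -
  have "single (u(i := a + b)) 1 - single (u(i := a)) 1 - single (u(i := b)) 1 \<in> rels"
    using assms unfolding tensor_relations_def by blast
  from scale_J[OF rels_J[OF this], of c]
  show ?thesis using upd_PiE[OF assms(1,2)] assms(3,4) subringD(4)[OF A_subring assms(3,4)]
    by (simp only: monoid_ring_mult_diff scale_single mult_1_right)
qed

lemma single_scale_J:
  assumes "u \<in> Pi\<^sub>E I A" "i \<in> I" "a \<in> A i"
  shows "single (u(i := scalar \<iota> d * a)) c - single (u(i := a)) (c * d) \<in> J"
proof -
  have "single (u(i := scalar \<iota> d * a)) 1 - single (u(i := a)) d \<in> rels"
    using assms unfolding tensor_relations_def by blast
  from scale_J[OF rels_J[OF this], of c]
  show ?thesis using upd_PiE[OF assms(1,2)] assms(3) A_scale[OF assms(3)]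
    by (simp only: monoid_ring_mult_diff scale_single mult_1_right)
qed

text \<open>
  If each \<open>B i\<close> spans its factor, then by multilinearity the coordinates of a family can be replaced by
  elements of the \<open>B i\<close> one at a time.
\<close>

lemma tensor_basis_reduction:
  assumes B: "\<And>i. i \<in> I \<Longrightarrow> B i \<subseteq> A i \<and> A i \<subseteq> V.span (B i)" and r: "keys r \<subseteq> Pi\<^sub>E I A"
  shows "\<exists>q. keys q \<subseteq> Pi\<^sub>E I B \<and> r - q \<in> J"
proof -
  define red where "red v \<longleftrightarrow> (\<exists>q. keys q \<subseteq> Pi\<^sub>E I B \<and> v - q \<in> J)" for v :: "(nat \<Rightarrow> 'd) \<Rightarrow>\<^sub>0 'k"
  have red0: "red v" if "v \<in> J" for v
    unfolding red_def using that by (intro exI[of _ 0]) simp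
  have red_add: "red (v + q)" if "red v" "red q" for v q
  proof -
    obtain v' q' where "keys v' \<subseteq> Pi\<^sub>E I B" "v - v' \<in> J" "keys q' \<subseteq> Pi\<^sub>E I B" "q - q' \<in> J"
      using \<open>red v\<close> \<open>red q\<close> unfolding red_def by blast
    then show ?thesis
      unfolding red_def using keys_add_le[of v' "Pi\<^sub>E I B" q'] J_props(2)[of "v - v'" "q - q'"]
      by (intro exI[of _ "v' + q'"]) (simp add: algebra_simps)
  qed
  have red_cong: "red v" if "red q" "v - q \<in> J" for v q
    using red_add[OF red0[OF that(2)] that(1)] by simp
  have single_red: "red (single u c)"
    if "finite S" "u \<in> Pi\<^sub>E I A" "S \<subseteq> I" "\<And>i. i \<in> I - S \<Longrightarrow> u i \<in> B i" for S u c
    using that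
  proof (induction S arbitrary: u c rule: finite_induct)
    case empty
    then have "u \<in> Pi\<^sub>E I B" by (auto simp: PiE_iff)
    then show ?case
      unfolding red_def using J_props(1) by (intro exI[of _ "single u c"]) simp
  next
    case (insert i S)
    have i: "i \<in> I" using insert.prems by simp
    have up: "u(i := a) \<in> Pi\<^sub>E I A" if "a \<in> A i" for a by (rule upd_PiE[OF insert.prems(1) i that])
    have basis: "red (single (u(i := b)) c)" if b: "b \<in> B i" for b c
    proof (rule insert.IH)
      show "u(i := b) \<in> Pi\<^sub>E I A" using up b B[OF i] by blast
      show "S \<subseteq> I" using insert.prems by simp
      show "(u(i := b)) j \<in> B j" if "j \<in> I - S" for j using insert.prems(3)[of j] that b by (cases "j = i") auto
    qed
    have "z \<in> A i \<and> (\<forall>c. red (single (u(i := z)) c))" if "z \<in> V.span (B i)" for z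
      using that
    proof (induction rule: V.span_induct_alt)
      case base
      have "single (u(i := scalar \<iota> 0 * 0)) c - single (u(i := 0)) (c * 0) \<in> J" for c
        by (rule single_scale_J[OF insert.prems(1) i subringD(2)[OF A_subring]])
      then have "single (u(i := 0)) c \<in> J" for c by simp
      then show ?case using red0 subringD(2)[OF A_subring] by blast
    next
      case (step d b y)
      have b: "b \<in> A i" and y: "y \<in> A i" using step B[OF i] by blast+
      have db: "scalar \<iota> d * b \<in> A i" by (rule A_scale[OF b])
      have "red (single (u(i := scalar \<iota> d * b + y)) c)" for c
      proof -
        have 1: "red (single (u(i := scalar \<iota> d * b)) c)"
          by (rule red_cong[OF basis[OF step(1)] single_scale_J[OF insert.prems(1) i b]])
        have 2: "red (single (u(i := y)) c)" using step by blast
        show ?thesis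
          by (rule red_cong[OF red_add[OF 1 2]])
            (use single_add_J[OF insert.prems(1) i db y, of c] in \<open>simp only: diff_diff_eq\<close>)
      qed
      then show ?case using subringD(4)[OF A_subring db y] by blast
    qed
    moreover have "u i \<in> V.span (B i)" using insert.prems(1) i B[OF i] by (auto simp: PiE_iff)
    ultimately have "red (single (u(i := u i)) c)" by blast
    then show ?case by simp
  qed
  have "red r" using r
  proof (induction r rule: poly_mapping_support_induct)
    case zero
    show ?case by (rule red0[OF J_props(1)])
  next
    case (single u c)
    show ?case by (rule single_red[of I, OF _ single]) simp_all
  next
    case (add r s)
    then show ?case by (intro red_add)
  qed
  then show ?thesis by (simp add: red_def)
qed

text \<open>
  Reduced to basis elements, an element of the kernel is a linear relation between products of basis elements.
\<close>

lemma tensor_kernel: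
  assumes w: "\<And>k. k \<in> I \<Longrightarrow> is_weyl \<iota> (rank_one p k) \<theta>"
    and r: "keys r \<subseteq> Pi\<^sub>E I A" "ev r = 0" and ev_J: "\<And>r. r \<in> J \<Longrightarrow> ev r = 0"
  shows "r \<in> J"
proof -
  have "\<forall>i. \<exists>B. B \<subseteq> A i \<and> V.independent B \<and> A i \<subseteq> V.span B"
  proof
    fix i
    obtain B where "B \<subseteq> A i" "V.independent B" "A i \<subseteq> V.span B" by (rule V.maximal_independent_subset[of "A i"])
    then show "\<exists>B. B \<subseteq> A i \<and> V.independent B \<and> A i \<subseteq> V.span B" by (intro exI[of _ B] conjI)
  qed
  from choice[OF this] obtain B where B': "\<forall>i. B i \<subseteq> A i \<and> V.independent (B i) \<and> A i \<subseteq> V.span (B i)" ..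
  then have B: "B i \<subseteq> A i" "V.independent (B i)" "A i \<subseteq> V.span (B i)" for i by simp_all
  obtain q where q: "keys q \<subseteq> Pi\<^sub>E I B" "r - q \<in> J"
    using tensor_basis_reduction[OF conjI[OF B(1,3)] r(1)] by (elim exE conjE)
  have "ev q = 0" using ev_J[OF q(2)] r(2) by simp
  then have s: "(\<Sum>w\<in>keys q. scalar \<iota> (lookup q w) * prod_list (map w [1..<Suc n])) = 0"
    by (simp only: eval_map_def mult_all_def)
  have "keys q = {}"
  proof (rule ccontr)
    assume "keys q \<noteq> {}"
    then obtain w where wq: "w \<in> keys q" by blast
    have "lookup q w = 0"
    proof (rule basis_products_independent[of B n, OF _ order_refl finite_keys _ _ s wq])
      show "B i \<subseteq> laurent_loc {i} \<and> V.independent (B i)" if "i \<in> I" for i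
        using B(1,2) A_laurent_loc[OF that w[OF that]] by blast
      show "v i \<in> B i" if "v \<in> keys q" "i \<in> I" for v i
        by (rule PiE_mem[OF subsetD[OF q(1) that(1)] that(2)])
      show "inj_on (\<lambda>v. restrict v I) (keys q)"
      proof (rule inj_onI)
        fix u v assume "u \<in> keys q" "v \<in> keys q" and e: "restrict u I = restrict v I"
        then have "u \<in> Pi\<^sub>E I B" "v \<in> Pi\<^sub>E I B" using q(1) by (simp_all add: subsetD)
        then show "u = v" using e PiE_restrict[of u I B] PiE_restrict[of v I B] by simp
      qed
    qed
    then show False using wq by (simp add: in_keys_iff)
  qed
  then have "q = 0" by simp
  then show ?thesis using q(2) by simp
qed

lemma A_sub_cluster_algebra: "k \<in> I \<Longrightarrow> A k \<subseteq> weyl_cluster_algebra \<iota> p"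
  unfolding weyl_cluster_algebra_def
proof (rule generate_ring_mono)
  assume k: "k \<in> I"
  have "coeffs {k} \<subseteq> C" by (rule coeffs_mono) (use k in simp)
  moreover have "cluster_vars \<iota> (rank_one p k) \<subseteq> cluster_vars \<iota> p"
    using k unfolding cluster_vars_rank_one[of \<iota> p] dirs_p by (rule UN_upper)
  ultimately show "coeff_ring \<iota> (rank_one p k) \<union> cluster_vars \<iota> (rank_one p k)
      \<subseteq> generate_ring DD (coeff_ring \<iota> p \<union> cluster_vars \<iota> p)"
    unfolding coeff_ring_rank_one coeff_ring_p by (auto intro!: generate_ring.incl)
qed

lemma cluster_algebra_least:
  assumes P: "subring P DD" and A: "\<And>k. k \<in> I \<Longrightarrow> A k \<subseteq> P"
  shows "weyl_cluster_algebra \<iota> p \<subseteq> P"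
  unfolding weyl_cluster_algebra_def
proof (rule generate_ring_least[OF P])
  have "C \<subseteq> P"
  proof (rule coeffs_least[OF subset_refl P])
    have 1: "1 \<in> I" using rank_pos by simp
    show "scalar \<iota> c \<in> P" for c using A[OF 1] scalar_A by blast
    fix i f assume i: "i \<in> I" and f: "f \<in> F i"
    have "\<iota> (frozen_var f) \<in> coeffs {i}" "inverse (\<iota> (frozen_var f)) \<in> coeffs {i}"
      using frozen_coeffs[of i "{i}"] frozen_inverse_coeffs(2)[of "{i}" i] i f by simp_all
    then show "\<iota> (frozen_var f) \<in> P" "inverse (\<iota> (frozen_var f)) \<in> P"
      using coeffs_A[of i] A[OF i] by blast+
  qed
  moreover have "cluster_vars \<iota> p \<subseteq> P"
  proof -
    have "cluster_vars \<iota> (rank_one p k) \<subseteq> A k" for k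
      unfolding weyl_cluster_algebra_def by (auto intro: generate_ring.incl)
    then show ?thesis using A unfolding cluster_vars_rank_one[of \<iota> p] dirs_p by blast
  qed
  ultimately show "coeff_ring \<iota> p \<union> cluster_vars \<iota> p \<subseteq> P" by simp
qed

lemma ev_hom: "ring_hom_ring T DD ev"
proof (intro ring_hom_ringI2 T_ring ring_DD ring_hom_memI, unfold tensor_free_def)
  fix r s :: "(nat \<Rightarrow> 'd) \<Rightarrow>\<^sub>0 'k"
  assume rs: "r \<in> carrier (monoid_ring M)" "s \<in> carrier (monoid_ring M)"
  then show "ev (r \<otimes>\<^bsub>monoid_ring M\<^esub> s) = ev r \<otimes>\<^bsub>DD\<^esub> ev s"
    by (subst scal.eval_map_mult) (simp_all only: M_simps monoid_ring_simps mem_Collect_eq mult_all_mult DD_simps)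
qed (simp_all add: mult_all_one)

lemma ev_image: "ev ` carrier T = weyl_cluster_algebra \<iota> p"
proof (rule subset_antisym)
  let ?W = "weyl_cluster_algebra \<iota> p"
  have W: "subring ?W DD" unfolding weyl_cluster_algebra_def by (rule generate_ring_subring)
  have 1: "1 \<in> I" using rank_pos by simp
  have sc: "scalar \<iota> c \<in> ?W" for c using A_sub_cluster_algebra[OF 1] scalar_A by blast
  have m: "mult_all u \<in> ?W" if "u \<in> Pi\<^sub>E I A" for u
    unfolding mult_all_def
    by (rule subring_prod_list[OF W]) (use that A_sub_cluster_algebra in \<open>auto simp only: set_dirs_list PiE_mem dest: PiE_mem\<close>)
  show "ev ` carrier T \<subseteq> ?W"
  proof
    fix z assume "z \<in> ev ` carrier T"
    then obtain r where r: "z = ev r" "keys r \<subseteq> Pi\<^sub>E I A"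
      unfolding tensor_free_def monoid_ring_simps M_simps by blast
    show "z \<in> ?W"
      unfolding r(1) eval_map_def using r(2)
      by (intro subring_sum[OF W] subringD(6)[OF W] sc m) blast
  qed
  have sub: "subring (ev ` carrier T) DD"
    by (rule ring_hom_ring.img_is_subring[OF ev_hom ring.carrier_is_subring[OF T_ring]])
  show "?W \<subseteq> ev ` carrier T"
  proof (rule cluster_algebra_least[OF sub], rule subsetI)
    fix k a assume k: "k \<in> I" and a: "a \<in> A k"
    let ?u = "(\<lambda>i\<in>I. 1)(k := a)"
    have u: "?u \<in> Pi\<^sub>E I A" by (rule upd_PiE[OF one_M k a])
    have "mult_all ?u = prod_list (map ((\<lambda>_. 1)(k := a)) [1..<Suc n])"
      unfolding mult_all_def by (intro arg_cong[of _ _ prod_list] map_cong refl) (simp only: set_dirs_list fun_upd_apply restrict_apply if_True)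
    also have "\<dots> = a" by (rule prod_list_single_factor) (use k in \<open>auto simp only: set_dirs_list distinct_upt\<close>)
    finally have "a = ev (single ?u 1)" by simp
    moreover have "single ?u 1 \<in> carrier T"
      using u by (simp only: tensor_free_def monoid_ring_simps M_simps mem_Collect_eq) simp
    ultimately show "a \<in> ev ` carrier T" by (rule image_eqI)
  qed
qed

lemma tensor_decomposition:
  assumes w: "\<And>k. k \<in> I \<Longrightarrow> is_weyl \<iota> (rank_one p k) \<theta>"
  shows "\<exists>h. h \<in> ring_iso (sub_ring (weyl_cluster_algebra \<iota> p)) (tensor_algebra (scalar \<iota>) I A) \<and>
    (\<forall>c. h (scalar \<iota> c) = tensor_scalar (scalar \<iota>) I A c)"
proof -
  let ?W = "weyl_cluster_algebra \<iota> p" and ?g = "\<lambda>Y. the_elem (ev ` Y)"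
  have W: "subring ?W DD" unfolding weyl_cluster_algebra_def by (rule generate_ring_subring)
  have hm: "mult_all (u \<otimes>\<^bsub>M\<^esub> v) = mult_all u * mult_all v" if "u \<in> carrier M" "v \<in> carrier M" for u v
    using that unfolding M_simps by (rule mult_all_mult)
  have h1: "mult_all \<one>\<^bsub>M\<^esub> = 1" unfolding M_simps by (rule mult_all_one)
  have ev_J: "ev r = 0" if "r \<in> J" for r
  proof -
    have "J \<subseteq> a_kernel T DD ev"
      unfolding tensor_ideal_def
    proof (rule ring.genideal_minimal[OF T_ring ring_hom_ring.kernel_is_ideal[OF ev_hom]])
      show "rels \<subseteq> a_kernel T DD ev"
        using rels_carrier ev_rels unfolding a_kernel_def' by auto
    qed
    then show ?thesis using that unfolding a_kernel_def' by auto
  qed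
  have ker: "r \<in> Idl\<^bsub>monoid_ring M\<^esub> rels" if "keys r \<subseteq> carrier M" "ev r = 0" for r
    using tensor_kernel[OF w _ that(2) ev_J] that(1) unfolding tensor_ideal_def tensor_free_def M_simps by blast
  note pres = scal.presentation_iso[where M = M and h = mult_all and A = ?W and Rel = rels,
      OF M_monoid W hm h1 ev_image[unfolded tensor_free_def] rels_carrier[unfolded tensor_free_def]]
  have iso: "?g \<in> ring_iso (tensor_algebra (scalar \<iota>) I A) (sub_ring ?W)"
    unfolding tensor_algebra_def tensor_ideal_def tensor_free_def
    by (rule pres(1); (assumption | erule ev_rels | erule (1) ker))
  have val: "?g (J +>\<^bsub>T\<^esub> r) = ev r" if "keys r \<subseteq> carrier M" for r
    unfolding tensor_ideal_def tensor_free_def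
    by (rule pres(2)[OF _ _ _ _ that]; (assumption | erule ev_rels | erule (1) ker))
  let ?h = "inv_into (carrier (tensor_algebra (scalar \<iota>) I A)) ?g"
  interpret T: ring T by (rule T_ring)
  have ring_Q: "ring (tensor_algebra (scalar \<iota>) I A)"
    unfolding tensor_algebra_def by (rule ideal.quotient_is_ring[OF J_ideal])
  have "?h \<in> ring_iso (sub_ring ?W) (tensor_algebra (scalar \<iota>) I A)"
    by (rule ring_iso_set_sym[OF ring_Q iso])
  moreover have "?h (scalar \<iota> c) = tensor_scalar (scalar \<iota>) I A c" for c
  proof -
    let ?s = "single (\<lambda>i\<in>I. 1) c"
    have k: "keys ?s \<subseteq> carrier M" using one_M unfolding M_simps by simp
    have "tensor_scalar (scalar \<iota>) I A c \<in> carrier (tensor_algebra (scalar \<iota>) I A)"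
      unfolding tensor_scalar_def tensor_algebra_def FactRing_def partial_object.simps
    proof (rule T.a_rcosetsI)
      show "J \<subseteq> carrier T" using J_props(7) by (auto simp only: tensor_free_def monoid_ring_simps M_simps)
      show "?s \<in> carrier T" using k by (simp only: tensor_free_def monoid_ring_simps mem_Collect_eq)
    qed
    moreover have "?g (tensor_scalar (scalar \<iota>) I A c) = scalar \<iota> c"
      unfolding tensor_scalar_def val[OF k] by (simp add: mult_all_one)
    moreover have "inj_on ?g (carrier (tensor_algebra (scalar \<iota>) I A))"
      using iso by (simp add: ring_iso_def bij_betw_def)
    ultimately show ?thesis by (intro inv_into_f_eq)
  qed
  ultimately show ?thesis by blast
qed

end

theorem theorem4p12:
  fixes n :: nat
    and F :: "nat \<Rightarrow> 'f set"
    and \<iota> :: "('f, 'k::field_char_0) gring \<Rightarrow> 'd::division_ring"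
    and D :: "nat \<Rightarrow> 'd set"
    and t :: "nat \<Rightarrow> 'd"
    and p :: "('f, 'd) preseed"
    and \<theta> :: "nat \<Rightarrow> 'd \<Rightarrow> 'd"
  assumes "ambient n F \<iota> D t"
    and "is_preseed n F \<iota> D t p"
    and "is_weyl \<iota> p \<theta>"
    and "exchange_vars_free \<iota> p"
  shows
    "(\<forall>k\<in>{1..n}.
        (\<exists>\<psi>. induced_iso (mut_R \<iota>) \<iota> p k \<psi>) \<and>
        (\<exists>\<psi>. induced_iso (mut_L \<iota>) \<iota> p k \<psi>) \<and>
        (gwa_datum (exchange_ring \<iota> p) {1..n} \<theta> (exchange_poly \<iota> p) \<and>
         (\<forall>i\<in>{1..n}. \<forall>c. \<theta> i (scalar \<iota> c) = scalar \<iota> c) \<longrightarrow>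
           HR_is_gwa \<iota> p \<theta> \<and> HR_is_gwa \<iota> (mut_R \<iota> k p) (\<theta>(k := inv_into UNIV (\<theta> k))) \<and>
           HL_is_gwa \<iota> p \<theta> \<and> HL_is_gwa \<iota> (mut_L \<iota> k p) (\<theta>(k := inv_into UNIV (\<theta> k)))))
     \<and> (laurent_independent (laurent_coeff_ring \<iota> p \<theta>) {1..n} (exch p) \<and>
        subring (weyl_cluster_algebra \<iota> p)
          (sub_ring (laurent_ring (laurent_coeff_ring \<iota> p \<theta>) {1..n} (exch p))))
     \<and> ((\<forall>k\<in>{1..n}. is_weyl \<iota> (rank_one p k) \<theta>) \<longrightarrow>
        (\<exists>h. h \<in> ring_iso (sub_ring (weyl_cluster_algebra \<iota> p))
               (tensor_algebra (scalar \<iota>) {1..n} (\<lambda>k. weyl_cluster_algebra \<iota> (rank_one p k))) \<and>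
             (\<forall>c. h (scalar \<iota> c) =
               tensor_scalar (scalar \<iota>) {1..n} (\<lambda>k. weyl_cluster_algebra \<iota> (rank_one p k)) c)))"
proof -
  interpret weyl_preseed n F \<iota> D t p \<theta>
    by (intro weyl_preseed.intro weyl_preseed_axioms.intro assms)
  show ?thesis
  proof (intro conjI ballI impI)
    fix k assume k: "k \<in> {1..n}"
    show "\<exists>\<psi>. induced_iso (mut_R \<iota>) \<iota> p k \<psi>" by (rule induced_iso_R[OF k])
    show "\<exists>\<psi>. induced_iso (mut_L \<iota>) \<iota> p k \<psi>" by (rule induced_iso_L[OF k])
    assume H: "gwa_datum (exchange_ring \<iota> p) {1..n} \<theta> (exchange_poly \<iota> p) \<and>
         (\<forall>i\<in>{1..n}. \<forall>c. \<theta> i (scalar \<iota> c) = scalar \<iota> c)"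
    then have sc: "\<theta> i (scalar \<iota> c) = scalar \<iota> c" if "i \<in> {1..n}" for i c using that by blast
    show "HR_is_gwa \<iota> p \<theta>" by (rule HR_gwa(1)[OF conjunct1[OF H] sc k])
    show "HR_is_gwa \<iota> (mut_R \<iota> k p) (\<theta>(k := inv_into UNIV (\<theta> k)))" by (rule HR_gwa(2)[OF conjunct1[OF H] sc k])
    show "HL_is_gwa \<iota> p \<theta>" by (rule HL_gwa(1)[OF conjunct1[OF H] sc k])
    show "HL_is_gwa \<iota> (mut_L \<iota> k p) (\<theta>(k := inv_into UNIV (\<theta> k)))" by (rule HL_gwa(2)[OF conjunct1[OF H] sc k])
  next
    show "laurent_independent (laurent_coeff_ring \<iota> p \<theta>) {1..n} (exch p)" by (rule laurent_coeff_independent)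
    show "subring (weyl_cluster_algebra \<iota> p) (sub_ring (laurent_ring (laurent_coeff_ring \<iota> p \<theta>) {1..n} (exch p)))"
      by (rule weyl_cluster_algebra_laurent)
  next
    assume "\<forall>k\<in>{1..n}. is_weyl \<iota> (rank_one p k) \<theta>"
    then show "\<exists>h. h \<in> ring_iso (sub_ring (weyl_cluster_algebra \<iota> p))
               (tensor_algebra (scalar \<iota>) {1..n} (\<lambda>k. weyl_cluster_algebra \<iota> (rank_one p k))) \<and>
             (\<forall>c. h (scalar \<iota> c) =
               tensor_scalar (scalar \<iota>) {1..n} (\<lambda>k. weyl_cluster_algebra \<iota> (rank_one p k)) c)"
      by (intro tensor_decomposition) blast
  qed
qed

end
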